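(* Let $Z_1, Z_2, \ldots$ be i.i.d. standard normal random variables and, for $n \ge 2$, let $\tilde I_n$ be the cluster index computed from $Z_1,\ldots,Z_n$, namely $$\tilde I_n = \max_{1\le i\le n-1} \; \frac{i(n-i)}{n^2}\,\frac{\left(\bar Z_{[i+1,n]} - \bar Z_{[1,i]}\right)\left(Z_{(i+1)} - Z_{(i)}\right)}{\frac1n\sum_{j=1}^n (Z_j - \bar Z)^2}.$$ Then for every $x \in \mathbb{R}$, $$\lim_{n \to +\infty} P\left[n\tilde I_n < x + \log n\right] = \exp\{-\exp\{-x\}\}.$$
   Context: $Z_{(1)} \le \cdots \le Z_{(n)}$ are the order statistics of $Z_1,\ldots,Z_n$; $\bar Z = \frac1n\sum_{j=1}^n Z_j$ is the sample mean; for $i \le j$, $\bar Z_{[i,j]} = \frac{1}{j-i+1}\sum_{k=i}^{j} Z_{(k)}$ is the average of the order statistics from the $i$th to the $j$th. $\log$ is the natural logarithm. *)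

theory Defs
  imports "HOL-Probability.Probability"
begin

text \<open>
  A sample \<open>Z\<^sub>1, \<dots>, Z\<^sub>n\<close> is the initial segment, with indices \<open>1, \<dots>, n\<close>, of a real sequence
  \<open>z\<close>; the value \<open>z 0\<close> is never used. Order statistics are indexed from \<open>1\<close> as well, while list
  positions start at \<open>0\<close>. They are meaningful for \<open>1 \<le> k \<le> n\<close> only.
\<close>

definition order_stat :: "(nat \<Rightarrow> real) \<Rightarrow> nat \<Rightarrow> nat \<Rightarrow> real" where
  "order_stat z n k = sort (map z [1..<Suc n]) ! (k - 1)"

definition sample_mean :: "(nat \<Rightarrow> real) \<Rightarrow> nat \<Rightarrow> real" where
  "sample_mean z n = (1 / real n) * (\<Sum>j=1..n. z j)"

definition segment_mean :: "(nat \<Rightarrow> real) \<Rightarrow> nat \<Rightarrow> nat \<Rightarrow> nat \<Rightarrow> real" where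
  "segment_mean z n i j = (1 / (real j - real i + 1)) * (\<Sum>k=i..j. order_stat z n k)"

text \<open>
  For \<open>n < 2\<close> the maximum ranges over the empty set and is unspecified. For a sample with zero
  variance the denominator vanishes and the index is \<open>0\<close>, by the convention \<open>x / 0 = 0\<close>.
\<close>

definition cluster_index :: "(nat \<Rightarrow> real) \<Rightarrow> nat \<Rightarrow> real" where
  "cluster_index z n =
    Max ((\<lambda>i. real i * (real n - real i) / (real n)\<^sup>2 *
          ((segment_mean z n (i + 1) n - segment_mean z n 1 i) *
             (order_stat z n (i + 1) - order_stat z n i) /
           ((1 / real n) * (\<Sum>j=1..n. (z j - sample_mean z n)\<^sup>2))))
         ` {1..n - 1})"

end

theory Submission
  imports Defs "HOL-Real_Asymp.Real_Asymp"
begin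

text \<open>
  Write \<open>H t\<close> for the sum of \<open>z k - m\<close> over the sample points above \<open>t\<close>, where \<open>m\<close> is
  the sample mean (\<open>upper_excess\<close>), and \<open>V\<close> for the sample variance. Because deviations from
  the mean sum to zero, the weight \<open>i (n - i) / n\<^sup>2\<close> times the difference of the
  two segment means is \<open>H / n\<close> at the \<open>i\<close>-th order statistic. So \<open>n\<close> times the cluster
  index is the maximum, over consecutive sample points \<open>a < b\<close>, of
  \<open>H a * (b - a) / V\<close> (\<open>cluster_index_less_iff\<close>).

  For Gaussian data \<open>V\<close> is close to \<open>1\<close> and \<open>H t\<close> is close to \<open>n \<phi> t\<close>, since the
  integral of \<open>v \<phi> v\<close> over \<open>v > t\<close> is \<open>\<phi> t\<close>. A gap therefore counts as large
  when its length exceeds \<open>c / (n \<phi> a)\<close> with \<open>c\<close> near \<open>x + ln n\<close>, that is, when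
  an interval of Gaussian mass about \<open>c / n\<close> to the right of a sample point is empty. The
  expected number of sample points with such an empty right neighbourhood is about
  \<open>n (1 - c / n) ^ n\<close>, which tends to \<open>exp (- x)\<close>. Its binomial moments converge to
  those of a Poisson variable, because distinct empty intervals are disjoint, so that \<open>r\<close> of
  them are avoided by the other points with probability about \<open>(1 - r c / n) ^ n\<close>; by
  the Bonferroni inequalities the probability that there is no such point tends to
  \<open>exp (- exp (- x))\<close> (\<open>no_isolated_point_limit\<close>).

  The substitution of \<open>n \<phi> t\<close> for \<open>H t\<close> must be accurate to a relative error of
  smaller order than \<open>1 / ln n\<close>. On the bulk \<open>\<bar>t\<bar> \<le> L\<close> with
  \<open>L = 2/3 sqrt (2 ln n)\<close> this follows from Chebyshev's inequality on a grid with
  polylogarithmically many points (\<open>upper_excess_uniform\<close>): there \<open>n \<phi> t\<close> is at least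
  of order \<open>n powr (5/9)\<close>, while the fluctuations are of order \<open>sqrt n\<close>. In the tails no
  approximation of \<open>H\<close> is available, but a crude bound suffices: if \<open>k\<close> points lie above
  \<open>a\<close>, then \<open>H a \<le> k (B + 1)\<close>, where \<open>B\<close> bounds the absolute values of all sample
  points and the mean lies between \<open>- 1\<close> and \<open>1\<close>, and the hazard rate of the Gaussian at
  \<open>a\<close> is at least \<open>a\<close>, so the next point is farther away than \<open>s / k\<close> with conditional
  probability at most \<open>exp (- s a)\<close>, whatever \<open>k\<close> is (\<open>prob_wide_gap_le\<close>). With \<open>s\<close> close
  to \<open>ln n / B\<close>, summing over the sample points in the tail gives a negative power of
  \<open>n\<close>. The lower tail is the upper tail of the reflected sample. On the event that all these
  approximations hold, the event of the theorem lies between two events of the form treated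
  by the Poisson argument, for two sequences \<open>c\<close> with the same limit of \<open>c - ln n\<close>
  (\<open>typical_sandwich\<close>).
\<close>

section \<open>The Gaussian density and measure\<close>

abbreviation \<phi> :: "real \<Rightarrow> real" where "\<phi> \<equiv> std_normal_density"

definition gaussian :: "real measure" where "gaussian = density lborel (\<lambda>x. ennreal (\<phi> x))"

lemma phi_shift: "\<phi> (z + s) = \<phi> z * exp (- (z * s + s\<^sup>2 / 2))"
proof -
  have "- (z + s)\<^sup>2 / 2 = - z\<^sup>2 / 2 + - (z * s + s\<^sup>2 / 2)" by (simp add: power2_eq_square field_simps)
  then show ?thesis unfolding std_normal_density_def by (simp only: exp_add mult.assoc)
qed

lemma phi_pos: "\<phi> z > 0" by (rule normal_density_pos) simp

lemma phi_minus: "\<phi> (- z) = \<phi> z" by (simp add: std_normal_density_def)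

lemma phi_shift_bounds:
  assumes "\<bar>t\<bar> \<le> L" "\<bar>p - t\<bar> \<le> h"
  shows "\<phi> t * exp (- ((L + h) * h)) \<le> \<phi> p" "\<phi> p \<le> \<phi> t * exp ((L + h) * h)"
proof -
  define s where "s = p - t"
  have s: "\<bar>s\<bar> \<le> h" using assms by (simp add: s_def)
  have eq: "\<phi> p = \<phi> t * exp (- (t * s + s\<^sup>2 / 2))" using phi_shift[of t s] by (simp add: s_def)
  have "\<bar>t * s\<bar> \<le> L * h" unfolding abs_mult using s assms by (intro mult_mono) auto
  moreover have "s\<^sup>2 \<le> h\<^sup>2" using s by (intro abs_le_square_iff[THEN iffD1]) auto
  moreover have "0 \<le> s\<^sup>2" by simp
  moreover have "(L + h) * h = L * h + h\<^sup>2" by (simp add: power2_eq_square algebra_simps)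
  ultimately have *: "- ((L + h) * h) \<le> - (t * s + s\<^sup>2 / 2)" "- (t * s + s\<^sup>2 / 2) \<le> (L + h) * h"
    by linarith+
  show "\<phi> t * exp (- ((L + h) * h)) \<le> \<phi> p" "\<phi> p \<le> \<phi> t * exp ((L + h) * h)"
    unfolding eq using phi_pos[of t] * by (auto intro!: mult_left_mono)
qed

lemma phi_antimono: "\<bar>t\<bar> \<le> L \<Longrightarrow> \<phi> L \<le> \<phi> t"
proof -
  assume "\<bar>t\<bar> \<le> L"
  then have "t\<^sup>2 \<le> L\<^sup>2" by (intro abs_le_square_iff[THEN iffD1]) auto
  then show ?thesis by (simp add: std_normal_density_def divide_right_mono)
qed

lemma prob_space_gaussian: "prob_space gaussian"
  unfolding gaussian_def by (rule prob_space_normal_density) simp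

lemma sets_gaussian [simp, measurable_cong]: "sets gaussian = sets borel" by (simp add: gaussian_def)
lemma space_gaussian [simp]: "space gaussian = UNIV" by (simp add: gaussian_def)

lemma emeasure_gaussian: "A \<in> sets borel \<Longrightarrow> emeasure gaussian A = (\<integral>\<^sup>+x. ennreal (\<phi> x) * indicator A x \<partial>lborel)"
  unfolding gaussian_def by (subst emeasure_density) auto

interpretation gaussian: prob_space gaussian by (rule prob_space_gaussian)

text \<open>
  The case \<open>s > 0\<close> says that the hazard rate at \<open>z\<close> is at least \<open>z\<close>: the density at
  distance \<open>s\<close> beyond a point \<open>v \<ge> z\<close> is smaller than at \<open>v\<close> by the factor
  \<open>exp (- (v s + s\<^sup>2 / 2))\<close>.
\<close>
lemma measure_gaussian_shift_le:
  assumes "0 \<le> s"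
  shows "measure gaussian {z + s..} \<le> exp (- (s * z + s\<^sup>2 / 2)) * measure gaussian {z..}"
proof -
  have "emeasure gaussian {z + s..} = (\<integral>\<^sup>+x. ennreal (\<phi> x) * indicator {z + s..} x \<partial>lborel)"
    by (simp add: emeasure_gaussian)
  also have "\<dots> = (\<integral>\<^sup>+x. ennreal (\<phi> (s + x)) * indicator {z + s..} (s + x) \<partial>lborel)"
    by (subst nn_integral_real_affine[where c=1 and t=s]) auto
  also have "\<dots> \<le> (\<integral>\<^sup>+x. ennreal (exp (- (s * z + s\<^sup>2 / 2))) * (ennreal (\<phi> x) * indicator {z..} x) \<partial>lborel)"
  proof (intro nn_integral_mono)
    fix x :: real
    show "ennreal (\<phi> (s + x)) * indicator {z + s..} (s + x) \<le> ennreal (exp (- (s * z + s\<^sup>2 / 2))) * (ennreal (\<phi> x) * indicator {z..} x)"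
    proof (cases "z \<le> x")
      case True
      have "\<phi> (s + x) = \<phi> x * exp (- (x * s + s\<^sup>2 / 2))" using phi_shift[of x s] by (simp add: add.commute)
      also have "\<dots> \<le> \<phi> x * exp (- (s * z + s\<^sup>2 / 2))"
        using True assms mult_left_mono[OF True assms] by (intro mult_left_mono) (auto simp: mult.commute)
      finally show ?thesis using True
        by (simp add: ennreal_mult'[symmetric] mult.commute ennreal_leI)
    qed auto
  qed
  also have "\<dots> = ennreal (exp (- (s * z + s\<^sup>2 / 2))) * emeasure gaussian {z..}"
    by (subst nn_integral_cmult) (auto simp: emeasure_gaussian)
  finally show ?thesis
    by (simp add: gaussian.emeasure_eq_measure ennreal_mult'[symmetric])
qed

lemma measure_gaussian_tail_le:
  assumes "0 \<le> L"
  shows "measure gaussian {L..} \<le> exp (- L\<^sup>2 / 2)"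
proof -
  have "measure gaussian {0 + L..} \<le> exp (- (L * 0 + L\<^sup>2 / 2)) * measure gaussian {0..}"
    by (rule measure_gaussian_shift_le[OF assms])
  also have "\<dots> \<le> exp (- (L * 0 + L\<^sup>2 / 2)) * 1"
    by (intro mult_left_mono) auto
  finally show ?thesis by simp
qed

lemma measure_gaussian_minus:
  assumes A [measurable]: "A \<in> sets borel"
  shows "measure gaussian (uminus -` A) = measure gaussian A"
proof -
  have B: "uminus -` A \<in> sets borel" using measurable_sets[of uminus borel borel A] by simp
  have "emeasure gaussian A = (\<integral>\<^sup>+x. ennreal (\<phi> (- x)) * indicator A (- x) \<partial>lborel)"
    unfolding emeasure_gaussian[OF A]
    by (subst nn_integral_real_affine[where c="-1" and t=0]) auto
  also have "\<dots> = emeasure gaussian (uminus -` A)"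
    unfolding emeasure_gaussian[OF B] by (simp add: phi_minus indicator_def)
  finally show ?thesis by (simp add: measure_def)
qed

text \<open>
  On a short interval the density is almost constant. The error factor is uniform over
  \<open>\<bar>z\<bar> \<le> L\<close>, and it tends to \<open>1\<close> as soon as \<open>L h\<close> and \<open>h\<close> tend to \<open>0\<close>.
\<close>
lemma measure_gaussian_interval:
  assumes z: "\<bar>z\<bar> \<le> L" and g: "0 \<le> g" "g \<le> h"
  shows "g * \<phi> z * exp (- ((L + h) * h)) \<le> measure gaussian {z..z + g}"
    and "measure gaussian {z..z + g} \<le> g * \<phi> z * exp ((L + h) * h)"
proof -
  have b: "\<phi> z * exp (- ((L + h) * h)) \<le> \<phi> x \<and> \<phi> x \<le> \<phi> z * exp ((L + h) * h)" if x: "x \<in> {z..z + g}" for x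
    using phi_shift_bounds[OF z, of x h] x g by auto
  have len: "emeasure lborel {z..z + g} = ennreal g" using g by simp
  have "ennreal (g * \<phi> z * exp (- ((L + h) * h))) = (\<integral>\<^sup>+x. ennreal (\<phi> z * exp (- ((L + h) * h))) * indicator {z..z + g} x \<partial>lborel)"
    using g by (subst nn_integral_cmult_indicator) (auto simp: len ennreal_mult'[symmetric] mult_ac)
  also have "\<dots> \<le> (\<integral>\<^sup>+x. ennreal (\<phi> x) * indicator {z..z + g} x \<partial>lborel)"
    using b by (intro nn_integral_mono) (auto simp: indicator_def intro!: ennreal_leI)
  also have "\<dots> = ennreal (measure gaussian {z..z + g})"
    by (simp add: emeasure_gaussian[symmetric] gaussian.emeasure_eq_measure)
  finally show "g * \<phi> z * exp (- ((L + h) * h)) \<le> measure gaussian {z..z + g}" by simp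
  have "ennreal (measure gaussian {z..z + g}) = (\<integral>\<^sup>+x. ennreal (\<phi> x) * indicator {z..z + g} x \<partial>lborel)"
    by (simp add: emeasure_gaussian[symmetric] gaussian.emeasure_eq_measure)
  also have "\<dots> \<le> (\<integral>\<^sup>+x. ennreal (\<phi> z * exp ((L + h) * h)) * indicator {z..z + g} x \<partial>lborel)"
    using b by (intro nn_integral_mono) (auto simp: indicator_def intro!: ennreal_leI)
  also have "\<dots> = ennreal (g * \<phi> z * exp ((L + h) * h))"
    using g by (subst nn_integral_cmult_indicator) (auto simp: len ennreal_mult'[symmetric] mult_ac)
  finally show "measure gaussian {z..z + g} \<le> g * \<phi> z * exp ((L + h) * h)"
    using g by simp
qed

lemma measure_gaussian_singleton: "measure gaussian {z} = 0"
proof -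
  have "emeasure gaussian {z} = (\<integral>\<^sup>+x. ennreal (\<phi> x) * indicator {z} x \<partial>lborel)"
    by (rule emeasure_gaussian) auto
  also have "\<dots> = (\<integral>\<^sup>+x. ennreal (\<phi> z) * indicator {z} x \<partial>lborel)"
    by (intro nn_integral_cong) (auto simp: indicator_def)
  also have "\<dots> = 0" by (subst nn_integral_cmult_indicator) auto
  finally show ?thesis by (simp add: measure_def)
qed

lemma integral_gaussian:
  "f \<in> borel_measurable borel \<Longrightarrow> integral\<^sup>L gaussian f = (\<integral>x. \<phi> x * f x \<partial>lborel)" for f :: "real \<Rightarrow> real"
  unfolding gaussian_def by (subst integral_density) auto

lemma integrable_gaussian:
  "f \<in> borel_measurable borel \<Longrightarrow> integrable gaussian f \<longleftrightarrow> integrable lborel (\<lambda>x. \<phi> x * f x)" for f :: "real \<Rightarrow> real"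
  unfolding gaussian_def by (subst integrable_density) auto

text \<open>
  The function \<open>- \<phi>\<close> is an antiderivative of \<open>\<lambda>v. v * \<phi> v\<close>. This
  identity is why the excess of a Gaussian sample above \<open>t\<close> is close to \<open>n \<phi> t\<close>.
\<close>
lemma gaussian_partial_mean:
  "(\<integral>x. (if t < x then x else 0) \<partial>gaussian) = \<phi> t"
proof -
  have int: "integrable lborel (\<lambda>x. \<phi> x * x)" using integrable_std_normal_moment[of 1] by simp
  have "(LBINT x=ereal t..\<infinity>. \<phi> x * x) = 0 - (- \<phi> t)"
  proof (rule interval_integral_FTC_integrable[where F="\<lambda>x. - \<phi> x"])
    show "((\<lambda>x. - \<phi> x) has_vector_derivative \<phi> x * x) (at x)" for x
      unfolding std_normal_density_def has_real_derivative_iff_has_vector_derivative[symmetric]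
      by (auto intro!: derivative_eq_intros simp: field_simps)
    show "isCont (\<lambda>x. \<phi> x * x) x" for x
      unfolding std_normal_density_def by (intro continuous_intros) auto
    show "set_integrable lborel (einterval (ereal t) \<infinity>) (\<lambda>x. \<phi> x * x)"
      unfolding set_integrable_def by (intro integrable_mult_indicator int) auto
    show "(((\<lambda>x. - \<phi> x) \<circ> real_of_ereal) \<longlongrightarrow> - \<phi> t) (at_right (ereal t))"
      unfolding ereal_tendsto_simps std_normal_density_def by (auto intro!: tendsto_eq_intros)
    show "(((\<lambda>x. - \<phi> x) \<circ> real_of_ereal) \<longlongrightarrow> 0) (at_left \<infinity>)"
      unfolding ereal_tendsto_simps std_normal_density_def by real_asymp
  qed auto
  then have "(LINT x:{t<..}|lborel. \<phi> x * x) = \<phi> t"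
    by (simp add: interval_integral_to_infinity_eq)
  moreover have "(LINT x:{t<..}|lborel. \<phi> x * x) = (\<integral>x. \<phi> x * (if t < x then x else 0) \<partial>lborel)"
    unfolding set_lebesgue_integral_def by (intro Bochner_Integration.integral_cong) (auto simp: indicator_def)
  ultimately show ?thesis by (simp add: integral_gaussian)
qed

lemma gaussian_moments:
  shows "(\<integral>x. x \<partial>gaussian) = 0" "(\<integral>x. x\<^sup>2 \<partial>gaussian) = 1" "(\<integral>x. (x\<^sup>2)\<^sup>2 \<partial>gaussian) = 3"
    and "integrable gaussian (\<lambda>x. x\<^sup>2)" "integrable gaussian (\<lambda>x. (x\<^sup>2)\<^sup>2)"
proof -
  show "(\<integral>x. x \<partial>gaussian) = 0"
    using integral_std_normal_moment_odd[of 0] by (simp add: integral_gaussian)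
  show "(\<integral>x. x\<^sup>2 \<partial>gaussian) = 1"
    using integral_std_normal_moment_even[of 1] by (simp add: integral_gaussian)
  show "(\<integral>x. (x\<^sup>2)\<^sup>2 \<partial>gaussian) = 3"
    using integral_std_normal_moment_even[of 2] by (simp add: integral_gaussian fact_numeral)
  show "integrable gaussian (\<lambda>x. x\<^sup>2)"
    using integrable_std_normal_moment[of 2] by (simp add: integrable_gaussian)
  show "integrable gaussian (\<lambda>x. (x\<^sup>2)\<^sup>2)"
    using integrable_std_normal_moment[of 4] by (simp add: integrable_gaussian)
qed

section \<open>The cluster index as a maximum over consecutive points\<close>

lemma sorted_nth_le_iff:
  fixes xs :: "'b::linorder list"
  assumes "sorted xs" "m < length xs"
  shows "xs ! m \<le> a \<longleftrightarrow> m < length (filter (\<lambda>x. x \<le> a) xs)"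
  using assms
proof (induction xs arbitrary: m)
  case (Cons x xs)
  show ?case
  proof (cases "x \<le> a")
    case True
    then show ?thesis using Cons by (cases m) auto
  next
    case False
    then have *: "\<not> y \<le> a" if "y \<in> set (x # xs)" for y using Cons.prems that by auto
    then have "filter (\<lambda>x. x \<le> a) (x # xs) = []" by (simp add: filter_empty_conv)
    moreover have "\<not> (x # xs) ! m \<le> a" using * nth_mem[OF Cons.prems(2)] by blast
    ultimately show ?thesis by simp
  qed
qed simp

text \<open>
  Order statistics are handled through counts, which are visibly measurable functions of the
  sample.
\<close>
lemma order_stat_le_iff:
  assumes "1 \<le> k" "k \<le> n"
  shows "order_stat z n k \<le> a \<longleftrightarrow> real k \<le> (\<Sum>j=1..n. if z j \<le> a then 1 else 0)"
proof -
  let ?l = "map z [1..<Suc n]"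
  have "order_stat z n k \<le> a \<longleftrightarrow> k - 1 < length (filter (\<lambda>x. x \<le> a) (sort ?l))"
    unfolding order_stat_def using assms by (intro sorted_nth_le_iff) auto
  also have "length (filter (\<lambda>x. x \<le> a) (sort ?l)) = length (filter (\<lambda>j. z j \<le> a) [1..<Suc n])"
    by (simp add: filter_sort filter_map comp_def del: upt_Suc)
  also have "\<dots> = card {j\<in>{1..n}. z j \<le> a}"
    by (subst distinct_card[symmetric]) (auto simp del: upt_Suc intro!: arg_cong[where f=card])
  also have "k - 1 < \<dots> \<longleftrightarrow> real k \<le> real \<dots>" using assms by auto
  also have "real (card {j\<in>{1..n}. z j \<le> a}) = (\<Sum>j=1..n. if z j \<le> a then 1 else 0)"
    by (simp add: sum.If_cases Int_def)
  finally show ?thesis .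
qed

lemma borel_measurable_order_stat:
  assumes [measurable]: "\<And>i. Z i \<in> borel_measurable M" and "1 \<le> k" "k \<le> n"
  shows "(\<lambda>\<omega>. order_stat (\<lambda>j. Z j \<omega>) n k) \<in> borel_measurable M"
  unfolding borel_measurable_iff_le order_stat_le_iff[OF assms(2,3)] by measurable

lemma borel_measurable_cluster_index:
  assumes [measurable]: "\<And>i. Z i \<in> borel_measurable M"
  shows "(\<lambda>\<omega>. cluster_index (\<lambda>j. Z j \<omega>) n) \<in> borel_measurable M"
proof -
  have os: "(\<lambda>\<omega>. order_stat (\<lambda>j. Z j \<omega>) n k) \<in> borel_measurable M" if "1 \<le> k" "k \<le> n" for k
    using borel_measurable_order_stat[OF assms that] .
  have sm: "(\<lambda>\<omega>. segment_mean (\<lambda>j. Z j \<omega>) n i k) \<in> borel_measurable M" if "1 \<le> i" "k \<le> n" for i k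
    unfolding segment_mean_def using that
    by (intro borel_measurable_times borel_measurable_const borel_measurable_sum os) auto
  have [measurable]: "(\<lambda>\<omega>. sample_mean (\<lambda>j. Z j \<omega>) n) \<in> borel_measurable M"
    unfolding sample_mean_def by measurable
  show ?thesis
    unfolding cluster_index_def
    by (intro borel_measurable_Max borel_measurable_times borel_measurable_divide borel_measurable_diff
        borel_measurable_const borel_measurable_sum borel_measurable_power sm os) auto
qed

definition upper_excess :: "(nat \<Rightarrow> real) \<Rightarrow> nat \<Rightarrow> real \<Rightarrow> real" where
  "upper_excess z n t = (\<Sum>k | k \<in> {1..n} \<and> t < z k. z k - sample_mean z n)"

definition sample_variance :: "(nat \<Rightarrow> real) \<Rightarrow> nat \<Rightarrow> real" where
  "sample_variance z n = (1 / real n) * (\<Sum>j=1..n. (z j - sample_mean z n)\<^sup>2)"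

definition consecutive :: "(nat \<Rightarrow> real) \<Rightarrow> nat \<Rightarrow> nat \<Rightarrow> nat \<Rightarrow> bool" where
  "consecutive z n j k \<longleftrightarrow> j \<in> {1..n} \<and> k \<in> {1..n} \<and> z j < z k \<and> (\<forall>i\<in>{1..n}. z i \<le> z j \<or> z k \<le> z i)"

text \<open>
  Without ties the order statistics are a strictly increasing enumeration of the sample, so
  sums over ranks and sums over sample points can be exchanged.
\<close>
context
  fixes z :: "nat \<Rightarrow> real" and n :: nat
  assumes n: "n \<ge> 2" and inj: "inj_on z {1..n}"
begin

lemma order_stat_strict_mono: "1 \<le> i \<Longrightarrow> i < m \<Longrightarrow> m \<le> n \<Longrightarrow> order_stat z n i < order_stat z n m"
proof -
  assume im: "1 \<le> i" "i < m" "m \<le> n"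
  have "distinct (map z [1..<Suc n])"
    using inj by (simp add: distinct_map atLeastLessThanSuc_atLeastAtMost del: upt_Suc)
  then have "sorted_wrt (<) (sort (map z [1..<Suc n]))" by (simp add: strict_sorted_iff del: upt_Suc)
  then show ?thesis unfolding order_stat_def
    by (rule sorted_wrt_nth_less) (use im in auto)
qed

lemma order_stat_image: "order_stat z n ` {1..n} = z ` {1..n}"
proof -
  let ?xs = "sort (map z [1..<Suc n])"
  have "z ` {1..n} = set ?xs" by (simp add: atLeastLessThanSuc_atLeastAtMost del: upt_Suc)
  also have "\<dots> = (\<lambda>i. ?xs ! i) ` {..<n}"
    by (auto simp: set_conv_nth simp del: upt_Suc set_sort)
  also have "{..<n} = (\<lambda>k. k - 1) ` {1..n}"
  proof (intro set_eqI iffI)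
    fix i assume "i \<in> {..<n}"
    then show "i \<in> (\<lambda>k. k - 1) ` {1..n}" by (intro image_eqI[of _ _ "Suc i"]) auto
  qed auto
  finally show ?thesis by (simp add: image_image order_stat_def)
qed

lemma order_stat_less_iff: "i \<in> {1..n} \<Longrightarrow> m \<in> {1..n} \<Longrightarrow> order_stat z n i < order_stat z n m \<longleftrightarrow> i < m"
  using order_stat_strict_mono[of i m] order_stat_strict_mono[of m i] by (cases i m rule: linorder_cases) auto

lemma order_stat_inj: "inj_on (order_stat z n) {1..n}"
  by (intro linorder_inj_onI) (use order_stat_strict_mono in fastforce)+

lemma sum_above_order_stat:
  assumes i: "i \<in> {1..n}"
  shows "(\<Sum>k | k \<in> {1..n} \<and> order_stat z n i < z k. f (z k)) = (\<Sum>m=i+1..n. f (order_stat z n m))"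
proof -
  have "(\<Sum>k | k \<in> {1..n} \<and> order_stat z n i < z k. f (z k)) = sum f (z ` {k. k \<in> {1..n} \<and> order_stat z n i < z k})"
    by (subst sum.reindex) (auto intro: inj_on_subset[OF inj])
  also have "z ` {k. k \<in> {1..n} \<and> order_stat z n i < z k} = {v \<in> z ` {1..n}. order_stat z n i < v}" by auto
  also have "\<dots> = order_stat z n ` {i+1..n}"
    unfolding order_stat_image[symmetric] using i order_stat_less_iff[OF i] by auto
  also have "sum f \<dots> = (\<Sum>m=i+1..n. f (order_stat z n m))"
    by (subst sum.reindex) (auto intro: inj_on_subset[OF order_stat_inj])
  finally show ?thesis .
qed

lemma sum_order_stat: "(\<Sum>m=1..n. f (order_stat z n m)) = (\<Sum>k=1..n. f (z k))"
proof -
  have "(\<Sum>m=1..n. f (order_stat z n m)) = sum f (order_stat z n ` {1..n})"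
    using order_stat_inj by (subst sum.reindex) auto
  also have "\<dots> = (\<Sum>k=1..n. f (z k))"
    unfolding order_stat_image using inj by (subst sum.reindex) auto
  finally show ?thesis .
qed

text \<open>
  With \<open>U\<close> and \<open>W\<close> the sums of the upper \<open>n - i\<close> and of the lower \<open>i\<close> order statistics,
  both sides equal \<open>U - (n - i) / n * (U + W)\<close>.
\<close>
lemma upper_excess_order_stat:
  assumes i: "i \<in> {1..n-1}"
  shows "real i * (real n - real i) / real n * (segment_mean z n (i + 1) n - segment_mean z n 1 i)
    = upper_excess z n (order_stat z n i)"
proof -
  let ?o = "order_stat z n"
  define U where "U = (\<Sum>m=i+1..n. ?o m)"
  define W where "W = (\<Sum>m=1..i. ?o m)"
  have le: "i \<le> n" using i by auto
  have in': "real i > 0" "real n - real i > 0" "real n > 0" using i n by auto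
  have "(\<Sum>m=1..n. ?o m) = W + U"
    unfolding U_def W_def using i le sum.ub_add_nat[of 1 i "order_stat z n" "n - i"] by simp
  then have mean: "sample_mean z n = (W + U) / real n"
    using sum_order_stat[of "\<lambda>v. v"] by (simp add: sample_mean_def)
  have "upper_excess z n (?o i) = (\<Sum>m=i+1..n. ?o m - sample_mean z n)"
    unfolding upper_excess_def using i by (intro sum_above_order_stat) auto
  also have "\<dots> = U - (real n - real i) * sample_mean z n"
    using le by (simp add: sum_subtractf U_def of_nat_diff)
  also have "\<dots> = real i * (real n - real i) / real n * (U / (real n - real i) - W / real i)"
    unfolding mean using in' by (simp add: field_simps)
  also have "U / (real n - real i) - W / real i = segment_mean z n (i + 1) n - segment_mean z n 1 i"
    unfolding segment_mean_def U_def W_def by simp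
  finally show ?thesis by simp
qed

lemma consecutive_iff_order_stat:
  "(\<exists>j k. consecutive z n j k \<and> P (z j) (z k)) \<longleftrightarrow> (\<exists>i\<in>{1..n-1}. P (order_stat z n i) (order_stat z n (i + 1)))"
proof
  assume "\<exists>j k. consecutive z n j k \<and> P (z j) (z k)"
  then obtain j k where c: "consecutive z n j k" and P: "P (z j) (z k)" by blast
  then have jk: "j \<in> {1..n}" "k \<in> {1..n}" "z j < z k" and gap: "\<And>i. i \<in> {1..n} \<Longrightarrow> z i \<le> z j \<or> z k \<le> z i"
    by (auto simp: consecutive_def)
  obtain i where i: "i \<in> {1..n}" "z j = order_stat z n i" using order_stat_image jk by (metis imageE imageI)
  obtain m where m: "m \<in> {1..n}" "z k = order_stat z n m" using order_stat_image jk by (metis imageE imageI)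
  have "i < m" using jk(3) i m order_stat_less_iff by simp
  have "m = i + 1"
  proof (rule ccontr)
    assume "m \<noteq> i + 1"
    then have lt: "i < i + 1" "i + 1 < m" using \<open>i < m\<close> by auto
    have i1: "i + 1 \<in> {1..n}" using lt m by auto
    obtain l where l: "l \<in> {1..n}" "z l = order_stat z n (i + 1)" using order_stat_image i1 by (metis imageE imageI)
    show False using gap[OF l(1)] lt i m i1 order_stat_less_iff[of i "i+1"] order_stat_less_iff[of "i+1" m] l by auto
  qed
  then show "\<exists>i\<in>{1..n-1}. P (order_stat z n i) (order_stat z n (i + 1))"
    using i m P by (intro bexI[of _ i]) auto
next
  assume "\<exists>i\<in>{1..n-1}. P (order_stat z n i) (order_stat z n (i + 1))"
  then obtain i where i: "i \<in> {1..n-1}" and P: "P (order_stat z n i) (order_stat z n (i + 1))" by blast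
  then have i': "i \<in> {1..n}" "i + 1 \<in> {1..n}" by auto
  obtain j where j: "j \<in> {1..n}" "order_stat z n i = z j" using order_stat_image i' by (metis imageE imageI)
  obtain k where k: "k \<in> {1..n}" "order_stat z n (i + 1) = z k" using order_stat_image i' by (metis imageE imageI)
  have "z l \<le> z j \<or> z k \<le> z l" if l: "l \<in> {1..n}" for l
  proof -
    obtain m where m: "m \<in> {1..n}" "z l = order_stat z n m" using order_stat_image l by (metis imageE imageI)
    show ?thesis using order_stat_less_iff[OF i'(1) m(1)] order_stat_less_iff[OF m(1) i'(2)]
      unfolding m(2) j(2)[symmetric] k(2)[symmetric] by linarith
  qed
  moreover have "z j < z k" using order_stat_less_iff[OF i'] j k by simp
  ultimately have "consecutive z n j k" using j k by (simp add: consecutive_def)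
  then show "\<exists>j k. consecutive z n j k \<and> P (z j) (z k)" using P j k by auto
qed

lemma cluster_index_less_iff:
  assumes V: "sample_variance z n > 0"
  shows "real n * cluster_index z n < c \<longleftrightarrow>
    (\<forall>j k. consecutive z n j k \<longrightarrow> upper_excess z n (z j) * (z k - z j) < c * sample_variance z n)"
proof -
  let ?o = "order_stat z n"
  define T where "T i = real i * (real n - real i) / (real n)\<^sup>2 *
          ((segment_mean z n (i + 1) n - segment_mean z n 1 i) * (?o (i + 1) - ?o i) / sample_variance z n)" for i
  have T: "real n * T i = upper_excess z n (?o i) * (?o (i + 1) - ?o i) / sample_variance z n" if "i \<in> {1..n-1}" for i
    unfolding upper_excess_order_stat[OF that, symmetric] T_def using n by (simp add: power2_eq_square)
  have "real n * cluster_index z n < c \<longleftrightarrow> Max (T ` {1..n-1}) < c / real n"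
    using n unfolding cluster_index_def T_def sample_variance_def by (simp add: field_simps)
  also have "\<dots> \<longleftrightarrow> (\<forall>i\<in>{1..n-1}. T i < c / real n)" using n by (subst Max_less_iff) auto
  also have "\<dots> \<longleftrightarrow> (\<forall>i\<in>{1..n-1}. real n * T i < c)" using n by (simp add: field_simps)
  also have "\<dots> \<longleftrightarrow> \<not> (\<exists>i\<in>{1..n-1}. \<not> upper_excess z n (?o i) * (?o (i + 1) - ?o i) < c * sample_variance z n)"
    using V by (simp add: T pos_divide_less_eq)
  also have "\<dots> \<longleftrightarrow> (\<forall>j k. consecutive z n j k \<longrightarrow> upper_excess z n (z j) * (z k - z j) < c * sample_variance z n)"
    using consecutive_iff_order_stat[of "\<lambda>a b. \<not> upper_excess z n a * (b - a) < c * sample_variance z n"] by blast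
  finally show ?thesis .
qed

end

section \<open>Bonferroni inequalities and Poisson limits\<close>

text \<open>
  The sign of the right-hand side for \<open>N > 0\<close> depends only on the parity of \<open>m\<close>. This is
  the pointwise form of the Bonferroni inequalities.
\<close>
lemma alternating_binomial_partial_sum:
  "(\<Sum>r\<le>m. (- 1) ^ r * real (N choose r)) = (if N = 0 then 1 else (- 1) ^ m * real ((N - 1) choose m))"
proof -
  have "(\<Sum>r\<le>m. (- 1) ^ r * real (N choose r)) = (\<Sum>r\<le>m. (real N gchoose r) * (- 1) ^ r)"
    by (simp add: binomial_gbinomial mult.commute)
  also have "\<dots> = (- 1) ^ m * (real N - 1 gchoose m)"
    by (rule gbinomial_sum_lower_neg)
  finally have *: "(\<Sum>r\<le>m. (- 1) ^ r * real (N choose r)) = (- 1) ^ m * (real N - 1 gchoose m)" .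
  show ?thesis
  proof (cases "N = 0")
    case True
    have "(\<Sum>r\<le>m. (- 1) ^ r * real (0 choose r)) = (\<Sum>r\<in>{0}. (- 1) ^ r * real (0 choose r))"
      by (rule sum.mono_neutral_right) auto
    then show ?thesis using True by simp
  next
    case False
    then have "real N - 1 = real (N - 1)" by simp
    then show ?thesis using False * by (simp only: binomial_gbinomial if_False)
  qed
qed

context prob_space
begin

text \<open>
  This is the \<open>r\<close>-th binomial moment of the number of events \<open>A i\<close> that occur.
\<close>
definition joint_sum :: "'b set \<Rightarrow> ('b \<Rightarrow> 'a set) \<Rightarrow> nat \<Rightarrow> real" where
  "joint_sum I A r = (\<Sum>J | J \<subseteq> I \<and> card J = r. prob {\<omega> \<in> space M. \<forall>j\<in>J. \<omega> \<in> A j})"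

lemma joint_sum_expectation:
  assumes [simp]: "finite I" and [measurable]: "\<And>i. i \<in> I \<Longrightarrow> A i \<in> events"
  shows "integrable M (\<lambda>\<omega>. real (card {i\<in>I. \<omega> \<in> A i} choose r))"
    and "expectation (\<lambda>\<omega>. real (card {i\<in>I. \<omega> \<in> A i} choose r)) = joint_sum I A r"
proof -
  define E where "E J = {\<omega> \<in> space M. \<forall>j\<in>J. \<omega> \<in> A j}" for J
  have fin: "finite {J. J \<subseteq> I \<and> card J = r}" by simp
  have E: "E J \<in> events" if "J \<subseteq> I" for J
  proof -
    have [simp]: "finite J" using finite_subset[OF that] by simp
    show ?thesis unfolding E_def using that by (intro sets.sets_Collect_finite_All) auto
  qed
  have eq: "real (card {i\<in>I. \<omega> \<in> A i} choose r) = (\<Sum>J | J \<subseteq> I \<and> card J = r. indicator (E J) \<omega>)"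
    if "\<omega> \<in> space M" for \<omega>
  proof -
    have "card {i\<in>I. \<omega> \<in> A i} choose r = card {J. J \<subseteq> {i\<in>I. \<omega> \<in> A i} \<and> card J = r}"
      by (subst n_subsets) auto
    also have "{J. J \<subseteq> {i\<in>I. \<omega> \<in> A i} \<and> card J = r} = {J \<in> {J. J \<subseteq> I \<and> card J = r}. \<omega> \<in> E J}"
      using that by (auto simp: E_def)
    also have "real (card \<dots>) = (\<Sum>J | J \<subseteq> I \<and> card J = r. indicator (E J) \<omega>)"
      using fin by (simp add: indicator_def sum.If_cases Int_def conj_ac)
    finally show ?thesis .
  qed
  have int: "integrable M (\<lambda>\<omega>. \<Sum>J | J \<subseteq> I \<and> card J = r. indicator (E J) \<omega> :: real)"
    using E by (intro Bochner_Integration.integrable_sum integrable_real_indicator) (auto simp: emeasure_eq_measure)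
  show "integrable M (\<lambda>\<omega>. real (card {i\<in>I. \<omega> \<in> A i} choose r))"
    using int by (subst Bochner_Integration.integrable_cong[OF refl eq]) auto
  have "expectation (\<lambda>\<omega>. real (card {i\<in>I. \<omega> \<in> A i} choose r)) =
     expectation (\<lambda>\<omega>. \<Sum>J | J \<subseteq> I \<and> card J = r. indicator (E J) \<omega>)"
    by (rule Bochner_Integration.integral_cong[OF refl eq])
  also have "\<dots> = (\<Sum>J | J \<subseteq> I \<and> card J = r. prob (E J))"
    using E by (subst Bochner_Integration.integral_sum)
      (auto intro!: integrable_real_indicator sum.cong simp: emeasure_eq_measure)
  finally show "expectation (\<lambda>\<omega>. real (card {i\<in>I. \<omega> \<in> A i} choose r)) = joint_sum I A r"
    by (simp add: joint_sum_def E_def)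
qed

lemma bonferroni:
  assumes [simp]: "finite I" and ev [measurable]: "\<And>i. i \<in> I \<Longrightarrow> A i \<in> events"
  shows "prob {\<omega> \<in> space M. \<forall>i\<in>I. \<omega> \<notin> A i} \<le> (\<Sum>r\<le>2*m. (- 1) ^ r * joint_sum I A r)"
    and "(\<Sum>r\<le>2*m+1. (- 1) ^ r * joint_sum I A r) \<le> prob {\<omega> \<in> space M. \<forall>i\<in>I. \<omega> \<notin> A i}"
proof -
  define N where "N \<omega> = card {i\<in>I. \<omega> \<in> A i}" for \<omega>
  define E where "E = {\<omega> \<in> space M. \<forall>i\<in>I. \<omega> \<notin> A i}"
  have js: "integrable M (\<lambda>\<omega>. real (N \<omega> choose r))"
      "expectation (\<lambda>\<omega>. real (N \<omega> choose r)) = joint_sum I A r" for r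
    unfolding N_def by (rule joint_sum_expectation; use assms in blast)+
  have E: "E \<in> events"
    unfolding E_def using ev by (intro sets.sets_Collect_finite_All sets.sets_Collect_neg) auto
  have intE: "integrable M (indicator E :: _ \<Rightarrow> real)"
    using E by (intro integrable_real_indicator) (auto simp: emeasure_eq_measure)
  have N0: "\<omega> \<in> E \<longleftrightarrow> N \<omega> = 0" if "\<omega> \<in> space M" for \<omega>
    using that by (auto simp: E_def N_def)
  have int: "integrable M (\<lambda>\<omega>. \<Sum>r\<le>k. (- 1) ^ r * real (N \<omega> choose r))" for k
    using js(1) by (intro Bochner_Integration.integrable_sum integrable_mult_right) auto
  have ex: "expectation (\<lambda>\<omega>. \<Sum>r\<le>k. (- 1) ^ r * real (N \<omega> choose r)) = (\<Sum>r\<le>k. (- 1) ^ r * joint_sum I A r)" for k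
    using js by (subst Bochner_Integration.integral_sum) (auto intro!: integrable_mult_right)
  have "prob E = expectation (indicator E)" using E by simp
  also have "\<dots> \<le> expectation (\<lambda>\<omega>. \<Sum>r\<le>2*m. (- 1) ^ r * real (N \<omega> choose r))"
    by (intro integral_mono intE int) (auto simp: alternating_binomial_partial_sum indicator_def N0)
  finally show "prob {\<omega> \<in> space M. \<forall>i\<in>I. \<omega> \<notin> A i} \<le> (\<Sum>r\<le>2*m. (- 1) ^ r * joint_sum I A r)"
    unfolding ex E_def .
  have "expectation (\<lambda>\<omega>. \<Sum>r\<le>2*m+1. (- 1) ^ r * real (N \<omega> choose r)) \<le> expectation (indicator E)"
    by (intro integral_mono intE int) (auto simp: alternating_binomial_partial_sum indicator_def N0 simp del: sum.atMost_Suc)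
  also have "\<dots> = prob E" using E by simp
  finally show "(\<Sum>r\<le>2*m+1. (- 1) ^ r * joint_sum I A r) \<le> prob {\<omega> \<in> space M. \<forall>i\<in>I. \<omega> \<notin> A i}"
    unfolding ex E_def .
qed

text \<open>
  At a fixed order the Bonferroni bounds converge to partial sums of the series of
  \<open>exp (- \<theta>)\<close>, and the order is arbitrary.
\<close>
lemma poisson_limit_of_joint_sums:
  assumes fin: "\<And>n. finite (I n)" and ev: "\<And>n i. i \<in> I n \<Longrightarrow> A n i \<in> events"
    and lim: "\<And>r. (\<lambda>n. joint_sum (I n) (A n) r) \<longlonglongrightarrow> \<theta> ^ r / fact r"
  shows "(\<lambda>n. prob {\<omega> \<in> space M. \<forall>i\<in>I n. \<omega> \<notin> A n i}) \<longlonglongrightarrow> exp (- \<theta>)"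
proof (rule LIMSEQ_I)
  fix \<epsilon> :: real assume \<epsilon>: "\<epsilon> > 0"
  define p where "p n = prob {\<omega> \<in> space M. \<forall>i\<in>I n. \<omega> \<notin> A n i}" for n
  define T where "T m = (\<Sum>r\<le>m. (- 1) ^ r * (\<theta> ^ r / fact r))" for m
  have Tn: "(\<lambda>n. \<Sum>r\<le>m. (- 1) ^ r * joint_sum (I n) (A n) r) \<longlonglongrightarrow> T m" for m
    unfolding T_def by (intro tendsto_sum tendsto_mult tendsto_const lim)
  have "(\<lambda>r. (- \<theta>) ^ r /\<^sub>R fact r) sums exp (- \<theta>)" by (rule exp_converges)
  also have "(\<lambda>r. (- \<theta>) ^ r /\<^sub>R fact r) = (\<lambda>r. (- 1) ^ r * (\<theta> ^ r / fact r))"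
    by (intro ext) (simp add: power_minus[of \<theta>] divide_inverse mult_ac)
  finally have "T \<longlonglongrightarrow> exp (- \<theta>)" unfolding T_def sums_def_le .
  then obtain m0 where m0: "\<And>m. m \<ge> m0 \<Longrightarrow> \<bar>T m - exp (- \<theta>)\<bar> < \<epsilon> / 2"
    using \<epsilon> LIMSEQ_D[of T "exp (- \<theta>)" "\<epsilon> / 2"] by auto
  have up: "eventually (\<lambda>n. (\<Sum>r\<le>2*m0. (- 1) ^ r * joint_sum (I n) (A n) r) < T (2*m0) + \<epsilon> / 2) sequentially"
    using Tn by (rule order_tendstoD) (use \<epsilon> in simp)
  have lo: "eventually (\<lambda>n. (\<Sum>r\<le>2*m0+1. (- 1) ^ r * joint_sum (I n) (A n) r) > T (2*m0+1) - \<epsilon> / 2) sequentially"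
    using Tn by (rule order_tendstoD) (use \<epsilon> in simp)
  have "eventually (\<lambda>n. norm (p n - exp (- \<theta>)) < \<epsilon>) sequentially"
    using up lo
  proof eventually_elim
    case (elim n)
    have "p n \<le> (\<Sum>r\<le>2*m0. (- 1) ^ r * joint_sum (I n) (A n) r)"
      "(\<Sum>r\<le>2*m0+1. (- 1) ^ r * joint_sum (I n) (A n) r) \<le> p n"
      unfolding p_def using fin ev by (rule bonferroni; blast)+
    moreover have "\<bar>T (2*m0) - exp (- \<theta>)\<bar> < \<epsilon> / 2" "\<bar>T (2*m0+1) - exp (- \<theta>)\<bar> < \<epsilon> / 2"
      by (rule m0; simp)+
    ultimately show ?case using elim unfolding real_norm_def by linarith
  qed
  then show "\<exists>no. \<forall>n\<ge>no. norm (prob {\<omega> \<in> space M. \<forall>i\<in>I n. \<omega> \<notin> A n i} - exp (- \<theta>)) < \<epsilon>"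
    unfolding p_def eventually_sequentially .
qed

end

section \<open>Independent samples\<close>

text \<open>
  Only the indices from \<open>1\<close> on belong to the sample; \<open>X 0\<close> is a measurable placeholder, so
  that measurability holds without side conditions.
\<close>
locale iid_sample = prob_space M for M :: "'a measure" +
  fixes X :: "nat \<Rightarrow> 'a \<Rightarrow> real" and \<mu> :: "real measure"
  assumes rv [measurable]: "\<And>i. X i \<in> borel_measurable M"
    and indep: "indep_vars (\<lambda>_. borel) X {1..}"
    and law: "\<And>i. i \<ge> 1 \<Longrightarrow> distr M borel (X i) = \<mu>"
begin

lemma sets_mu [measurable_cong, simp]: "sets \<mu> = sets borel"
  using law[of 1] by (metis sets_distr order_refl)

lemma space_mu [simp]: "space \<mu> = UNIV"
  using sets_eq_imp_space_eq[OF sets_mu] by simp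

lemma prob_space_mu: "prob_space \<mu>"
  using law[of 1] prob_space_distr[of "X 1" borel] by simp

lemma distr_sample:
  assumes "I \<subseteq> {1..}" "I \<noteq> {}"
  shows "distr M (Pi\<^sub>M I (\<lambda>_. borel)) (\<lambda>\<omega>. \<lambda>i\<in>I. X i \<omega>) = Pi\<^sub>M I (\<lambda>_. \<mu>)"
proof -
  have "indep_vars (\<lambda>_. borel) X I"
    using indep_vars_subset[OF indep assms(1)] .
  then have "distr M (Pi\<^sub>M I (\<lambda>_. borel)) (\<lambda>\<omega>. \<lambda>i\<in>I. X i \<omega>) = Pi\<^sub>M I (\<lambda>i. distr M borel (X i))"
    by (subst (asm) indep_vars_iff_distr_eq_PiM) (use assms in auto)
  also have "\<dots> = Pi\<^sub>M I (\<lambda>_. \<mu>)"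
    using assms law by (intro PiM_cong) auto
  finally show ?thesis .
qed

text \<open>
  Fubini's theorem in probabilistic form: given the points with indices in \<open>J\<close>, the
  remaining ones are still independent with law \<open>\<mu>\<close>, so the conditional probability of
  their constraints is a product.
\<close>
lemma emeasure_given_part:
  fixes C :: "nat \<Rightarrow> (nat \<Rightarrow> real) \<Rightarrow> real \<Rightarrow> bool"
  assumes fin: "finite J" "finite R" and dj: "J \<inter> R = {}" and idx: "J \<subseteq> {1..}" "R \<subseteq> {1..}" and ne: "J \<noteq> {}"
    and A [measurable]: "Measurable.pred (Pi\<^sub>M J (\<lambda>_. borel)) A"
    and C [measurable]: "\<And>k. k \<in> R \<Longrightarrow>
      Measurable.pred (Pi\<^sub>M J (\<lambda>_. borel) \<Otimes>\<^sub>M borel) (\<lambda>p. C k (fst p) (snd p))"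
  shows "emeasure M {\<omega> \<in> space M. A (\<lambda>j\<in>J. X j \<omega>) \<and> (\<forall>k\<in>R. C k (\<lambda>j\<in>J. X j \<omega>) (X k \<omega>))} =
    (\<integral>\<^sup>+\<omega>. indicator {\<omega>. A (\<lambda>j\<in>J. X j \<omega>)} \<omega> *
       (\<Prod>k\<in>R. emeasure \<mu> {y. C k (\<lambda>j\<in>J. X j \<omega>) y}) \<partial>M)"
proof -
  interpret mu: prob_space \<mu> by (rule prob_space_mu)
  interpret PS: product_sigma_finite "\<lambda>_::nat. \<mu>" ..
  let ?I = "J \<union> R"
  define B where "B = {v \<in> space (Pi\<^sub>M ?I (\<lambda>_. borel :: real measure)).
      A (\<lambda>j\<in>J. v j) \<and> (\<forall>k\<in>R. C k (\<lambda>j\<in>J. v j) (v k))}"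
  have sets_Pi: "sets (Pi\<^sub>M I (\<lambda>_. \<mu>)) = sets (Pi\<^sub>M I (\<lambda>_. borel))" for I :: "nat set"
    by (intro sets_PiM_cong) auto
  have space_Pi: "space (Pi\<^sub>M I (\<lambda>_. \<mu>)) = space (Pi\<^sub>M I (\<lambda>_. borel :: real measure))" for I :: "nat set"
    by (simp add: space_PiM)
  have restr: "(\<lambda>v. \<lambda>j\<in>J. v j) \<in> measurable (Pi\<^sub>M ?I (\<lambda>_. borel)) (Pi\<^sub>M J (\<lambda>_. borel :: real measure))"
    by (intro measurable_restrict_subset) auto
  have mA: "Measurable.pred (Pi\<^sub>M ?I (\<lambda>_. borel)) (\<lambda>v. A (\<lambda>j\<in>J. v j))"
    using measurable_compose[OF restr A] by simp
  have mC: "Measurable.pred (Pi\<^sub>M ?I (\<lambda>_. borel)) (\<lambda>v. C k (\<lambda>j\<in>J. v j) (v k))" if "k \<in> R" for k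
  proof -
    have "(\<lambda>v. (\<lambda>j\<in>J. v j, v k)) \<in> measurable (Pi\<^sub>M ?I (\<lambda>_. borel)) (Pi\<^sub>M J (\<lambda>_. borel) \<Otimes>\<^sub>M borel)"
      using restr that by (intro measurable_Pair measurable_component_singleton) auto
    from measurable_compose[OF this C[OF that]] show ?thesis by simp
  qed
  have B: "B \<in> sets (Pi\<^sub>M ?I (\<lambda>_. borel))"
    unfolding B_def using fin mA mC by (intro predE pred_intros_logic pred_intros_finite) auto
  have "emeasure M {\<omega> \<in> space M. A (\<lambda>j\<in>J. X j \<omega>) \<and> (\<forall>k\<in>R. C k (\<lambda>j\<in>J. X j \<omega>) (X k \<omega>))}
      = emeasure (distr M (Pi\<^sub>M ?I (\<lambda>_. borel)) (\<lambda>\<omega>. \<lambda>i\<in>?I. X i \<omega>)) B"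
  proof (subst emeasure_distr[OF _ B])
    show "(\<lambda>\<omega>. \<lambda>i\<in>?I. X i \<omega>) \<in> measurable M (Pi\<^sub>M ?I (\<lambda>_. borel))" by measurable
    have eq: "(\<lambda>j\<in>J. if j \<in> J \<or> j \<in> R then X j \<omega> else undefined) = (\<lambda>j\<in>J. X j \<omega>)" for \<omega>
      by (auto simp: restrict_def fun_eq_iff)
    show "emeasure M {\<omega> \<in> space M. A (\<lambda>j\<in>J. X j \<omega>) \<and> (\<forall>k\<in>R. C k (\<lambda>j\<in>J. X j \<omega>) (X k \<omega>))} =
      emeasure M ((\<lambda>\<omega>. \<lambda>i\<in>?I. X i \<omega>) -` B \<inter> space M)"
      by (rule arg_cong[where f="emeasure M"])
         (auto simp: B_def space_PiM eq cong: restrict_cong)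
  qed
  also have "\<dots> = emeasure (Pi\<^sub>M ?I (\<lambda>_. \<mu>)) B"
    using idx ne by (subst distr_sample) auto
  also have "\<dots> = (\<integral>\<^sup>+x. emeasure (Pi\<^sub>M R (\<lambda>_. \<mu>)) ((\<lambda>y. merge J R (x, y)) -` B \<inter> space (Pi\<^sub>M R (\<lambda>_. \<mu>))) \<partial>Pi\<^sub>M J (\<lambda>_. \<mu>))"
    using B by (intro PS.emeasure_fold_integral fin dj) (simp add: sets_Pi)
  also have "\<dots> = (\<integral>\<^sup>+x. indicator {x. A x} x * (\<Prod>k\<in>R. emeasure \<mu> {y. C k x y}) \<partial>Pi\<^sub>M J (\<lambda>_. \<mu>))"
  proof (intro nn_integral_cong)
    fix x assume x: "x \<in> space (Pi\<^sub>M J (\<lambda>_. \<mu>))"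
    have xr: "restrict x J = x" using x by (auto simp: space_PiM)
    have r: "restrict (merge J R (x, y)) J = x" for y
    proof -
      have "restrict (merge J R (x, y)) J = restrict x J" by (auto simp: restrict_def merge_def)
      then show ?thesis using xr by simp
    qed
    have s: "merge J R (x, y) k = y k" if "k \<in> R" for y k
      using that dj by (auto simp: merge_def)
    have eq: "(\<lambda>y. merge J R (x, y)) -` B \<inter> space (Pi\<^sub>M R (\<lambda>_. \<mu>)) =
      (if A x then (\<Pi>\<^sub>E k\<in>R. {y. C k x y}) else {})"
      using s dj by (auto simp: B_def space_PiM r PiE_def Pi_def extensional_merge)
    have "Measurable.pred borel (C k x)" if "k \<in> R" for k
    proof -
      have "(\<lambda>y. (x, y)) \<in> measurable borel (Pi\<^sub>M J (\<lambda>_. borel) \<Otimes>\<^sub>M borel)"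
        using x by (intro measurable_Pair1') (simp add: space_PiM)
      from measurable_compose[OF this C[OF that]] show ?thesis by simp
    qed
    then have "{y. C k x y} \<in> sets \<mu>" if "k \<in> R" for k
      using that unfolding pred_def by simp
    then show "emeasure (Pi\<^sub>M R (\<lambda>_. \<mu>)) ((\<lambda>y. merge J R (x, y)) -` B \<inter> space (Pi\<^sub>M R (\<lambda>_. \<mu>)))
        = indicator {x. A x} x * (\<Prod>k\<in>R. emeasure \<mu> {y. C k x y})"
      unfolding eq using fin by (auto simp: PS.emeasure_PiM)
  qed
  also have "\<dots> = (\<integral>\<^sup>+x. indicator {x. A x} x * (\<Prod>k\<in>R. emeasure \<mu> {y. C k x y})
      \<partial>distr M (Pi\<^sub>M J (\<lambda>_. borel)) (\<lambda>\<omega>. \<lambda>i\<in>J. X i \<omega>))"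
    using idx ne by (subst distr_sample) auto
  also have "\<dots> = (\<integral>\<^sup>+\<omega>. indicator {x. A x} (\<lambda>j\<in>J. X j \<omega>) *
       (\<Prod>k\<in>R. emeasure \<mu> {y. C k (\<lambda>j\<in>J. X j \<omega>) y}) \<partial>M)"
  proof (intro nn_integral_distr)
    show "(\<lambda>\<omega>. \<lambda>i\<in>J. X i \<omega>) \<in> measurable M (Pi\<^sub>M J (\<lambda>_. borel))" by measurable
    have *: "(\<lambda>x. emeasure \<mu> {y. C k x y}) \<in> borel_measurable (Pi\<^sub>M J (\<lambda>_. borel))" if "k \<in> R" for k
    proof -
      have "sets (Pi\<^sub>M J (\<lambda>_. borel :: real measure) \<Otimes>\<^sub>M \<mu>) =
          sets (Pi\<^sub>M J (\<lambda>_. borel :: real measure) \<Otimes>\<^sub>M borel)"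
        by (intro sets_pair_measure_cong) auto
      from this sets_eq_imp_space_eq[OF this]
      have "{p \<in> space (Pi\<^sub>M J (\<lambda>_. borel) \<Otimes>\<^sub>M \<mu>). C k (fst p) (snd p)}
          \<in> sets (Pi\<^sub>M J (\<lambda>_. borel) \<Otimes>\<^sub>M \<mu>)"
        using C[OF that] unfolding pred_def by simp
      then show ?thesis
        by (intro mu.measurable_emeasure) auto
    qed
    show "(\<lambda>x. indicator {x. A x} x * (\<Prod>k\<in>R. emeasure \<mu> {y. C k x y}))
        \<in> borel_measurable (distr M (Pi\<^sub>M J (\<lambda>_. borel)) (\<lambda>\<omega>. \<lambda>i\<in>J. X i \<omega>))"
      using * unfolding measurable_distr_eq1 by (intro borel_measurable_times_ennreal borel_measurable_prod_ennreal) auto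
  qed
  finally show ?thesis by (simp add: indicator_def)
qed

end

context iid_sample
begin

lemma integral_sample:
  fixes f :: "real \<Rightarrow> real"
  assumes "i \<ge> 1" and [measurable]: "f \<in> borel_measurable borel"
  shows "expectation (\<lambda>\<omega>. f (X i \<omega>)) = integral\<^sup>L \<mu> f"
  using law[OF assms(1)] by (subst integral_distr[symmetric, of "X i" M borel f]) auto

lemma integrable_sample:
  fixes f :: "real \<Rightarrow> real"
  assumes "i \<ge> 1" and [measurable]: "f \<in> borel_measurable borel"
  shows "integrable M (\<lambda>\<omega>. f (X i \<omega>)) \<longleftrightarrow> integrable \<mu> f"
  using law[OF assms(1)] by (subst integrable_distr_eq[symmetric, of "X i" M borel f]) auto

text \<open>
  Chebyshev's inequality, with the variance of \<open>f\<close> bounded by its second moment.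
\<close>
lemma sample_sum_deviation:
  fixes f :: "real \<Rightarrow> real"
  assumes f [measurable]: "f \<in> borel_measurable borel" and f2: "integrable \<mu> (\<lambda>x. (f x)\<^sup>2)" and y: "y > 0"
  shows "prob {\<omega> \<in> space M. y \<le> \<bar>(\<Sum>j=1..n. f (X j \<omega>)) - real n * integral\<^sup>L \<mu> f\<bar>}
    \<le> real n * (\<integral>x. (f x)\<^sup>2 \<partial>\<mu>) / y\<^sup>2"
proof -
  interpret mu: prob_space \<mu> by (rule prob_space_mu)
  define m where "m = integral\<^sup>L \<mu> f"
  define h where "h x = f x - m" for x
  have [measurable]: "h \<in> borel_measurable borel" unfolding h_def by measurable
  have f1: "integrable \<mu> f" using mu.square_integrable_imp_integrable[OF _ f2] by simp
  have h1: "integrable \<mu> h" unfolding h_def using f1 by auto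
  have h2: "integrable \<mu> (\<lambda>x. (h x)\<^sup>2)"
    unfolding h_def power2_diff using f1 f2 by auto
  have hm: "integral\<^sup>L \<mu> h = 0" unfolding h_def using f1 by (simp add: m_def mu.prob_space[simplified])
  have hv: "(\<integral>x. (h x)\<^sup>2 \<partial>\<mu>) \<le> (\<integral>x. (f x)\<^sup>2 \<partial>\<mu>)"
    unfolding h_def m_def using mu.variance_eq[OF f1 f2] by simp
  have prod: "integrable M (\<lambda>\<omega>. h (X i \<omega>) * h (X j \<omega>)) \<and> expectation (\<lambda>\<omega>. h (X i \<omega>) * h (X j \<omega>)) = (if i = j then (\<integral>x. (h x)\<^sup>2 \<partial>\<mu>) else 0)"
    if ij: "i \<ge> 1" "j \<ge> 1" for i j
  proof (cases "i = j")
    case True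
    then show ?thesis using ij integral_sample[of i "\<lambda>x. (h x)\<^sup>2"] integrable_sample[of i "\<lambda>x. (h x)\<^sup>2"] h2
      by (simp add: power2_eq_square)
  next
    case False
    have "indep_vars (\<lambda>_. borel) (\<lambda>i \<omega>. h (X i \<omega>)) {1..}"
      by (rule indep_vars_compose2[OF indep]) auto
    then have iv: "indep_vars (\<lambda>_. borel) (\<lambda>i \<omega>. h (X i \<omega>)) {i, j}"
      by (rule indep_vars_subset) (use ij in auto)
    have int: "integrable M (\<lambda>\<omega>. h (X k \<omega>))" if "k \<in> {i, j}" for k
      using that ij integrable_sample[of k h] h1 by auto
    have "integrable M (\<lambda>\<omega>. \<Prod>k\<in>{i,j}. h (X k \<omega>))"
      by (rule indep_vars_integrable[OF _ iv int]) auto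
    moreover have "expectation (\<lambda>\<omega>. \<Prod>k\<in>{i,j}. h (X k \<omega>)) = (\<Prod>k\<in>{i,j}. expectation (\<lambda>\<omega>. h (X k \<omega>)))"
      by (rule indep_vars_lebesgue_integral[OF _ iv int]) auto
    ultimately show ?thesis using False ij integral_sample[of _ h] hm by simp
  qed
  define S where "S \<omega> = (\<Sum>j=1..n. h (X j \<omega>))" for \<omega>
  have Sm [measurable]: "S \<in> borel_measurable M" unfolding S_def by measurable
  have S2: "(S \<omega>)\<^sup>2 = (\<Sum>i=1..n. \<Sum>j=1..n. h (X i \<omega>) * h (X j \<omega>))" for \<omega>
    by (simp add: S_def power2_eq_square sum_product)
  have intS: "integrable M (\<lambda>\<omega>. (S \<omega>)\<^sup>2)"
    unfolding S2 using prod by (intro Bochner_Integration.integrable_sum) auto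
  have "expectation (\<lambda>\<omega>. (S \<omega>)\<^sup>2) = (\<Sum>i=1..n. \<Sum>j=1..n. if i = j then (\<integral>x. (h x)\<^sup>2 \<partial>\<mu>) else 0)"
    unfolding S2 using prod
    by (subst Bochner_Integration.integral_sum, force intro!: Bochner_Integration.integrable_sum)
       (intro sum.cong refl, subst Bochner_Integration.integral_sum, auto)
  also have "\<dots> = real n * (\<integral>x. (h x)\<^sup>2 \<partial>\<mu>)" by (simp add: sum.delta)
  finally have ES: "expectation (\<lambda>\<omega>. (S \<omega>)\<^sup>2) \<le> real n * (\<integral>x. (f x)\<^sup>2 \<partial>\<mu>)"
    using hv by (simp add: mult_left_mono)
  have "prob {\<omega> \<in> space M. y \<le> \<bar>S \<omega>\<bar>} \<le> expectation (\<lambda>\<omega>. (S \<omega>)\<^sup>2) / y\<^sup>2"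
    by (rule second_moment_method[OF Sm intS y])
  also have "\<dots> \<le> real n * (\<integral>x. (f x)\<^sup>2 \<partial>\<mu>) / y\<^sup>2"
    using ES by (intro divide_right_mono) auto
  finally show ?thesis
    by (simp add: S_def h_def m_def sum_subtractf)
qed

end

section \<open>Points with an empty right neighbourhood\<close>

lemma pred_between:
  fixes f h u :: "'b \<Rightarrow> real"
  assumes [measurable]: "f \<in> borel_measurable N" "h \<in> borel_measurable N" "u \<in> borel_measurable N"
  shows "Measurable.pred N (\<lambda>p. f p \<le> h p \<and> h p \<le> u p)"
  by measurable

lemma interval_hit_pred:
  fixes K :: "real set" and g :: "real \<Rightarrow> real"
  assumes K: "K \<in> sets borel" and g: "g \<in> borel_measurable borel"
  shows "Measurable.pred (borel \<Otimes>\<^sub>M borel) (\<lambda>p. fst p \<in> K \<and> fst p \<le> snd p \<and> snd p \<le> fst p + g (fst p))"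
proof (rule pred_intros_logic(3))
  show "Measurable.pred (borel \<Otimes>\<^sub>M borel) (\<lambda>p. fst p \<le> snd p \<and> snd p \<le> fst p + g (fst p))"
    by (rule pred_between[OF measurable_fst measurable_snd
          borel_measurable_add[OF measurable_fst measurable_compose[OF measurable_fst g]]])
  show "Measurable.pred (borel \<Otimes>\<^sub>M borel) (\<lambda>p. fst p \<in> K)"
    by (rule measurable_compose[OF measurable_fst]) (use K in simp)
qed

context iid_sample
begin

lemma emeasure_given_one:
  assumes R: "finite R" "R \<subseteq> {1..}" "j \<notin> R" "j \<ge> 1"
    and A [measurable]: "Measurable.pred borel A"
    and C [measurable]: "\<And>k. k \<in> R \<Longrightarrow> Measurable.pred (borel \<Otimes>\<^sub>M borel) (\<lambda>p. C k (fst p) (snd p))"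
  shows "emeasure M {\<omega> \<in> space M. A (X j \<omega>) \<and> (\<forall>k\<in>R. C k (X j \<omega>) (X k \<omega>))} =
    (\<integral>\<^sup>+z. indicator {z. A z} z * (\<Prod>k\<in>R. emeasure \<mu> {y. C k z y}) \<partial>\<mu>)"
proof -
  interpret mu: prob_space \<mu> by (rule prob_space_mu)
  have "Measurable.pred (Pi\<^sub>M {j} (\<lambda>_. borel) \<Otimes>\<^sub>M borel) (\<lambda>p. C k (fst p j) (snd p))" if "k \<in> R" for k
  proof -
    have "(\<lambda>p. (fst p j, snd p)) \<in> measurable (Pi\<^sub>M {j} (\<lambda>_. borel :: real measure) \<Otimes>\<^sub>M (borel :: real measure)) (borel \<Otimes>\<^sub>M borel)"
      by measurable
    from measurable_compose[OF this C[OF that]] show ?thesis by simp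
  qed
  then have "emeasure M {\<omega> \<in> space M. A ((\<lambda>i\<in>{j}. X i \<omega>) j) \<and> (\<forall>k\<in>R. C k ((\<lambda>i\<in>{j}. X i \<omega>) j) (X k \<omega>))} =
    (\<integral>\<^sup>+\<omega>. indicator {\<omega>. A ((\<lambda>i\<in>{j}. X i \<omega>) j)} \<omega> * (\<Prod>k\<in>R. emeasure \<mu> {y. C k ((\<lambda>i\<in>{j}. X i \<omega>) j) y}) \<partial>M)"
    using R by (intro emeasure_given_part) auto
  also have "\<dots> = (\<integral>\<^sup>+\<omega>. indicator {z. A z} (X j \<omega>) * (\<Prod>k\<in>R. emeasure \<mu> {y. C k (X j \<omega>) y}) \<partial>M)"
    by (simp add: indicator_def)
  also have "\<dots> = (\<integral>\<^sup>+z. indicator {z. A z} z * (\<Prod>k\<in>R. emeasure \<mu> {y. C k z y}) \<partial>distr M borel (X j))"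
  proof (rule nn_integral_distr[symmetric])
    show "X j \<in> measurable M borel" by measurable
    have "(\<lambda>z. emeasure \<mu> {y. C k z y}) \<in> borel_measurable borel" if "k \<in> R" for k
    proof -
      have "sets ((borel :: real measure) \<Otimes>\<^sub>M \<mu>) = sets ((borel :: real measure) \<Otimes>\<^sub>M borel)"
        by (intro sets_pair_measure_cong) auto
      from this sets_eq_imp_space_eq[OF this]
      have "{p \<in> space (borel \<Otimes>\<^sub>M \<mu>). C k (fst p) (snd p)} \<in> sets (borel \<Otimes>\<^sub>M \<mu>)"
        using C[OF that] unfolding pred_def by simp
      then show ?thesis
        by (intro mu.measurable_emeasure) auto
    qed
    then show "(\<lambda>z. indicator {z. A z} z * (\<Prod>k\<in>R. emeasure \<mu> {y. C k z y}))
        \<in> borel_measurable (distr M borel (X j))"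
      unfolding measurable_distr_eq1 by (intro borel_measurable_times_ennreal borel_measurable_prod_ennreal) auto
  qed
  also have "distr M borel (X j) = \<mu>" using law R by auto
  finally show ?thesis by simp
qed

lemma prob_pair_le:
  assumes jk: "j \<noteq> k" "j \<ge> 1" "k \<ge> 1"
    and C [measurable]: "Measurable.pred (borel \<Otimes>\<^sub>M borel) (\<lambda>p. C (fst p) (snd p))"
    and le: "\<And>z. measure \<mu> {y. C z y} \<le> b"
  shows "prob {\<omega> \<in> space M. C (X j \<omega>) (X k \<omega>)} \<le> b"
proof -
  interpret mu: prob_space \<mu> by (rule prob_space_mu)
  have b: "b \<ge> 0" using le[of 0] measure_nonneg[of \<mu> "{y. C 0 y}"] by linarith
  have "emeasure M {\<omega> \<in> space M. True \<and> (\<forall>k\<in>{k}. C (X j \<omega>) (X k \<omega>))} =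
      (\<integral>\<^sup>+z. indicator {z. True} z * (\<Prod>k\<in>{k}. emeasure \<mu> {y. C z y}) \<partial>\<mu>)"
    using jk by (intro emeasure_given_one) auto
  also have "\<dots> \<le> (\<integral>\<^sup>+z. ennreal b \<partial>\<mu>)"
    using le by (intro nn_integral_mono) (simp add: mu.emeasure_eq_measure ennreal_leI)
  also have "\<dots> = ennreal b" by (simp add: mu.emeasure_space_1[simplified])
  finally show ?thesis using b by (simp add: emeasure_eq_measure)
qed

text \<open>
  The interval is closed at its left end, so that a tied point is not isolated where
  \<open>g \<ge> 0\<close>, and isolated points have disjoint intervals even if ties are possible.
\<close>
definition isolated :: "nat \<Rightarrow> real set \<Rightarrow> (real \<Rightarrow> real) \<Rightarrow> nat \<Rightarrow> 'a set" where
  "isolated n K g j = {\<omega> \<in> space M. X j \<omega> \<in> K \<and> (\<forall>k\<in>{1..n} - {j}. X k \<omega> \<notin> {X j \<omega>..X j \<omega> + g (X j \<omega>)})}"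

lemma isolated_event:
  assumes [measurable]: "K \<in> sets borel" "g \<in> borel_measurable borel"
  shows "isolated n K g j \<in> events"
proof -
  have [simp]: "finite ({1..n} - {j})" by simp
  show ?thesis unfolding isolated_def atLeastAtMost_iff by measurable
qed

lemma interval_hit_event:
  assumes [measurable]: "K \<in> sets borel" "g \<in> borel_measurable borel"
  shows "{\<omega> \<in> space M. X i \<omega> \<in> K \<and> X i \<omega> \<le> X j \<omega> \<and> X j \<omega> \<le> X i \<omega> + g (X i \<omega>)} \<in> events"
  by measurable

lemma outside_event:
  assumes [measurable]: "K \<in> sets borel"
  shows "{\<omega> \<in> space M. X j \<omega> \<notin> K} \<in> events"
  by measurable

text \<open>
  If all points with indices in \<open>J\<close> are isolated, then their intervals are disjoint and the
  other \<open>n - r\<close> points avoid their union, which has mass between \<open>r lo\<close> and \<open>r hi\<close>. For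
  the lower bound it remains to discount the event that some point of \<open>J\<close> lies outside \<open>K\<close>
  or in the interval of another one, which a union bound controls.
\<close>
lemma prob_jointly_isolated:
  assumes J: "J \<subseteq> {1..n}" "J \<noteq> {}" "card J = r"
    and K [measurable]: "K \<in> sets borel" and g [measurable]: "g \<in> borel_measurable borel"
    and g0: "\<And>z. z \<in> K \<Longrightarrow> g z \<ge> 0"
    and lo: "\<And>z. z \<in> K \<Longrightarrow> lo \<le> measure \<mu> {z..z + g z}" "0 \<le> lo" "real r * lo \<le> 1"
    and hi: "\<And>z. z \<in> K \<Longrightarrow> measure \<mu> {z..z + g z} \<le> hi" "0 \<le> hi" "real r * hi \<le> 1"
  defines "P \<equiv> prob {\<omega> \<in> space M. \<forall>j\<in>J. \<omega> \<in> isolated n K g j}"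
  shows "P \<le> (1 - real r * lo) ^ (n - r)"
    and "P \<ge> (1 - real r * hi) ^ (n - r) * (1 - real r * (1 - measure \<mu> K) - (real r)\<^sup>2 * hi)"
proof -
  interpret mu: prob_space \<mu> by (rule prob_space_mu)
  define R where "R = {1..n} - J"
  have finJ [simp]: "finite J" using finite_subset[OF J(1)] by simp
  have cR: "card R = n - r" using J by (simp add: R_def card_Diff_subset)
  define A where "A v \<longleftrightarrow> (\<forall>j\<in>J. v j \<in> K) \<and> (\<forall>j\<in>J. \<forall>k\<in>J. j \<noteq> k \<longrightarrow> \<not> (v j \<le> v k \<and> v k \<le> v j + g (v j)))"
    for v :: "nat \<Rightarrow> real"
  define C where "C v y \<longleftrightarrow> (\<forall>j\<in>J. \<not> (v j \<le> y \<and> y \<le> v j + g (v j)))" for v :: "nat \<Rightarrow> real" and y :: real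
  let ?v = "\<lambda>\<omega>. \<lambda>j\<in>J. X j \<omega>"
  have comp: "(\<lambda>v. v j) \<in> borel_measurable (Pi\<^sub>M J (\<lambda>_. borel :: real measure))" if "j \<in> J" for j
    using that by (rule measurable_component_singleton)
  have Apred: "Measurable.pred (Pi\<^sub>M J (\<lambda>_. borel)) A"
    unfolding A_def
  proof (intro pred_intros_logic(3) pred_intros_finite(3) finJ)
    fix j assume j: "j \<in> J"
    show "Measurable.pred (Pi\<^sub>M J (\<lambda>_. borel)) (\<lambda>v. v j \<in> K)"
      by (rule measurable_compose[OF comp[OF j]]) (use K in simp)
    fix k assume k: "k \<in> J"
    show "Measurable.pred (Pi\<^sub>M J (\<lambda>_. borel)) (\<lambda>v. j \<noteq> k \<longrightarrow> \<not> (v j \<le> v k \<and> v k \<le> v j + g (v j)))"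
    proof (cases "j = k")
      case False
      have "Measurable.pred (Pi\<^sub>M J (\<lambda>_. borel)) (\<lambda>v. v j \<le> v k \<and> v k \<le> v j + g (v j))"
        by (rule pred_between[OF comp[OF j] comp[OF k] borel_measurable_add[OF comp[OF j] measurable_compose[OF comp[OF j] g]]])
      then have "Measurable.pred (Pi\<^sub>M J (\<lambda>_. borel)) (\<lambda>v. \<not> (v j \<le> v k \<and> v k \<le> v j + g (v j)))"
        by (rule pred_intros_logic(2))
      then show ?thesis using False by simp
    qed simp
  qed
  have Cpred: "Measurable.pred (Pi\<^sub>M J (\<lambda>_. borel) \<Otimes>\<^sub>M borel) (\<lambda>p. C (fst p) (snd p))"
    unfolding C_def
  proof (intro pred_intros_finite(3) pred_intros_logic(2) finJ)
    fix j assume j: "j \<in> J"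
    have *: "(\<lambda>p. fst p j) \<in> borel_measurable (Pi\<^sub>M J (\<lambda>_. borel :: real measure) \<Otimes>\<^sub>M (borel :: real measure))"
      using measurable_compose[OF measurable_fst comp[OF j]] .
    show "Measurable.pred (Pi\<^sub>M J (\<lambda>_. borel) \<Otimes>\<^sub>M borel) (\<lambda>p. fst p j \<le> snd p \<and> snd p \<le> fst p j + g (fst p j))"
      by (rule pred_between[OF * measurable_snd borel_measurable_add[OF * measurable_compose[OF * g]]])
  qed
  have eq: "{\<omega> \<in> space M. \<forall>j\<in>J. \<omega> \<in> isolated n K g j} = {\<omega> \<in> space M. A (?v \<omega>) \<and> (\<forall>k\<in>R. C (?v \<omega>) (X k \<omega>))}"
  proof (rule Collect_cong, rule conj_cong[OF refl])
    fix \<omega>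
    let ?far = "\<lambda>j k. X k \<omega> \<notin> {X j \<omega>..X j \<omega> + g (X j \<omega>)}"
    assume w: "\<omega> \<in> space M"
    have split: "{1..n} - {j} = (J - {j}) \<union> R" if "j \<in> J" for j
      using that J(1) by (auto simp: R_def)
    have "(\<forall>j\<in>J. \<omega> \<in> isolated n K g j) \<longleftrightarrow> (\<forall>j\<in>J. X j \<omega> \<in> K \<and> (\<forall>k\<in>(J - {j}) \<union> R. ?far j k))"
      using w by (intro ball_cong refl) (simp only: isolated_def split mem_Collect_eq simp_thms)
    also have "\<dots> \<longleftrightarrow> (\<forall>j\<in>J. X j \<omega> \<in> K) \<and> (\<forall>j\<in>J. \<forall>k\<in>J - {j}. ?far j k) \<and> (\<forall>j\<in>J. \<forall>k\<in>R. ?far j k)"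
      unfolding ball_Un ball_conj_distrib by (rule refl)
    also have "(\<forall>j\<in>J. \<forall>k\<in>J - {j}. ?far j k) \<longleftrightarrow> (\<forall>j\<in>J. \<forall>k\<in>J. j \<noteq> k \<longrightarrow> ?far j k)"
      by (metis (no_types, lifting) Diff_iff singletonD singletonI)
    also have "(\<forall>j\<in>J. \<forall>k\<in>R. ?far j k) \<longleftrightarrow> (\<forall>k\<in>R. \<forall>j\<in>J. ?far j k)"
      by (simp only: Ball_def, metis)
    also have "(\<forall>j\<in>J. X j \<omega> \<in> K) \<and> (\<forall>j\<in>J. \<forall>k\<in>J. j \<noteq> k \<longrightarrow> ?far j k) \<and> (\<forall>k\<in>R. \<forall>j\<in>J. ?far j k) \<longleftrightarrow>
        ((\<forall>j\<in>J. X j \<omega> \<in> K) \<and> (\<forall>j\<in>J. \<forall>k\<in>J. j \<noteq> k \<longrightarrow> ?far j k)) \<and> (\<forall>k\<in>R. \<forall>j\<in>J. ?far j k)"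
      by (rule conj_assoc[symmetric])
    also have "\<dots> \<longleftrightarrow> A (?v \<omega>) \<and> (\<forall>k\<in>R. C (?v \<omega>) (X k \<omega>))"
      unfolding A_def C_def by simp
    finally show "(\<forall>j\<in>J. \<omega> \<in> isolated n K g j) \<longleftrightarrow> A (?v \<omega>) \<and> (\<forall>k\<in>R. C (?v \<omega>) (X k \<omega>))" .
  qed
  have Ev: "{\<omega> \<in> space M. A (?v \<omega>)} \<in> events"
  proof -
    have "?v \<in> measurable M (Pi\<^sub>M J (\<lambda>_. borel))" by measurable
    from measurable_compose[OF this Apred] show ?thesis unfolding pred_def .
  qed
  have main: "emeasure M {\<omega> \<in> space M. \<forall>j\<in>J. \<omega> \<in> isolated n K g j} =
      (\<integral>\<^sup>+\<omega>. indicator {\<omega>. A (?v \<omega>)} \<omega> * (\<Prod>k\<in>R. emeasure \<mu> {y. C (?v \<omega>) y}) \<partial>M)"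
    unfolding eq using J Apred Cpred by (intro emeasure_given_part) (auto simp: R_def)
  have one: "(1 - real r * hi) \<le> measure \<mu> {y. C v y} \<and> measure \<mu> {y. C v y} \<le> 1 - real r * lo" if "A v" for v
  proof -
    define B where "B j = {v j..v j + g (v j)}" for j
    have "disjoint_family_on B J"
      unfolding disjoint_family_on_def
    proof (intro ballI impI)
      fix i j assume ij: "i \<in> J" "j \<in> J" "i \<noteq> j"
      have "\<forall>j\<in>J. \<forall>k\<in>J. j \<noteq> k \<longrightarrow> \<not> (v j \<le> v k \<and> v k \<le> v j + g (v j))"
        using that unfolding A_def by (rule conjunct2)
      then have sep: "\<not> (v i \<le> v j \<and> v j \<le> v i + g (v i))" "\<not> (v j \<le> v i \<and> v i \<le> v j + g (v j))"
        using ij by metis+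
      have "y \<notin> B j" if "y \<in> B i" for y
        using that sep unfolding B_def atLeastAtMost_iff by linarith
      then show "B i \<inter> B j = {}" by blast
    qed
    moreover have "B ` J \<subseteq> sets \<mu>" by (auto simp: B_def)
    ultimately have "measure \<mu> (\<Union>j\<in>J. B j) = (\<Sum>j\<in>J. measure \<mu> (B j))"
      by (intro mu.finite_measure_finite_Union[OF finJ])
    moreover have "{y. C v y} = space \<mu> - (\<Union>j\<in>J. B j)" by (auto simp: C_def B_def)
    moreover have "measure \<mu> (space \<mu> - (\<Union>j\<in>J. B j)) = 1 - measure \<mu> (\<Union>j\<in>J. B j)"
      by (intro mu.prob_compl sets.finite_UN) (auto simp: B_def)
    moreover have "(\<Sum>j\<in>J. lo) \<le> (\<Sum>j\<in>J. measure \<mu> (B j))" "(\<Sum>j\<in>J. measure \<mu> (B j)) \<le> (\<Sum>j\<in>J. hi)"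
      using that lo(1) hi(1) unfolding A_def B_def by (intro sum_mono; blast)+
    ultimately show ?thesis using J by simp
  qed
  have prods: "(\<Prod>k\<in>R. emeasure \<mu> {y. C v y}) = ennreal (measure \<mu> {y. C v y} ^ (n - r))" for v
    by (simp add: mu.emeasure_eq_measure ennreal_power cR)
  have "emeasure M {\<omega> \<in> space M. \<forall>j\<in>J. \<omega> \<in> isolated n K g j} \<le> (\<integral>\<^sup>+\<omega>. ennreal ((1 - real r * lo) ^ (n - r)) \<partial>M)"
    unfolding main prods
    by (intro nn_integral_mono) (auto simp: indicator_def intro!: ennreal_leI power_mono dest: one)
  also have "\<dots> = ennreal ((1 - real r * lo) ^ (n - r))" by (simp add: emeasure_space_1)
  finally show "P \<le> (1 - real r * lo) ^ (n - r)"
    using lo(3) unfolding P_def by (simp add: emeasure_eq_measure)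
  have "ennreal ((1 - real r * hi) ^ (n - r) * prob {\<omega> \<in> space M. A (?v \<omega>)}) =
     (\<integral>\<^sup>+\<omega>. ennreal ((1 - real r * hi) ^ (n - r)) * indicator {\<omega> \<in> space M. A (?v \<omega>)} \<omega> \<partial>M)"
    using Ev hi by (subst nn_integral_cmult_indicator) (auto simp: emeasure_eq_measure ennreal_mult)
  also have "\<dots> \<le> emeasure M {\<omega> \<in> space M. \<forall>j\<in>J. \<omega> \<in> isolated n K g j}"
    unfolding main prods using hi(3)
    by (intro nn_integral_mono) (auto simp: indicator_def intro!: ennreal_leI power_mono dest: one)
  finally have low: "(1 - real r * hi) ^ (n - r) * prob {\<omega> \<in> space M. A (?v \<omega>)} \<le> P"
    unfolding P_def by (simp add: emeasure_eq_measure)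
  have KE: "prob {\<omega> \<in> space M. X j \<omega> \<notin> K} = 1 - measure \<mu> K" if "j \<in> J" for j
  proof -
    have "prob {\<omega> \<in> space M. X j \<omega> \<notin> K} = measure (distr M borel (X j)) (space \<mu> - K)"
      by (subst measure_distr) (auto intro!: arg_cong[where f=prob])
    also have "\<dots> = measure \<mu> (space \<mu> - K)" using law[of j] J that by auto
    also have "\<dots> = 1 - measure \<mu> K" by (intro mu.prob_compl) auto
    finally show ?thesis .
  qed
  define Q where "Q p = {\<omega> \<in> space M. X (fst p) \<omega> \<in> K \<and> X (fst p) \<omega> \<le> X (snd p) \<omega> \<and>
          X (snd p) \<omega> \<le> X (fst p) \<omega> + g (X (fst p) \<omega>)}" for p
  have Qm: "Q p \<in> events" for p unfolding Q_def by (rule interval_hit_event[OF K g])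
  have Km: "{\<omega> \<in> space M. X j \<omega> \<notin> K} \<in> events" for j by (rule outside_event[OF K])
  have Kprob: "prob (\<Union>j\<in>J. {\<omega> \<in> space M. X j \<omega> \<notin> K}) \<le> real r * (1 - measure \<mu> K)"
  proof -
    have "prob (\<Union>j\<in>J. {\<omega> \<in> space M. X j \<omega> \<notin> K}) \<le> (\<Sum>j\<in>J. prob {\<omega> \<in> space M. X j \<omega> \<notin> K})"
      using Km by (intro measure_UNION_le) auto
    then show ?thesis using KE J by simp
  qed
  have Qprob: "prob (\<Union>p\<in>{p \<in> J \<times> J. fst p \<noteq> snd p}. Q p) \<le> (real r)\<^sup>2 * hi"
  proof -
    have "prob (\<Union>p\<in>{p \<in> J \<times> J. fst p \<noteq> snd p}. Q p) \<le> (\<Sum>p\<in>{p \<in> J \<times> J. fst p \<noteq> snd p}. prob (Q p))"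
      using Qm by (intro measure_UNION_le) auto
    also have "\<dots> \<le> (\<Sum>p\<in>{p \<in> J \<times> J. fst p \<noteq> snd p}. hi)"
    proof (rule sum_mono)
      fix p assume p: "p \<in> {p \<in> J \<times> J. fst p \<noteq> snd p}"
      let ?C = "\<lambda>z y. z \<in> K \<and> z \<le> y \<and> y \<le> z + g z"
      have "fst p \<noteq> snd p" "1 \<le> fst p" "1 \<le> snd p" using p J by auto
      moreover have "Measurable.pred (borel \<Otimes>\<^sub>M borel) (\<lambda>p. ?C (fst p) (snd p))"
        by (rule interval_hit_pred[OF K g])
      moreover have "measure \<mu> {y. ?C z y} \<le> hi" for z
      proof -
        have "measure \<mu> {y. ?C z y} = (if z \<in> K then measure \<mu> {z..z + g z} else 0)"
          by (cases "z \<in> K") (auto intro!: arg_cong[where f="measure \<mu>"])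
        then show ?thesis using hi by auto
      qed
      ultimately show "prob (Q p) \<le> hi"
        unfolding Q_def by (rule prob_pair_le[of "fst p" "snd p" ?C hi])
    qed
    also have "\<dots> \<le> (\<Sum>p\<in>J \<times> J. hi)" using hi by (intro sum_mono2) auto
    also have "\<dots> = (real r)\<^sup>2 * hi" using J by (simp add: card_cartesian_product power2_eq_square)
    finally show ?thesis .
  qed
  \<comment> \<open>If \<open>A\<close> fails, then some point of \<open>J\<close> lies outside \<open>K\<close> or in the interval of another one.\<close>
  define bad where "bad = (\<Union>j\<in>J. {\<omega> \<in> space M. X j \<omega> \<notin> K}) \<union> (\<Union>p\<in>{p \<in> J \<times> J. fst p \<noteq> snd p}. Q p)"
  have "prob bad \<le> prob (\<Union>j\<in>J. {\<omega> \<in> space M. X j \<omega> \<notin> K}) + prob (\<Union>p\<in>{p \<in> J \<times> J. fst p \<noteq> snd p}. Q p)"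
    unfolding bad_def using Km Qm by (intro measure_Un_le sets.finite_UN) auto
  then have bad: "prob bad \<le> real r * (1 - measure \<mu> K) + (real r)\<^sup>2 * hi" using Kprob Qprob by linarith
  have badE: "bad \<in> events"
    unfolding bad_def using Km Qm by (intro sets.Un sets.finite_UN) auto
  have "space M - {\<omega> \<in> space M. A (?v \<omega>)} \<subseteq> bad"
  proof
    fix \<omega> assume "\<omega> \<in> space M - {\<omega> \<in> space M. A (?v \<omega>)}"
    then have w: "\<omega> \<in> space M" and nA: "\<not> A (?v \<omega>)" by auto
    show "\<omega> \<in> bad"
    proof (cases "\<forall>j\<in>J. X j \<omega> \<in> K")
      case True
      then obtain i j where ij: "i \<in> J" "j \<in> J" "i \<noteq> j" "X i \<omega> \<le> X j \<omega>" "X j \<omega> \<le> X i \<omega> + g (X i \<omega>)"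
        using nA unfolding A_def by auto
      then have "\<omega> \<in> Q (i, j)" using w True by (simp add: Q_def)
      then show ?thesis unfolding bad_def using ij by (intro UnI2 UN_I[of "(i, j)"]) auto
    next
      case False
      then show ?thesis unfolding bad_def using w by (intro UnI1) auto
    qed
  qed
  then have "prob (space M - {\<omega> \<in> space M. A (?v \<omega>)}) \<le> prob bad"
    using badE by (intro finite_measure_mono) auto
  then have "prob {\<omega> \<in> space M. A (?v \<omega>)} \<ge> 1 - real r * (1 - measure \<mu> K) - (real r)\<^sup>2 * hi"
    using bad Ev by (simp add: prob_compl)
  then have "(1 - real r * hi) ^ (n - r) * (1 - real r * (1 - measure \<mu> K) - (real r)\<^sup>2 * hi) \<le>
     (1 - real r * hi) ^ (n - r) * prob {\<omega> \<in> space M. A (?v \<omega>)}"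
    using hi by (intro mult_left_mono) auto
  with low show "P \<ge> (1 - real r * hi) ^ (n - r) * (1 - real r * (1 - measure \<mu> K) - (real r)\<^sup>2 * hi)"
    by linarith
qed

end

lemma binomial_over_power_limit:
  "(\<lambda>n. real (n choose r) / real n ^ r) \<longlonglongrightarrow> 1 / fact r"
proof -
  have "(\<lambda>n. (\<Prod>i<r. (real n - real i) / real n) / fact r) \<longlonglongrightarrow> (\<Prod>i<r. 1) / fact r"
  proof (intro tendsto_divide tendsto_prod tendsto_const)
    show "(\<lambda>n. (real n - real i) / real n) \<longlonglongrightarrow> 1" for i :: nat by real_asymp
  qed simp
  moreover have "real (n choose r) / real n ^ r = (\<Prod>i<r. (real n - real i) / real n) / fact r" for n
    by (simp add: binomial_gbinomial gbinomial_prod_rev prod_dividef atLeast0LessThan)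
  ultimately show ?thesis by simp
qed

lemma one_minus_power_bounds:
  fixes u :: real
  assumes "0 \<le> u" "u \<le> 1 / 2"
  shows "(1 - u) ^ m \<le> exp (- u * real m)" "exp (- (u + 2 * u\<^sup>2) * real m) \<le> (1 - u) ^ m"
proof -
  have "1 - u \<le> exp (- u)" using exp_ge_add_one_self[of "- u"] by simp
  then have "(1 - u) ^ m \<le> exp (- u) ^ m" using assms by (intro power_mono) auto
  also have "\<dots> = exp (- u * real m)"
    by (simp add: exp_of_nat_mult[symmetric] mult.commute del: mult_minus_left)
  finally show "(1 - u) ^ m \<le> exp (- u * real m)" .
  have "- u - 2 * u\<^sup>2 \<le> ln (1 - u)" using assms by (intro ln_one_minus_pos_lower_bound) auto
  then have "exp (- (u + 2 * u\<^sup>2)) \<le> 1 - u" using assms by (subst ln_ge_iff[symmetric]) auto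
  then have "exp (- (u + 2 * u\<^sup>2)) ^ m \<le> (1 - u) ^ m" by (intro power_mono) auto
  also have "exp (- (u + 2 * u\<^sup>2)) ^ m = exp (- (u + 2 * u\<^sup>2) * real m)"
    by (simp add: exp_of_nat_mult[symmetric] mult.commute)
  finally show "exp (- (u + 2 * u\<^sup>2) * real m) \<le> (1 - u) ^ m" .
qed

text \<open>
  The binomial coefficient grows like \<open>n ^ r / fact r\<close>, and \<open>r b\<close> times \<open>n\<close> exceeds
  \<open>r ln n\<close> by about \<open>r x\<close>, so the power behaves like \<open>exp (- r x) / n ^ r\<close>.
\<close>
lemma poisson_moment_limit:
  fixes b :: "nat \<Rightarrow> real"
  assumes lim: "(\<lambda>n. real n * b n - ln (real n)) \<longlonglongrightarrow> x"
  shows "(\<lambda>n. real (n choose r) * (1 - real r * b n) ^ (n - r)) \<longlonglongrightarrow> exp (- x) ^ r / fact r"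
    and "b \<longlonglongrightarrow> 0" and "eventually (\<lambda>n. b n \<ge> 0) sequentially"
proof -
  define y where "y n = real n * b n - ln (real n)" for n
  have y: "y \<longlonglongrightarrow> x" using lim unfolding y_def .
  have b: "eventually (\<lambda>n. b n = (y n + ln (real n)) / real n) sequentially"
    using eventually_gt_at_top[of 0] by eventually_elim (simp add: y_def)
  have l0: "(\<lambda>n. ln (real n) / real n) \<longlonglongrightarrow> 0" by real_asymp
  have i0: "(\<lambda>n. 1 / real n) \<longlonglongrightarrow> 0" by real_asymp
  have "(\<lambda>n. y n * (1 / real n) + ln (real n) / real n) \<longlonglongrightarrow> x * 0 + 0"
    by (intro tendsto_add tendsto_mult y l0 i0)
  then have "(\<lambda>n. (y n + ln (real n)) / real n) \<longlonglongrightarrow> 0" by (simp add: add_divide_distrib)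
  then show b0: "b \<longlonglongrightarrow> 0" by (rule Lim_transform_eventually) (use b in eventually_elim, simp)
  have "filterlim (\<lambda>n. y n + ln (real n)) at_top sequentially"
    by (rule filterlim_tendsto_add_at_top[OF y]) real_asymp
  then have "eventually (\<lambda>n. y n + ln (real n) \<ge> 0) sequentially"
    unfolding filterlim_at_top by blast
  with b show bge: "eventually (\<lambda>n. b n \<ge> 0) sequentially"
    by eventually_elim simp
  have u0: "(\<lambda>n. real r * b n) \<longlonglongrightarrow> 0" using tendsto_mult_left[OF b0, of "real r"] by simp
  have usmall: "eventually (\<lambda>n. real r * b n \<le> 1 / 2) sequentially"
    using order_tendstoD(2)[OF u0, of "1/2"] by (auto elim: eventually_mono)
  have sq: "(\<lambda>n. real n * (b n)\<^sup>2) \<longlonglongrightarrow> 0"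
  proof -
    have "(\<lambda>n. (y n)\<^sup>2 * (1 / real n) + 2 * y n * (ln (real n) / real n) + (ln (real n))\<^sup>2 / real n) \<longlonglongrightarrow> x\<^sup>2 * 0 + 2 * x * 0 + 0"
      by (intro tendsto_add tendsto_mult tendsto_power tendsto_const y l0 i0) real_asymp
    then have "(\<lambda>n. (y n)\<^sup>2 * (1 / real n) + 2 * y n * (ln (real n) / real n) + (ln (real n))\<^sup>2 / real n) \<longlonglongrightarrow> 0"
      by simp
    then show ?thesis
    proof (rule Lim_transform_eventually)
      show "eventually (\<lambda>n. (y n)\<^sup>2 * (1 / real n) + 2 * y n * (ln (real n) / real n) + (ln (real n))\<^sup>2 / real n = real n * (b n)\<^sup>2) sequentially"
        using b eventually_gt_at_top[of 0]
      proof eventually_elim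
        case (elim n)
        have "real n * (b n)\<^sup>2 = (y n + ln (real n))\<^sup>2 / real n"
          unfolding elim(1) using elim(2) by (simp add: power2_eq_square)
        then show ?case by (simp add: power2_sum add_divide_distrib)
      qed
    qed
  qed
  \<comment> \<open>Replacing \<open>n - r\<close> by \<open>n\<close> in the exponent costs \<open>r\<^sup>2 b n\<close>, which tends to \<open>0\<close>.\<close>
  have e1: "(\<lambda>n. real r * ln (real n) - real r * b n * real (n - r)) \<longlonglongrightarrow> - real r * x"
  proof -
    have "(\<lambda>n. - real r * y n + (real r)\<^sup>2 * b n) \<longlonglongrightarrow> - real r * x + (real r)\<^sup>2 * 0"
      by (intro tendsto_add tendsto_mult tendsto_const y b0)
    then have "(\<lambda>n. - real r * y n + (real r)\<^sup>2 * b n) \<longlonglongrightarrow> - real r * x"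
      by simp
    then show ?thesis
    proof (rule Lim_transform_eventually)
      show "eventually (\<lambda>n. - real r * y n + (real r)\<^sup>2 * b n = real r * ln (real n) - real r * b n * real (n - r)) sequentially"
        using eventually_ge_at_top[of r]
        by eventually_elim (simp add: of_nat_diff y_def power2_eq_square algebra_simps)
    qed
  qed
  have e2: "(\<lambda>n. 2 * (real r * b n)\<^sup>2 * real (n - r)) \<longlonglongrightarrow> 0"
  proof (rule tendsto_sandwich[where f="\<lambda>_. 0" and h="\<lambda>n. 2 * (real r)\<^sup>2 * (real n * (b n)\<^sup>2)"])
    show "(\<lambda>n. 2 * (real r)\<^sup>2 * (real n * (b n)\<^sup>2)) \<longlonglongrightarrow> 0"
      using tendsto_mult_left[OF sq, of "2 * (real r)\<^sup>2"] by simp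
    show "\<forall>\<^sub>F n in sequentially. 2 * (real r * b n)\<^sup>2 * real (n - r) \<le> 2 * (real r)\<^sup>2 * (real n * (b n)\<^sup>2)"
      by (intro always_eventually allI) (auto simp: power_mult_distrib mult.assoc[symmetric] mult.commute[of "real _" "(b _)\<^sup>2"] intro!: mult_left_mono)
  qed auto
  have npow: "real n ^ r = exp (real r * ln (real n))" if "n > 0" for n
    using that by (simp add: exp_of_nat_mult)
  have pl: "(\<lambda>n. real n ^ r * (1 - real r * b n) ^ (n - r)) \<longlonglongrightarrow> exp (- real r * x)"
  proof (rule tendsto_sandwich[where h="\<lambda>n. exp (real r * ln (real n) - real r * b n * real (n - r))"
      and f="\<lambda>n. exp (real r * ln (real n) - real r * b n * real (n - r) - 2 * (real r * b n)\<^sup>2 * real (n - r))"])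
    show "(\<lambda>n. exp (real r * ln (real n) - real r * b n * real (n - r))) \<longlonglongrightarrow> exp (- real r * x)"
      by (intro tendsto_exp e1)
    have "(\<lambda>n. exp (real r * ln (real n) - real r * b n * real (n - r) - 2 * (real r * b n)\<^sup>2 * real (n - r)))
        \<longlonglongrightarrow> exp (- real r * x - 0)"
      by (intro tendsto_exp tendsto_diff e1 e2)
    then show "(\<lambda>n. exp (real r * ln (real n) - real r * b n * real (n - r) - 2 * (real r * b n)\<^sup>2 * real (n - r)))
        \<longlonglongrightarrow> exp (- real r * x)" by simp
    show "\<forall>\<^sub>F n in sequentially. real n ^ r * (1 - real r * b n) ^ (n - r) \<le> exp (real r * ln (real n) - real r * b n * real (n - r))"
      using usmall bge eventually_gt_at_top[of 0]
    proof eventually_elim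
      case (elim n)
      have "(1 - real r * b n) ^ (n - r) \<le> exp (- (real r * b n) * real (n - r))"
        using elim by (intro one_minus_power_bounds) auto
      then have "real n ^ r * (1 - real r * b n) ^ (n - r) \<le> real n ^ r * exp (- (real r * b n) * real (n - r))"
        by (intro mult_left_mono) auto
      also have "\<dots> = exp (real r * ln (real n) - real r * b n * real (n - r))"
        using elim by (simp only: npow exp_add[symmetric]) simp
      finally show ?case .
    qed
    show "\<forall>\<^sub>F n in sequentially. exp (real r * ln (real n) - real r * b n * real (n - r) - 2 * (real r * b n)\<^sup>2 * real (n - r)) \<le> real n ^ r * (1 - real r * b n) ^ (n - r)"
      using usmall bge eventually_gt_at_top[of 0]
    proof eventually_elim
      case (elim n)
      have "exp (- (real r * b n + 2 * (real r * b n)\<^sup>2) * real (n - r)) \<le> (1 - real r * b n) ^ (n - r)"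
        using elim by (intro one_minus_power_bounds) auto
      then have "real n ^ r * exp (- (real r * b n + 2 * (real r * b n)\<^sup>2) * real (n - r)) \<le> real n ^ r * (1 - real r * b n) ^ (n - r)"
        by (intro mult_left_mono) auto
      also have "real n ^ r * exp (- (real r * b n + 2 * (real r * b n)\<^sup>2) * real (n - r)) =
         exp (real r * ln (real n) - real r * b n * real (n - r) - 2 * (real r * b n)\<^sup>2 * real (n - r))"
        using elim by (simp only: npow exp_add[symmetric]) (simp add: algebra_simps)
      finally show ?case .
    qed
  qed
  have "(\<lambda>n. real (n choose r) / real n ^ r * (real n ^ r * (1 - real r * b n) ^ (n - r))) \<longlonglongrightarrow> 1 / fact r * exp (- real r * x)"
    by (intro tendsto_mult binomial_over_power_limit pl)
  also have "1 / fact r * exp (- real r * x) = exp (- x) ^ r / fact r"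
    by (simp add: exp_of_nat_mult[symmetric])
  finally show "(\<lambda>n. real (n choose r) * (1 - real r * b n) ^ (n - r)) \<longlonglongrightarrow> exp (- x) ^ r / fact r"
    by (rule Lim_transform_eventually) (use eventually_gt_at_top[of 0] in eventually_elim, simp)
qed

text \<open>
  The number of isolated points is asymptotically Poisson with parameter \<open>exp (- x)\<close>. The
  interval attached to a point \<open>z\<close> may depend on \<open>z\<close>; only its mass matters.
\<close>
lemma (in iid_sample) no_isolated_point_limit:
  assumes K: "\<And>n. K n \<in> sets borel" and g: "\<And>n. g n \<in> borel_measurable borel"
    and bounds: "eventually (\<lambda>n. \<forall>z\<in>K n. 0 \<le> g n z \<and> lo n \<le> measure \<mu> {z..z + g n z} \<and>
       measure \<mu> {z..z + g n z} \<le> hi n) sequentially"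
    and lo: "(\<lambda>n. real n * lo n - ln (real n)) \<longlonglongrightarrow> x"
    and hi: "(\<lambda>n. real n * hi n - ln (real n)) \<longlonglongrightarrow> x"
    and mass: "(\<lambda>n. measure \<mu> (K n)) \<longlonglongrightarrow> 1"
  shows "(\<lambda>n. prob {\<omega> \<in> space M. \<forall>j\<in>{1..n}. \<omega> \<notin> isolated n (K n) (g n) j}) \<longlonglongrightarrow> exp (- exp (- x))"
proof (rule poisson_limit_of_joint_sums)
  show "isolated n (K n) (g n) i \<in> events" for n i
    using isolated_event[OF K g] .
  fix r :: nat
  show "(\<lambda>n. joint_sum {1..n} (isolated n (K n) (g n)) r) \<longlonglongrightarrow> exp (- x) ^ r / fact r"
  proof (cases "r = 0")
    case True
    have "joint_sum {1..n} (isolated n (K n) (g n)) 0 = 1" for n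
    proof -
      have "{J. J \<subseteq> {1..n} \<and> card J = 0} = {{}}" by (auto dest: finite_subset)
      then show ?thesis unfolding joint_sum_def by (simp add: prob_space)
    qed
    then show ?thesis using True by simp
  next
    case False
    note L = poisson_moment_limit[OF lo] and H = poisson_moment_limit[OF hi]
    let ?P = "\<lambda>n J. prob {\<omega> \<in> space M. \<forall>j\<in>J. \<omega> \<in> isolated n (K n) (g n) j}"
    have small: "eventually (\<lambda>n. real r * b n \<le> 1) sequentially" if "b \<longlonglongrightarrow> 0" for b :: "nat \<Rightarrow> real"
      using order_tendstoD(2)[OF tendsto_mult_left[OF that, of "real r"], of 1] by (auto elim: eventually_mono)
    let ?c = "\<lambda>n. 1 - real r * (1 - measure \<mu> (K n)) - (real r)\<^sup>2 * hi n"
    have ev: "eventually (\<lambda>n. \<forall>J. J \<subseteq> {1..n} \<and> card J = r \<longrightarrow> ?P n J \<le> (1 - real r * lo n) ^ (n - r) \<and>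
       (1 - real r * hi n) ^ (n - r) * ?c n \<le> ?P n J) sequentially"
      using bounds small[OF L(2)] small[OF H(2)] L(3) H(3)
    proof eventually_elim
      case (elim n)
      show ?case
      proof (intro allI impI conjI)
        fix J assume J: "J \<subseteq> {1..n} \<and> card J = r"
        then have "J \<noteq> {}" using False by auto
        with J elim show "?P n J \<le> (1 - real r * lo n) ^ (n - r)"
          by (intro prob_jointly_isolated(1)[where hi="hi n"] K g) auto
        from \<open>J \<noteq> {}\<close> J elim show "(1 - real r * hi n) ^ (n - r) * ?c n \<le> ?P n J"
          by (intro prob_jointly_isolated(2)[where lo="lo n"] K g) auto
      qed
    qed
    have card: "card {J. J \<subseteq> {1..n} \<and> card J = r} = n choose r" for n
      using n_subsets[of "{1..n}" r] by simp
    show ?thesis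
    proof (rule tendsto_sandwich[where h="\<lambda>n. real (n choose r) * (1 - real r * lo n) ^ (n - r)"
        and f="\<lambda>n. real (n choose r) * (1 - real r * hi n) ^ (n - r) * ?c n"])
      show "(\<lambda>n. real (n choose r) * (1 - real r * lo n) ^ (n - r)) \<longlonglongrightarrow> exp (- x) ^ r / fact r"
        by (rule L(1))
      have "?c \<longlonglongrightarrow> 1 - real r * (1 - 1) - (real r)\<^sup>2 * 0"
        by (intro tendsto_diff tendsto_mult tendsto_const mass H(2))
      then have "(\<lambda>n. real (n choose r) * (1 - real r * hi n) ^ (n - r) * ?c n) \<longlonglongrightarrow> exp (- x) ^ r / fact r * (1 - real r * (1 - 1) - (real r)\<^sup>2 * 0)"
        by (intro tendsto_mult[OF H(1)])
      then show "(\<lambda>n. real (n choose r) * (1 - real r * hi n) ^ (n - r) * ?c n) \<longlonglongrightarrow> exp (- x) ^ r / fact r"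
        by simp
      show "\<forall>\<^sub>F n in sequentially. joint_sum {1..n} (isolated n (K n) (g n)) r \<le> real (n choose r) * (1 - real r * lo n) ^ (n - r)"
        using ev
      proof eventually_elim
        case (elim n)
        then have "joint_sum {1..n} (isolated n (K n) (g n)) r \<le> (\<Sum>J | J \<subseteq> {1..n} \<and> card J = r. (1 - real r * lo n) ^ (n - r))"
          unfolding joint_sum_def by (intro sum_mono) auto
        then show ?case unfolding sum_constant card .
      qed
      show "\<forall>\<^sub>F n in sequentially. real (n choose r) * (1 - real r * hi n) ^ (n - r) * ?c n \<le> joint_sum {1..n} (isolated n (K n) (g n)) r"
        using ev
      proof eventually_elim
        case (elim n)
        then have "(\<Sum>J | J \<subseteq> {1..n} \<and> card J = r. (1 - real r * hi n) ^ (n - r) * ?c n) \<le> joint_sum {1..n} (isolated n (K n) (g n)) r"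
          unfolding joint_sum_def by (intro sum_mono) auto
        then show ?case unfolding sum_constant card mult.assoc .
      qed
    qed
  qed
qed simp

section \<open>Gaps in the tails\<close>

text \<open>
  The set \<open>D\<close> consists of the points above \<open>z j\<close>. It is named explicitly, and not defined
  from \<open>z\<close>, so that the event becomes a finite union of events to which conditioning on
  \<open>z j\<close> applies. The factor \<open>card D\<close> in the length of the gap compensates that \<open>card D\<close>
  points have to lie beyond it.
\<close>
definition wide_gap :: "(nat \<Rightarrow> real) \<Rightarrow> nat \<Rightarrow> real \<Rightarrow> real \<Rightarrow> bool" where
  "wide_gap z n a s \<longleftrightarrow> (\<exists>j\<in>{1..n}. \<exists>D\<in>Pow ({1..n} - {j}) - {{}}. a \<le> z j \<and>
     (\<forall>i\<in>{1..n} - {j}. if i \<in> D then z j + s / real (card D) \<le> z i else z i \<le> z j))"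

lemma gaussian_upper_lower:
  "measure gaussian {z..} + measure gaussian {..z} = 1"
proof -
  have "measure gaussian ({z..} \<union> {..<z}) = measure gaussian {z..} + measure gaussian {..<z}"
    by (intro gaussian.finite_measure_Union) auto
  moreover have "{z..} \<union> {..<z} = space gaussian" by auto
  moreover have "measure gaussian ({..<z} \<union> {z}) = measure gaussian {..<z} + measure gaussian {z}"
    by (intro gaussian.finite_measure_Union) auto
  moreover have "{..<z} \<union> {z} = {..z}" by auto
  ultimately show ?thesis
    using gaussian.prob_space measure_gaussian_singleton[of z] by simp
qed

locale gaussian_sample = iid_sample M X gaussian for M :: "'a measure" and X
begin

lemma gaussian_sample_minus: "gaussian_sample M (\<lambda>i \<omega>. - X i \<omega>)"
proof unfold_locales
  show "(\<lambda>\<omega>. - X i \<omega>) \<in> borel_measurable M" for i by measurable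
  show "indep_vars (\<lambda>_. borel) (\<lambda>i \<omega>. - X i \<omega>) {1..}"
    by (rule indep_vars_compose2[OF indep]) auto
  fix i :: nat assume i: "i \<ge> 1"
  have "distr M borel (\<lambda>\<omega>. - X i \<omega>) = distr (distr M borel (X i)) borel uminus"
    by (subst distr_distr) (auto simp: comp_def)
  also have "\<dots> = distr gaussian borel uminus" using law[OF i] by simp
  also have "\<dots> = gaussian"
  proof (rule measure_eqI)
    fix A assume "A \<in> sets (distr gaussian borel uminus)"
    then have A: "A \<in> sets borel" by simp
    have "emeasure (distr gaussian borel uminus) A = emeasure gaussian (uminus -` A)"
      using A by (subst emeasure_distr) auto
    then show "emeasure (distr gaussian borel uminus) A = emeasure gaussian A"
      using measure_gaussian_minus[OF A] by (simp add: gaussian.emeasure_eq_measure)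
  qed simp
  finally show "distr M borel (\<lambda>\<omega>. - X i \<omega>) = gaussian" .
qed

lemma wide_gap_event: "{\<omega> \<in> space M. wide_gap (\<lambda>i. X i \<omega>) n a s} \<in> events"
  unfolding wide_gap_def by measurable

text \<open>
  Given \<open>z j = z\<close> with \<open>z \<ge> a\<close>, the event for a set \<open>D\<close> of size \<open>k\<close> requires \<open>k\<close>
  points beyond \<open>z + s / k\<close> and the others below \<open>z\<close>. Each of the \<open>k\<close> points costs an
  additional factor \<open>exp (- s / k * z)\<close> relative to lying beyond \<open>z\<close>; together this is
  at most \<open>exp (- s a)\<close> for every \<open>k\<close>. What is left are the probabilities of the disjoint
  events that \<open>D\<close> is the set of points above \<open>z\<close>, which add up to at most \<open>1\<close>.
\<close>
lemma prob_wide_gap_le: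
  assumes s: "s \<ge> 0"
  shows "prob {\<omega> \<in> space M. wide_gap (\<lambda>i. X i \<omega>) n a s} \<le> real n * (measure gaussian {a..} * exp (- (s * a)))"
proof -
  define C where "C D k z y \<longleftrightarrow> (if k \<in> D then z + s / real (card D) \<le> y else y \<le> z)" for D :: "nat set" and k and z y :: real
  define E where "E j D = {\<omega> \<in> space M. a \<le> X j \<omega> \<and> (\<forall>k\<in>{1..n} - {j}. C D k (X j \<omega>) (X k \<omega>))}" for j D
  have Em [measurable]: "E j D \<in> events" for j D
    unfolding E_def C_def by measurable
  have Cm: "Measurable.pred (borel \<Otimes>\<^sub>M borel) (\<lambda>p. C D k (fst p) (snd p))" for D k
    unfolding C_def by (cases "k \<in> D") simp_all
  have one: "(\<Sum>D\<in>Pow ({1..n} - {j}) - {{}}. prob (E j D)) \<le> measure gaussian {a..} * exp (- (s * a))"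
    if j: "j \<in> {1..n}" for j
  proof -
    let ?R = "{1..n} - {j}"
    let ?F = "\<lambda>D z. indicator {z. a \<le> z} z * (\<Prod>k\<in>?R. emeasure gaussian {y. C D k z y})"
    have "ennreal (prob (E j D)) = (\<integral>\<^sup>+z. ?F D z \<partial>gaussian)" for D
      unfolding emeasure_eq_measure[symmetric] E_def
      using j Cm by (intro emeasure_given_one) auto
    then have "ennreal (\<Sum>D\<in>Pow ?R - {{}}. prob (E j D)) = (\<Sum>D\<in>Pow ?R - {{}}. \<integral>\<^sup>+z. ?F D z \<partial>gaussian)"
      by (subst sum_ennreal[symmetric]) auto
    also have "\<dots> \<le> (\<Sum>D\<in>Pow ?R - {{}}. \<integral>\<^sup>+z. ennreal (exp (- (s * a)) * (measure gaussian {z..} ^ card D * measure gaussian {..z} ^ card (?R - D))) * indicator {a..} z \<partial>gaussian)"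
    proof (intro sum_mono nn_integral_mono)
      fix D z assume D: "D \<in> Pow ?R - {{}}"
      then have fD: "finite D" "card D > 0" by (auto intro: finite_subset simp: card_gt_0_iff)
      define p where "p = measure gaussian {z..}"
      define q where "q = measure gaussian {..z}"
      show "?F D z \<le> ennreal (exp (- (s * a)) * (p ^ card D * q ^ card (?R - D))) * indicator {a..} z"
      proof (cases "a \<le> z")
        case True
        define t where "t = s / real (card D)"
        have t: "t \<ge> 0" "real (card D) * t = s" using s fD by (auto simp: t_def)
        have hazard: "measure gaussian {z + t..} \<le> exp (- (t * a)) * p"
        proof -
          have "measure gaussian {z + t..} \<le> exp (- (t * z + t\<^sup>2 / 2)) * p"
            unfolding p_def using t by (intro measure_gaussian_shift_le) auto
          also have "\<dots> \<le> exp (- (t * a)) * p"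
          proof (rule mult_right_mono)
            have "t * a \<le> t * z" "0 \<le> t\<^sup>2" using mult_left_mono[OF True t(1)] by auto
            then have "- (t * z + t\<^sup>2 / 2) \<le> - (t * a)" by linarith
            then show "exp (- (t * z + t\<^sup>2 / 2)) \<le> exp (- (t * a))" by simp
          qed (simp add: p_def)
          finally show ?thesis .
        qed
        have "(\<Prod>k\<in>?R. emeasure gaussian {y. C D k z y}) = (\<Prod>k\<in>?R. if k \<in> D then ennreal (measure gaussian {z + t..}) else ennreal q)"
          by (intro prod.cong refl)
            (auto simp: C_def t_def q_def gaussian.emeasure_eq_measure atLeast_def atMost_def)
        also have "\<dots> = ennreal (measure gaussian {z + t..}) ^ card D * ennreal q ^ card (?R - D)"
        proof -
          have "?R \<inter> {k. k \<in> D} = D" "?R \<inter> - {k. k \<in> D} = ?R - D" using D by auto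
          then show ?thesis by (subst prod.If_cases) auto
        qed
        also have "\<dots> = ennreal (measure gaussian {z + t..} ^ card D * q ^ card (?R - D))"
          by (simp add: ennreal_power ennreal_mult q_def)
        also have "\<dots> \<le> ennreal ((exp (- (t * a)) * p) ^ card D * q ^ card (?R - D))"
          using hazard by (intro ennreal_leI mult_right_mono power_mono) (auto simp: q_def)
        also have "(exp (- (t * a)) * p) ^ card D = exp (- (s * a)) * p ^ card D"
          using t(2) by (simp add: power_mult_distrib exp_of_nat_mult[symmetric] mult.assoc[symmetric])
        finally show ?thesis using True by (simp add: mult.assoc)
      qed auto
    qed
    also have "\<dots> = (\<integral>\<^sup>+z. (\<Sum>D\<in>Pow ?R - {{}}. ennreal (exp (- (s * a)) * (measure gaussian {z..} ^ card D * measure gaussian {..z} ^ card (?R - D))) * indicator {a..} z) \<partial>gaussian)"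
    proof (subst nn_integral_sum)
      have m: "(\<lambda>z. measure gaussian {z..}) \<in> borel_measurable borel" "(\<lambda>z. measure gaussian {..z}) \<in> borel_measurable borel"
      proof -
        have "mono (\<lambda>z. measure gaussian {..z})" by (intro monoI gaussian.finite_measure_mono) auto
        then show *: "(\<lambda>z. measure gaussian {..z}) \<in> borel_measurable borel" by (rule borel_measurable_mono)
        have "(\<lambda>z. measure gaussian {z..}) = (\<lambda>z. 1 - measure gaussian {..z})"
          using gaussian_upper_lower by (intro ext) (simp add: algebra_simps)
        then show "(\<lambda>z. measure gaussian {z..}) \<in> borel_measurable borel" using * by simp
      qed
      show "(\<lambda>z. ennreal (exp (- (s * a)) * (measure gaussian {z..} ^ card D * measure gaussian {..z} ^ card (?R - D))) * indicator {a..} z) \<in> borel_measurable gaussian" for D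
        using m by measurable
    qed simp
    also have "\<dots> \<le> (\<integral>\<^sup>+z. ennreal (exp (- (s * a))) * indicator {a..} z \<partial>gaussian)"
    proof (intro nn_integral_mono)
      fix z
      \<comment> \<open>The sum over all \<open>D\<close> is the binomial expansion of \<open>(p + q) ^ (n - 1) = 1\<close>.\<close>
      define p where "p = measure gaussian {z..}"
      define q where "q = measure gaussian {..z}"
      have pq: "p + q = 1" "p \<ge> 0" "q \<ge> 0" using gaussian_upper_lower by (auto simp: p_def q_def)
      have "(\<Sum>D\<in>Pow ?R. p ^ card D * q ^ card (?R - D)) = (\<Prod>k\<in>?R. p + q)"
        by (subst prod_add) auto
      then have "(\<Sum>D\<in>Pow ?R. p ^ card D * q ^ card (?R - D)) = 1" using pq by simp
      moreover have "(\<Sum>D\<in>Pow ?R - {{}}. p ^ card D * q ^ card (?R - D)) \<le> (\<Sum>D\<in>Pow ?R. p ^ card D * q ^ card (?R - D))"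
        using pq by (intro sum_mono2) auto
      ultimately have le: "(\<Sum>D\<in>Pow ?R - {{}}. p ^ card D * q ^ card (?R - D)) \<le> 1" by simp
      have "(\<Sum>D\<in>Pow ?R - {{}}. ennreal (exp (- (s * a)) * (p ^ card D * q ^ card (?R - D))) * indicator {a..} z)
        = ennreal (\<Sum>D\<in>Pow ?R - {{}}. exp (- (s * a)) * (p ^ card D * q ^ card (?R - D))) * indicator {a..} z"
        using pq by (subst sum_distrib_right[symmetric], subst sum_ennreal) auto
      also have "\<dots> = ennreal (exp (- (s * a)) * (\<Sum>D\<in>Pow ?R - {{}}. p ^ card D * q ^ card (?R - D))) * indicator {a..} z"
        by (simp add: sum_distrib_left)
      also have "\<dots> \<le> ennreal (exp (- (s * a)) * 1) * indicator {a..} z"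
        using le by (intro mult_right_mono ennreal_leI mult_left_mono) auto
      finally show "(\<Sum>D\<in>Pow ?R - {{}}. ennreal (exp (- (s * a)) * (p ^ card D * q ^ card (?R - D))) * indicator {a..} z)
         \<le> ennreal (exp (- (s * a))) * indicator {a..} z" by simp
    qed
    also have "\<dots> = ennreal (measure gaussian {a..} * exp (- (s * a)))"
      by (subst nn_integral_cmult_indicator) (auto simp: gaussian.emeasure_eq_measure ennreal_mult'[symmetric] mult.commute)
    finally show ?thesis by (subst (asm) ennreal_le_iff) auto
  qed
  have eq: "{\<omega> \<in> space M. wide_gap (\<lambda>i. X i \<omega>) n a s} = (\<Union>j\<in>{1..n}. \<Union>D\<in>Pow ({1..n} - {j}) - {{}}. E j D)"
    unfolding wide_gap_def E_def C_def by auto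
  have "prob {\<omega> \<in> space M. wide_gap (\<lambda>i. X i \<omega>) n a s} \<le> (\<Sum>j\<in>{1..n}. prob (\<Union>D\<in>Pow ({1..n} - {j}) - {{}}. E j D))"
    unfolding eq by (intro measure_UNION_le sets.finite_UN) auto
  also have "\<dots> \<le> (\<Sum>j\<in>{1..n}. \<Sum>D\<in>Pow ({1..n} - {j}) - {{}}. prob (E j D))"
    by (intro sum_mono measure_UNION_le) auto
  also have "\<dots> \<le> (\<Sum>j\<in>{1..n}. measure gaussian {a..} * exp (- (s * a)))"
    by (intro sum_mono one)
  finally show ?thesis by simp
qed

lemma prob_ties: "prob {\<omega> \<in> space M. \<not> inj_on (\<lambda>i. X i \<omega>) {1..n}} = 0"
proof -
  have eq: "{\<omega> \<in> space M. \<not> inj_on (\<lambda>i. X i \<omega>) {1..n}} =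
    (\<Union>p\<in>{p \<in> {1..n} \<times> {1..n}. fst p \<noteq> snd p}. {\<omega> \<in> space M. X (snd p) \<omega> = X (fst p) \<omega>})"
    by (auto simp: inj_on_def) (metis atLeastAtMost_iff One_nat_def)
  have "prob {\<omega> \<in> space M. \<not> inj_on (\<lambda>i. X i \<omega>) {1..n}} \<le>
    (\<Sum>p\<in>{p \<in> {1..n} \<times> {1..n}. fst p \<noteq> snd p}. prob {\<omega> \<in> space M. X (snd p) \<omega> = X (fst p) \<omega>})"
    unfolding eq by (intro measure_UNION_le) auto
  also have "\<dots> \<le> (\<Sum>p\<in>{p \<in> {1..n} \<times> {1..n}. fst p \<noteq> snd p}. 0)"
  proof (rule sum_mono)
    fix p assume p: "p \<in> {p \<in> {1..n} \<times> {1..n}. fst p \<noteq> snd p}"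
    show "prob {\<omega> \<in> space M. X (snd p) \<omega> = X (fst p) \<omega>} \<le> 0"
      by (rule prob_pair_le[where C="\<lambda>z y. y = z"]) (use p in \<open>auto simp: measure_gaussian_singleton\<close>)
  qed
  finally show ?thesis by (simp add: measure_le_0_iff)
qed

lemma prob_max_le:
  assumes "a \<ge> 0"
  shows "prob {\<omega> \<in> space M. \<exists>j\<in>{1..n}. a \<le> X j \<omega>} \<le> real n * exp (- a\<^sup>2 / 2)"
proof -
  have "prob {\<omega> \<in> space M. \<exists>j\<in>{1..n}. a \<le> X j \<omega>} = prob (\<Union>j\<in>{1..n}. {\<omega> \<in> space M. a \<le> X j \<omega>})"
    by (intro arg_cong[where f=prob]) auto
  also have "\<dots> \<le> (\<Sum>j\<in>{1..n}. prob {\<omega> \<in> space M. a \<le> X j \<omega>})"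
    by (intro measure_UNION_le) auto
  also have "\<dots> = (\<Sum>j\<in>{1..n}. measure gaussian {a..})"
  proof (rule sum.cong[OF refl])
    fix j assume "j \<in> {1..n}"
    then have "measure gaussian {a..} = measure (distr M borel (X j)) {a..}" using law[of j] by simp
    also have "\<dots> = prob {\<omega> \<in> space M. a \<le> X j \<omega>}"
      by (subst measure_distr) (auto intro!: arg_cong[where f=prob])
    finally show "prob {\<omega> \<in> space M. a \<le> X j \<omega>} = measure gaussian {a..}" ..
  qed
  also have "\<dots> \<le> (\<Sum>j\<in>{1..n}. exp (- a\<^sup>2 / 2))"
    by (intro sum_mono measure_gaussian_tail_le assms)
  finally show ?thesis by simp
qed

end

section \<open>Comparison of the cluster index with isolated points\<close>

definition upper_sum :: "(nat \<Rightarrow> real) \<Rightarrow> nat \<Rightarrow> real \<Rightarrow> real" where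
  "upper_sum z n t = (\<Sum>k=1..n. if t < z k then z k else 0)"

lemma upper_sum_antimono: "0 \<le> s \<Longrightarrow> s \<le> t \<Longrightarrow> upper_sum z n t \<le> upper_sum z n s"
  unfolding upper_sum_def by (intro sum_mono) auto

lemma upper_sum_mono: "s \<le> t \<Longrightarrow> t \<le> 0 \<Longrightarrow> upper_sum z n s \<le> upper_sum z n t"
  unfolding upper_sum_def by (intro sum_mono) auto

lemma upper_excess_alt:
  "upper_excess z n t = upper_sum z n t - sample_mean z n * real (card {k\<in>{1..n}. t < z k})"
proof -
  have "{1..n} \<inter> {k. t < z k} = {k\<in>{1..n}. t < z k}" by auto
  then show ?thesis
    unfolding upper_excess_def upper_sum_def by (simp add: sum_subtractf sum.If_cases mult.commute)
qed

text \<open>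
  The function \<open>upper_sum z n\<close> increases up to \<open>0\<close> and decreases from there on, as does
  \<open>\<phi>\<close>. Hence control at the points of a grid extends to the points in between, with a
  loss given by the oscillation of \<open>\<phi>\<close> over one cell.
\<close>
lemma upper_excess_uniform:
  assumes h: "h > 0" and L: "L \<le> (real m - 1) * h" and e: "exp ((L + h) * h) \<le> 1 + \<eta> / 4" and \<eta>: "\<eta> > 0"
    and \<delta>: "\<delta> \<le> \<eta> / 4 * (real n * \<phi> L)"
    and grid: "\<And>i. i \<in> {- int m..int m} \<Longrightarrow> \<bar>upper_sum z n (of_int i * h) - real n * \<phi> (of_int i * h)\<bar> \<le> \<delta>"
    and mean: "\<bar>\<Sum>j=1..n. z j\<bar> \<le> \<delta>"
    and t: "\<bar>t\<bar> \<le> L"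
  shows "\<bar>upper_excess z n t - real n * \<phi> t\<bar> \<le> \<eta> * (real n * \<phi> t)"
proof -
  \<comment> \<open>The cell from \<open>p\<close> to \<open>q\<close> contains \<open>t\<close>. Both ends are multiples of \<open>h\<close>, so \<open>0\<close> is not in its interior.\<close>
  define i where "i = \<lfloor>t / h\<rfloor>"
  define p where "p = of_int i * h"
  define q where "q = of_int (i + 1) * h"
  have "of_int i \<le> t / h" "t / h < of_int i + 1" unfolding i_def by linarith+
  then have pq: "p \<le> t" "t < q" using h by (auto simp: p_def q_def field_simps)
  have qp: "q = p + h" by (simp add: p_def q_def algebra_simps)
  have "\<bar>t / h\<bar> \<le> real m - 1" using t L h by (simp add: abs_div pos_divide_le_eq)
  then have "i \<le> int m - 1" "- (int m) + 1 \<le> i" unfolding i_def by linarith+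
  then have i: "i \<in> {- int m..int m}" "i + 1 \<in> {- int m..int m}" by auto
  have gp: "\<bar>upper_sum z n p - real n * \<phi> p\<bar> \<le> \<delta>" unfolding p_def by (rule grid[OF i(1)])
  have gq: "\<bar>upper_sum z n q - real n * \<phi> q\<bar> \<le> \<delta>" unfolding q_def by (rule grid[OF i(2)])
  have between: "upper_sum z n t \<le> max (upper_sum z n p) (upper_sum z n q)"
    "min (upper_sum z n p) (upper_sum z n q) \<le> upper_sum z n t"
  proof -
    have "upper_sum z n q \<le> upper_sum z n t \<and> upper_sum z n t \<le> upper_sum z n p \<or>
      upper_sum z n p \<le> upper_sum z n t \<and> upper_sum z n t \<le> upper_sum z n q"
    proof (cases "0 \<le> i")
      case True
      then have "0 \<le> p" using h by (simp add: p_def)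
      then show ?thesis using pq by (intro disjI1 conjI upper_sum_antimono) auto
    next
      case False
      then have "of_int (i + 1) \<le> (0::real)" unfolding of_int_le_0_iff by linarith
      then have "q \<le> 0" using h unfolding q_def by (intro mult_nonpos_nonneg) auto
      then show ?thesis using pq by (intro disjI2 conjI upper_sum_mono) auto
    qed
    then show "upper_sum z n t \<le> max (upper_sum z n p) (upper_sum z n q)"
      "min (upper_sum z n p) (upper_sum z n q) \<le> upper_sum z n t" by auto
  qed
  have \<phi>n: "0 \<le> real n * \<phi> t" by simp
  have up: "\<phi> u \<le> \<phi> t * (1 + \<eta> / 4)" and lo: "\<phi> t * (1 - \<eta> / 4) \<le> \<phi> u" if "\<bar>u - t\<bar> \<le> h" for u
  proof -
    have "\<phi> u \<le> \<phi> t * exp ((L + h) * h)" by (rule phi_shift_bounds[OF t that])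
    also have "\<dots> \<le> \<phi> t * (1 + \<eta> / 4)" using e by (intro mult_left_mono) auto
    finally show "\<phi> u \<le> \<phi> t * (1 + \<eta> / 4)" .
    have "(1 - \<eta> / 4) * exp ((L + h) * h) \<le> 1"
    proof (cases "\<eta> / 4 \<le> 1")
      case True
      have "(1 - \<eta> / 4) * exp ((L + h) * h) \<le> (1 - \<eta> / 4) * (1 + \<eta> / 4)"
        using True e by (intro mult_left_mono) auto
      also have "\<dots> = 1 - (\<eta> / 4)\<^sup>2" by (simp add: power2_eq_square algebra_simps)
      finally show ?thesis by (smt (verit) zero_le_power2)
    next
      case False
      then have "(1 - \<eta> / 4) * exp ((L + h) * h) \<le> 0" by (intro mult_nonpos_nonneg) auto
      then show ?thesis by simp
    qed
    then have "1 - \<eta> / 4 \<le> 1 / exp ((L + h) * h)" by (subst pos_le_divide_eq) auto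
    then have "1 - \<eta> / 4 \<le> exp (- ((L + h) * h))"
      by (simp only: exp_minus inverse_eq_divide)
    then have "\<phi> t * (1 - \<eta> / 4) \<le> \<phi> t * exp (- ((L + h) * h))" by (intro mult_left_mono) auto
    also have "\<dots> \<le> \<phi> u" by (rule phi_shift_bounds[OF t that])
    finally show "\<phi> t * (1 - \<eta> / 4) \<le> \<phi> u" .
  qed
  have pt: "\<bar>p - t\<bar> \<le> h" "\<bar>q - t\<bar> \<le> h" using pq qp by auto
  have nup: "real n * \<phi> u \<le> real n * \<phi> t + \<eta> / 4 * (real n * \<phi> t)"
    and nlo: "real n * \<phi> t - \<eta> / 4 * (real n * \<phi> t) \<le> real n * \<phi> u" if "\<bar>u - t\<bar> \<le> h" for u
    using mult_left_mono[OF up[OF that], of "real n"] mult_left_mono[OF lo[OF that], of "real n"]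
    by (simp_all add: algebra_simps)
  have "\<phi> L \<le> \<phi> t" by (rule phi_antimono[OF t])
  then have "\<eta> / 4 * (real n * \<phi> L) \<le> \<eta> / 4 * (real n * \<phi> t)" using \<eta> by (intro mult_left_mono) auto
  then have \<delta>': "\<delta> \<le> \<eta> / 4 * (real n * \<phi> t)" using \<delta> by linarith
  have A: "\<bar>upper_sum z n t - real n * \<phi> t\<bar> \<le> 2 * (\<eta> / 4 * (real n * \<phi> t))"
    using between gp gq nup[OF pt(1)] nup[OF pt(2)] nlo[OF pt(1)] nlo[OF pt(2)] \<delta>' by linarith
  have "\<bar>sample_mean z n * real (card {k\<in>{1..n}. t < z k})\<bar> \<le> \<bar>sample_mean z n\<bar> * real n"
  proof -
    have "card {k\<in>{1..n}. t < z k} \<le> card {1..n}" by (intro card_mono) auto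
    then show ?thesis unfolding abs_mult by (intro mult_left_mono) auto
  qed
  also have "\<dots> \<le> \<delta>" using mean by (cases "n = 0") (auto simp: sample_mean_def abs_mult)
  finally show ?thesis
    unfolding upper_excess_alt using A \<delta>' \<phi>n \<eta> mult_nonneg_nonneg[of \<eta> "real n * \<phi> t"] by linarith
qed

lemma not_wide_gapD:
  assumes "\<not> wide_gap z n a s" "j \<in> {1..n}" "D \<in> Pow ({1..n} - {j}) - {{}}" "a \<le> z j"
  obtains i where "i \<in> {1..n} - {j}" "\<not> (if i \<in> D then z j + s / real (card D) \<le> z i else z i \<le> z j)"
  using assms unfolding wide_gap_def by blast

definition no_isolated :: "(nat \<Rightarrow> real) \<Rightarrow> nat \<Rightarrow> real \<Rightarrow> (real \<Rightarrow> real) \<Rightarrow> bool" where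
  "no_isolated z n L g \<longleftrightarrow> (\<forall>j\<in>{1..n}. \<not> (z j \<in> {-L..L} \<and> (\<forall>k\<in>{1..n} - {j}. z k \<notin> {z j..z j + g (z j)})))"

text \<open>
  The assumptions of this context describe a sample of typical shape. The number \<open>L\<close> bounds
  the bulk, \<open>Lt\<close> is where the tails start. The two regions overlap, and \<open>excess\<close> and \<open>cross\<close>
  force a sample point between \<open>- L\<close> and \<open>- Lt\<close>, so that no gap escapes both.
\<close>
context
  fixes z :: "nat \<Rightarrow> real" and n :: nat and L Lt \<eta> B s c :: real
  assumes n: "n \<ge> 2" and inj: "inj_on z {1..n}"
    and var: "\<bar>sample_variance z n - 1\<bar> \<le> \<eta>" and \<eta>: "0 < \<eta>" "\<eta> < 1" and c: "c > 0"
    and mean: "\<bar>sample_mean z n\<bar> \<le> 1"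
    and bound: "\<And>j. j \<in> {1..n} \<Longrightarrow> \<bar>z j\<bar> \<le> B" and B: "B \<ge> 0"
    and excess: "\<And>t. \<bar>t\<bar> \<le> L \<Longrightarrow> \<bar>upper_excess z n t - real n * \<phi> t\<bar> \<le> \<eta> * (real n * \<phi> t)"
    and tail: "\<not> wide_gap z n Lt s" "\<not> wide_gap (\<lambda>i. - z i) n Lt s" and s: "s * (B + 1) \<le> c * (1 - \<eta>)"
    and cross: "\<phi> L * (1 + \<eta>) < \<phi> Lt * (1 - \<eta>)" and Lt: "0 < Lt" "Lt \<le> L"
begin

lemma excess_bounds:
  assumes "\<bar>t\<bar> \<le> L"
  shows "real n * \<phi> t * (1 - \<eta>) \<le> upper_excess z n t" "upper_excess z n t \<le> real n * \<phi> t * (1 + \<eta>)"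
  using excess[OF assms] by (simp_all add: abs_le_iff algebra_simps)

lemma variance_bounds: "c * (1 - \<eta>) \<le> c * sample_variance z n" "c * sample_variance z n \<le> c * (1 + \<eta>)" "sample_variance z n > 0"
  using var \<eta> c by (auto intro!: mult_left_mono)

lemma no_isolated_of_cluster_index_less:
  assumes less: "real n * cluster_index z n < c"
  shows "no_isolated z n L (\<lambda>t. c * (1 + \<eta>) / (1 - \<eta>) / (real n * \<phi> t))"
  unfolding no_isolated_def
proof (intro ballI notI, elim conjE)
  fix j assume j: "j \<in> {1..n}" and zj: "z j \<in> {-L..L}"
    and iso: "\<forall>k\<in>{1..n} - {j}. z k \<notin> {z j..z j + c * (1 + \<eta>) / (1 - \<eta>) / (real n * \<phi> (z j))}"
  have zj': "\<bar>z j\<bar> \<le> L" using zj by auto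
  have pos: "real n * \<phi> (z j) > 0" using n phi_pos[of "z j"] by simp
  define S where "S = {k \<in> {1..n}. z j < z k}"
  \<comment> \<open>A largest sample point in the bulk is impossible: the excess there would vanish.\<close>
  have "S \<noteq> {}"
  proof
    assume "S = {}"
    then have "{k. k \<in> {1..n} \<and> z j < z k} = {}" by (auto simp: S_def)
    then have "upper_excess z n (z j) = 0" unfolding upper_excess_def by (simp only: sum.empty)
    moreover have "0 < real n * \<phi> (z j) * (1 - \<eta>)" using pos \<eta> by simp
    ultimately show False using excess_bounds(1)[OF zj'] by linarith
  qed
  moreover have "finite S" by (simp add: S_def)
  ultimately obtain k where k: "k \<in> S" "\<And>i. i \<in> S \<Longrightarrow> z k \<le> z i"
    using ex_is_arg_min_if_finite[of S z] by (auto simp: is_arg_min_linorder)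
  have "consecutive z n j k"
    unfolding consecutive_def using k j by (auto simp: S_def not_less) (meson not_le_imp_less)
  then have "upper_excess z n (z j) * (z k - z j) < c * sample_variance z n"
    using less cluster_index_less_iff[OF n inj variance_bounds(3)] by blast
  also have "\<dots> \<le> c * (1 + \<eta>)" by (rule variance_bounds)
  finally have "upper_excess z n (z j) * (z k - z j) < c * (1 + \<eta>)" .
  moreover have "real n * \<phi> (z j) * (1 - \<eta>) * (z k - z j) \<le> upper_excess z n (z j) * (z k - z j)"
    using excess_bounds(1)[OF zj'] k by (intro mult_right_mono) (auto simp: S_def)
  ultimately have "(z k - z j) * ((1 - \<eta>) * (real n * \<phi> (z j))) < c * (1 + \<eta>)" by (simp add: mult_ac)
  then have "z k - z j < c * (1 + \<eta>) / ((1 - \<eta>) * (real n * \<phi> (z j)))"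
    using pos \<eta> by (subst pos_less_divide_eq) auto
  then have "z k \<in> {z j..z j + c * (1 + \<eta>) / (1 - \<eta>) / (real n * \<phi> (z j))}"
    using k by (auto simp: S_def)
  moreover have "k \<in> {1..n} - {j}" using k(1) by (auto simp: S_def)
  ultimately show False using iso by blast
qed

lemma upper_tail_gap:
  assumes cons: "consecutive z n j k" and zj: "Lt \<le> z j"
  shows "upper_excess z n (z j) * (z k - z j) < c * sample_variance z n"
proof -
  have jk: "j \<in> {1..n}" "k \<in> {1..n}" "z j < z k" and gap: "\<And>i. i \<in> {1..n} \<Longrightarrow> z i \<le> z j \<or> z k \<le> z i"
    using cons by (auto simp: consecutive_def)
  define D where "D = {i \<in> {1..n}. z j < z i}"
  have D: "D \<in> Pow ({1..n} - {j}) - {{}}" using jk by (auto simp: D_def)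
  then have cD: "card D > 0" by (auto simp: card_gt_0_iff D_def)
  obtain i where i0: "i \<in> {1..n} - {j}" "\<not> (if i \<in> D then z j + s / real (card D) \<le> z i else z i \<le> z j)"
    by (rule not_wide_gapD[OF tail(1) jk(1) D zj])
  have iD: "i \<in> D"
  proof (rule ccontr)
    assume "i \<notin> D"
    then show False using i0 by (simp add: D_def)
  qed
  then have i: "i \<in> D" "z i < z j + s / real (card D)" using i0 by simp_all
  have "z k \<le> z i" using gap[of i] i by (auto simp: D_def)
  then have "z k - z j < s / real (card D)" using i by linarith
  then have g: "real (card D) * (z k - z j) < s" using cD by (simp add: pos_less_divide_eq mult.commute)
  have "upper_excess z n (z j) \<le> (\<Sum>i\<in>D. B + 1)"
    unfolding upper_excess_def D_def using bound mean by (intro sum_mono) fastforce+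
  then have "upper_excess z n (z j) * (z k - z j) \<le> (real (card D) * (B + 1)) * (z k - z j)"
    using jk by (intro mult_right_mono) auto
  also have "\<dots> = (real (card D) * (z k - z j)) * (B + 1)" by (simp add: mult_ac)
  also have "\<dots> < s * (B + 1)" using g B by (intro mult_strict_right_mono) auto
  also have "\<dots> \<le> c * (1 - \<eta>)" by (rule s)
  also have "\<dots> \<le> c * sample_variance z n" by (rule variance_bounds)
  finally show ?thesis .
qed

text \<open>
  The reflected sample turns the right end \<open>z k\<close> of the gap into the left end. The excess
  at \<open>z j\<close> is also the sum of the deviations below the mean, taken over the points up to
  \<open>z j\<close>.
\<close>
lemma lower_tail_gap:
  assumes cons: "consecutive z n j k" and zk: "z k \<le> - Lt"
  shows "upper_excess z n (z j) * (z k - z j) < c * sample_variance z n"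
proof -
  have jk: "j \<in> {1..n}" "k \<in> {1..n}" "z j < z k" and gap: "\<And>i. i \<in> {1..n} \<Longrightarrow> z i \<le> z j \<or> z k \<le> z i"
    using cons by (auto simp: consecutive_def)
  define D where "D = {i \<in> {1..n}. z i < z k}"
  have D: "D \<in> Pow ({1..n} - {k}) - {{}}" using jk by (auto simp: D_def)
  then have cD: "card D > 0" by (auto simp: card_gt_0_iff D_def)
  have zk': "Lt \<le> - z k" using zk by simp
  obtain i where i0: "i \<in> {1..n} - {k}" "\<not> (if i \<in> D then - z k + s / real (card D) \<le> - z i else - z i \<le> - z k)"
    by (rule not_wide_gapD[OF tail(2) jk(2) D zk'])
  have iD: "i \<in> D"
  proof (rule ccontr)
    assume "i \<notin> D"
    then show False using i0 by (simp add: D_def)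
  qed
  then have i: "i \<in> D" "- z i < - z k + s / real (card D)" using i0 by simp_all
  have "z i \<le> z j" using gap[of i] i by (auto simp: D_def)
  then have "z k - z j < s / real (card D)" using i by linarith
  then have g: "real (card D) * (z k - z j) < s" using cD by (simp add: pos_less_divide_eq mult.commute)
  have "(\<Sum>i=1..n. z i - sample_mean z n) = 0"
    using n by (simp add: sum_subtractf sample_mean_def)
  moreover have "(\<Sum>i=1..n. z i - sample_mean z n) = (\<Sum>i\<in>{i. i \<in> {1..n} \<and> z j < z i} \<union> D. z i - sample_mean z n)"
    using gap jk by (intro sum.cong) (force simp: D_def)+
  moreover have "\<dots> = upper_excess z n (z j) + (\<Sum>i\<in>D. z i - sample_mean z n)"
    unfolding upper_excess_def using gap jk by (intro sum.union_disjoint) (force simp: D_def)+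
  ultimately have "upper_excess z n (z j) = (\<Sum>i\<in>D. sample_mean z n - z i)"
    by (simp add: sum_subtractf)
  also have "\<dots> \<le> (\<Sum>i\<in>D. B + 1)"
    unfolding D_def using bound mean by (intro sum_mono) fastforce+
  finally have "upper_excess z n (z j) * (z k - z j) \<le> (real (card D) * (B + 1)) * (z k - z j)"
    using jk by (intro mult_right_mono) auto
  also have "\<dots> = (real (card D) * (z k - z j)) * (B + 1)" by (simp add: mult_ac)
  also have "\<dots> < s * (B + 1)" using g B by (intro mult_strict_right_mono) auto
  also have "\<dots> \<le> c * (1 - \<eta>)" by (rule s)
  also have "\<dots> \<le> c * sample_variance z n" by (rule variance_bounds)
  finally show ?thesis .
qed

lemma cluster_index_less_of_no_isolated:
  assumes ni: "no_isolated z n L (\<lambda>t. c * (1 - 2 * \<eta>) / (1 + \<eta>) / (real n * \<phi> t))"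
  shows "real n * cluster_index z n < c"
  unfolding cluster_index_less_iff[OF n inj variance_bounds(3)]
proof (intro allI impI)
  fix j k assume cons: "consecutive z n j k"
  then have jk: "j \<in> {1..n}" "k \<in> {1..n}" "z j < z k" and gap: "\<And>i. i \<in> {1..n} \<Longrightarrow> z i \<le> z j \<or> z k \<le> z i"
    by (auto simp: consecutive_def)
  consider "Lt \<le> z j" | "z k \<le> - Lt" | "z j < Lt" "- Lt < z k" by linarith
  then show "upper_excess z n (z j) * (z k - z j) < c * sample_variance z n"
  proof cases
    case 3
    \<comment> \<open>A gap that covers the interval from \<open>- L\<close> to \<open>- Lt\<close> would make the excess constant on it.\<close>
    have "- L \<le> z j"
    proof (rule ccontr)
      assume "\<not> - L \<le> z j"
      then have "{i \<in> {1..n}. - L < z i} = {i \<in> {1..n}. - Lt < z i}"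
        using gap 3 Lt by force
      then have "upper_excess z n (- L) = upper_excess z n (- Lt)"
        unfolding upper_excess_def by simp
      then have "real n * \<phi> Lt * (1 - \<eta>) \<le> real n * \<phi> L * (1 + \<eta>)"
        using excess_bounds(2)[of "- L"] excess_bounds(1)[of "- Lt"] Lt by (simp add: phi_minus)
      then have "real n * (\<phi> Lt * (1 - \<eta>)) \<le> real n * (\<phi> L * (1 + \<eta>))" by (simp only: mult.assoc)
      then show False using cross n by simp
    qed
    then have zj: "\<bar>z j\<bar> \<le> L" using 3 Lt by auto
    have pos: "real n * \<phi> (z j) > 0" using n phi_pos[of "z j"] by simp
    obtain i where i: "i \<in> {1..n}" "i \<noteq> j" "z j \<le> z i" "z i \<le> z j + c * (1 - 2 * \<eta>) / (1 + \<eta>) / (real n * \<phi> (z j))"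
    proof -
      have "z j \<in> {-L..L}" using zj by auto
      then have "\<not> (\<forall>i\<in>{1..n} - {j}. z i \<notin> {z j..z j + c * (1 - 2 * \<eta>) / (1 + \<eta>) / (real n * \<phi> (z j))})"
        using bspec[OF ni[unfolded no_isolated_def] jk(1)] by (simp only: simp_thms)
      then obtain i where "i \<in> {1..n} - {j}" "z i \<in> {z j..z j + c * (1 - 2 * \<eta>) / (1 + \<eta>) / (real n * \<phi> (z j))}"
        by metis
      then show ?thesis by (intro that[of i]) auto
    qed
    have "z i \<noteq> z j" using inj i jk by (auto dest: inj_onD)
    then have "z k \<le> z i" using gap[OF i(1)] i by auto
    then have "z k - z j \<le> c * (1 - 2 * \<eta>) / (1 + \<eta>) / (real n * \<phi> (z j))" using i by linarith
    then have "z k - z j \<le> c * (1 - 2 * \<eta>) / (real n * \<phi> (z j) * (1 + \<eta>))" by (simp add: mult.commute)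
    then have g: "real n * \<phi> (z j) * (1 + \<eta>) * (z k - z j) \<le> c * (1 - 2 * \<eta>)"
      using pos \<eta> by (subst (asm) pos_le_divide_eq) (auto simp: mult.commute)
    have "upper_excess z n (z j) * (z k - z j) \<le> real n * \<phi> (z j) * (1 + \<eta>) * (z k - z j)"
      using excess_bounds(2)[OF zj] jk by (intro mult_right_mono) auto
    also have "\<dots> \<le> c * (1 - 2 * \<eta>)" by (rule g)
    also have "\<dots> < c * (1 - \<eta>)" using c \<eta> by (intro mult_strict_left_mono) auto
    also have "\<dots> \<le> c * sample_variance z n" by (rule variance_bounds)
    finally show ?thesis .
  qed (use upper_tail_gap lower_tail_gap cons in auto)
qed

end

section \<open>Typical samples\<close>

text \<open>
  The tolerance for relative errors must be of smaller order than \<open>1 / ln n\<close>, because it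
  is multiplied by a level of order \<open>ln n\<close>.

  The constants in the next three definitions have to satisfy the following. Put
  \<open>w = sqrt (2 * ln n)\<close>. Then \<open>\<phi> (\<gamma> w)\<close> is of order
  \<open>n powr (- \<gamma>\<^sup>2)\<close>. The bulk needs \<open>n \<phi>\<close> above the order \<open>sqrt n\<close> of
  the random fluctuations, hence \<open>(2/3)\<^sup>2 = 4/9 < 1/2\<close>. All points stay below
  \<open>21/20 w\<close>, as \<open>(21/20)\<^sup>2 > 1\<close>. The tail beyond \<open>13/20 w\<close> contains about
  \<open>n powr (1 - 169/400)\<close> points, each of which starts a wide gap with probability about
  \<open>n powr (- (13/20) / (21/20))\<close>, and \<open>1 - 169/400 - 13/21 < 0\<close>. Finally
  \<open>13/20 < 2/3\<close> makes the bulk and the tails overlap.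
\<close>
definition tol :: "nat \<Rightarrow> real" where "tol n = 1 / (ln (real n))\<^sup>2"
definition bulk :: "nat \<Rightarrow> real" where "bulk n = 2 / 3 * sqrt (2 * ln (real n))"
definition tail_start :: "nat \<Rightarrow> real" where "tail_start n = 13 / 20 * sqrt (2 * ln (real n))"
definition max_level :: "nat \<Rightarrow> real" where "max_level n = 21 / 20 * sqrt (2 * ln (real n))"
definition sum_error :: "nat \<Rightarrow> real" where "sum_error n = tol n / 4 * (real n * \<phi> (bulk n))"

text \<open>
  On the bulk \<open>\<phi>\<close> changes over one cell by a relative amount of order
  \<open>bulk n * mesh n\<close>, which is of order \<open>ln n powr (- 5/2)\<close> and so below the
  tolerance. With \<open>grid_size n\<close> cells on each side the grid extends to about \<open>ln n\<close>,
  beyond the bulk.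
\<close>
definition mesh :: "nat \<Rightarrow> real" where "mesh n = 1 / ln (real n) ^ 3"
definition grid_size :: "nat \<Rightarrow> nat" where "grid_size n = nat \<lceil>ln (real n) ^ 4\<rceil>"
definition level :: "real \<Rightarrow> nat \<Rightarrow> real" where "level x n = x + ln (real n)"
definition tail_gap :: "real \<Rightarrow> nat \<Rightarrow> real" where
  "tail_gap x n = level x n * (1 - tol n) / (max_level n + 1)"

definition typical :: "real \<Rightarrow> (nat \<Rightarrow> real) \<Rightarrow> nat \<Rightarrow> bool" where
  "typical x z n \<longleftrightarrow> inj_on z {1..n} \<and>
     \<bar>\<Sum>j=1..n. z j\<bar> < sum_error n \<and>
     \<bar>(\<Sum>j=1..n. (z j)\<^sup>2) - real n\<bar> < real n * tol n / 2 \<and>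
     (\<forall>i\<in>{- int (grid_size n)..int (grid_size n)}.
        \<bar>upper_sum z n (of_int i * mesh n) - real n * \<phi> (of_int i * mesh n)\<bar> < sum_error n) \<and>
     (\<forall>j\<in>{1..n}. z j < max_level n) \<and> (\<forall>j\<in>{1..n}. - z j < max_level n) \<and>
     \<not> wide_gap z n (tail_start n) (tail_gap x n) \<and> \<not> wide_gap (\<lambda>i. - z i) n (tail_start n) (tail_gap x n)"

lemma phi_bulk: "eventually (\<lambda>n. \<phi> (bulk n) = 1 / sqrt (2 * pi) * exp (- (4 / 9) * ln (real n))) sequentially"
  using eventually_ge_at_top[of 1]
  by eventually_elim (simp add: std_normal_density_def bulk_def power_mult_distrib power_divide)

lemma phi_tail_start: "eventually (\<lambda>n. \<phi> (tail_start n) = 1 / sqrt (2 * pi) * exp (- (169 / 400) * ln (real n))) sequentially"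
  using eventually_ge_at_top[of 1]
  by eventually_elim (simp add: std_normal_density_def tail_start_def power_mult_distrib power_divide)

lemma parameters_eventually:
  "eventually (\<lambda>n. n \<ge> 2 \<and> 0 < tol n \<and> tol n < 1 \<and> level x n > 0 \<and> mesh n > 0 \<and>
     bulk n \<le> (real (grid_size n) - 1) * mesh n \<and>
     exp ((bulk n + mesh n) * mesh n) \<le> 1 + tol n / 4 \<and>
     \<phi> (bulk n) * (1 + tol n) < \<phi> (tail_start n) * (1 - tol n) \<and>
     0 < tail_start n \<and> tail_start n \<le> bulk n \<and> 0 \<le> max_level n) sequentially"
proof -
  define K :: real where "K = 1 / sqrt (2 * pi)"
  have K: "K > 0" by (simp add: K_def)
  have "eventually (\<lambda>n. K * exp (- (4/9) * ln (real n)) * (1 + 1 / (ln (real n))\<^sup>2) <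
      K * exp (- (169/400) * ln (real n)) * (1 - 1 / (ln (real n))\<^sup>2)) sequentially"
    using K by real_asymp
  then have cross: "eventually (\<lambda>n. \<phi> (bulk n) * (1 + tol n) < \<phi> (tail_start n) * (1 - tol n)) sequentially"
    using phi_bulk phi_tail_start by eventually_elim (simp only: tol_def K_def)
  have "eventually (\<lambda>n. bulk n \<le> (ln (real n) ^ 4 - 1) * mesh n) sequentially"
    unfolding bulk_def mesh_def by real_asymp
  moreover have "eventually (\<lambda>n. mesh n > 0) sequentially" unfolding mesh_def by real_asymp
  ultimately have grid: "eventually (\<lambda>n. mesh n > 0 \<and> bulk n \<le> (real (grid_size n) - 1) * mesh n) sequentially"
  proof eventually_elim
    case (elim n)
    have "ln (real n) ^ 4 - 1 \<le> real (grid_size n) - 1" unfolding grid_size_def by (simp add: real_nat_ceiling_ge)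
    then have "(ln (real n) ^ 4 - 1) * mesh n \<le> (real (grid_size n) - 1) * mesh n"
      using elim by (intro mult_right_mono) auto
    with elim show ?case by linarith
  qed
  have 1: "eventually (\<lambda>n. exp ((bulk n + mesh n) * mesh n) \<le> 1 + tol n / 4) sequentially"
    unfolding bulk_def mesh_def tol_def by real_asymp
  have 2: "eventually (\<lambda>n. level x n > 0) sequentially" unfolding level_def by real_asymp
  have 3: "eventually (\<lambda>n. 0 < tol n) sequentially" "eventually (\<lambda>n. tol n < 1) sequentially"
    unfolding tol_def by real_asymp+
  have 4: "eventually (\<lambda>n. ln (real n) > 0) sequentially" by real_asymp
  show ?thesis
    using cross grid 1 2 3 4 eventually_ge_at_top[of 2]
    by eventually_elim (simp add: tail_start_def bulk_def max_level_def)
qed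

lemma sample_variance_alt:
  assumes "n > 0"
  shows "sample_variance z n = (\<Sum>j=1..n. (z j)\<^sup>2) / real n - (sample_mean z n)\<^sup>2"
proof -
  define m where "m = sample_mean z n"
  have s: "(\<Sum>j=1..n. z j) = real n * m" using assms by (simp add: m_def sample_mean_def)
  have "(\<Sum>j=1..n. (z j - m)\<^sup>2) = (\<Sum>j=1..n. (z j)\<^sup>2) - 2 * m * (\<Sum>j=1..n. z j) + real n * m\<^sup>2"
    by (simp add: power2_diff sum.distrib sum_subtractf sum_distrib_left mult_ac)
  also have "\<dots> = (\<Sum>j=1..n. (z j)\<^sup>2) - real n * m\<^sup>2" unfolding s by (simp add: power2_eq_square)
  finally show ?thesis
    unfolding sample_variance_def m_def[symmetric] using assms by (simp add: diff_divide_distrib)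
qed

lemma phi_le_1: "\<phi> t \<le> 1"
proof -
  have "1 \<le> sqrt (2 * pi)" using pi_gt3 by simp
  then have "1 / sqrt (2 * pi) * exp (- t\<^sup>2 / 2) \<le> 1 * 1" by (intro mult_mono) auto
  then show ?thesis unfolding std_normal_density_def by simp
qed

text \<open>
  Replacing \<open>H\<close> by \<open>n \<phi>\<close> and the variance by \<open>1\<close> changes the level by factors
  \<open>1 \<plusminus> O(tol n)\<close>; the factor \<open>1 - 2 * tol n\<close> leaves room for a strict
  inequality.
\<close>
lemma typical_sandwich:
  "eventually (\<lambda>n. \<forall>z. typical x z n \<longrightarrow>
     (real n * cluster_index z n < level x n \<longrightarrow>
        no_isolated z n (bulk n) (\<lambda>t. level x n * (1 + tol n) / (1 - tol n) / (real n * \<phi> t))) \<and>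
     (no_isolated z n (bulk n) (\<lambda>t. level x n * (1 - 2 * tol n) / (1 + tol n) / (real n * \<phi> t)) \<longrightarrow>
        real n * cluster_index z n < level x n)) sequentially"
  using parameters_eventually[of x]
proof (eventually_elim, intro allI impI)
  fix n z
  assume par: "n \<ge> 2 \<and> 0 < tol n \<and> tol n < 1 \<and> level x n > 0 \<and> mesh n > 0 \<and>
     bulk n \<le> (real (grid_size n) - 1) * mesh n \<and>
     exp ((bulk n + mesh n) * mesh n) \<le> 1 + tol n / 4 \<and>
     \<phi> (bulk n) * (1 + tol n) < \<phi> (tail_start n) * (1 - tol n) \<and>
     0 < tail_start n \<and> tail_start n \<le> bulk n \<and> 0 \<le> max_level n"
    and tz: "typical x z n"
  from par have n: "n \<ge> 2" and tol: "0 < tol n" "tol n < 1" by auto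
  have sum: "\<bar>\<Sum>j=1..n. z j\<bar> < sum_error n" and sq: "\<bar>(\<Sum>j=1..n. (z j)\<^sup>2) - real n\<bar> < real n * tol n / 2"
    using tz by (auto simp: typical_def)
  have "sum_error n \<le> tol n / 4 * (real n * 1)"
    unfolding sum_error_def using tol phi_le_1 by (intro mult_left_mono) auto
  then have "\<bar>\<Sum>j=1..n. z j\<bar> \<le> real n * (tol n / 4)" using sum by (simp add: mult.commute)
  then have m: "\<bar>sample_mean z n\<bar> \<le> tol n / 4"
    using n by (simp add: sample_mean_def abs_mult field_simps)
  have m1: "\<bar>sample_mean z n\<bar> \<le> 1" using m tol by linarith
  have m2: "(sample_mean z n)\<^sup>2 \<le> tol n / 4"
  proof -
    have "\<bar>sample_mean z n\<bar> * \<bar>sample_mean z n\<bar> \<le> (tol n / 4) * 1"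
      using m m1 by (intro mult_mono) auto
    then show ?thesis by (simp add: power2_eq_square)
  qed
  have "\<bar>(\<Sum>j=1..n. (z j)\<^sup>2) / real n - 1\<bar> \<le> tol n / 2"
  proof -
    have "(\<Sum>j=1..n. (z j)\<^sup>2) / real n - 1 = ((\<Sum>j=1..n. (z j)\<^sup>2) - real n) / real n"
      using n by (simp add: diff_divide_distrib)
    then have "\<bar>(\<Sum>j=1..n. (z j)\<^sup>2) / real n - 1\<bar> = \<bar>(\<Sum>j=1..n. (z j)\<^sup>2) - real n\<bar> / real n" by simp
    also have "\<dots> \<le> (real n * tol n / 2) / real n" using sq by (intro divide_right_mono) auto
    finally show ?thesis using n by simp
  qed
  then have var: "\<bar>sample_variance z n - 1\<bar> \<le> tol n"
    using n m2 tol zero_le_power2[of "sample_mean z n"] by (subst sample_variance_alt) (linarith+)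
  have excess: "\<bar>upper_excess z n t - real n * \<phi> t\<bar> \<le> tol n * (real n * \<phi> t)" if "\<bar>t\<bar> \<le> bulk n" for t
  proof (rule upper_excess_uniform[where h="mesh n" and L="bulk n" and m="grid_size n" and \<delta>="sum_error n"])
    show "\<bar>upper_sum z n (of_int i * mesh n) - real n * \<phi> (of_int i * mesh n)\<bar> \<le> sum_error n"
      if "i \<in> {- int (grid_size n)..int (grid_size n)}" for i
      using tz that unfolding typical_def by (auto intro: less_imp_le)
  qed (use par sum that in \<open>auto simp: sum_error_def\<close>)
  have bound: "\<bar>z j\<bar> \<le> max_level n" if "j \<in> {1..n}" for j
    using tz that unfolding typical_def by (auto simp: abs_le_iff intro: less_imp_le)
  have s: "tail_gap x n * (max_level n + 1) \<le> level x n * (1 - tol n)"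
    using par by (simp add: tail_gap_def)
  have inj: "inj_on z {1..n}" and
    t: "\<not> wide_gap z n (tail_start n) (tail_gap x n)" "\<not> wide_gap (\<lambda>i. - z i) n (tail_start n) (tail_gap x n)"
    using tz by (simp_all add: typical_def)
  have c: "level x n > 0" and B: "0 \<le> max_level n"
    and cross: "\<phi> (bulk n) * (1 + tol n) < \<phi> (tail_start n) * (1 - tol n)"
    and ts: "0 < tail_start n" "tail_start n \<le> bulk n"
    using par by auto
  show "(real n * cluster_index z n < level x n \<longrightarrow>
        no_isolated z n (bulk n) (\<lambda>t. level x n * (1 + tol n) / (1 - tol n) / (real n * \<phi> t))) \<and>
     (no_isolated z n (bulk n) (\<lambda>t. level x n * (1 - 2 * tol n) / (1 + tol n) / (real n * \<phi> t)) \<longrightarrow>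
        real n * cluster_index z n < level x n)"
  proof (intro conjI impI)
    assume less: "real n * cluster_index z n < level x n"
    show "no_isolated z n (bulk n) (\<lambda>t. level x n * (1 + tol n) / (1 - tol n) / (real n * \<phi> t))"
      by (rule no_isolated_of_cluster_index_less
            [OF n inj var tol c m1 _ B _ t s cross ts less]) (fact bound excess)+
  next
    assume ni: "no_isolated z n (bulk n) (\<lambda>t. level x n * (1 - 2 * tol n) / (1 + tol n) / (real n * \<phi> t))"
    show "real n * cluster_index z n < level x n"
      by (rule cluster_index_less_of_no_isolated
            [OF n inj var tol c m1 _ B _ t s cross ts ni]) (fact bound excess)+
  qed
qed

context gaussian_sample
begin

lemma prob_sum_deviation:
  fixes f :: "real \<Rightarrow> real"
  assumes f: "f \<in> borel_measurable borel" and f2: "\<And>v. (f v)\<^sup>2 \<le> v\<^sup>2" and y: "y > 0"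
  shows "prob {\<omega> \<in> space M. y \<le> \<bar>(\<Sum>j=1..n. f (X j \<omega>)) - real n * integral\<^sup>L gaussian f\<bar>} \<le> real n / y\<^sup>2"
proof -
  have m: "(\<lambda>x. (f x)\<^sup>2) \<in> borel_measurable gaussian" using f by measurable
  have int: "integrable gaussian (\<lambda>x. (f x)\<^sup>2)"
    by (rule Bochner_Integration.integrable_bound[OF gaussian_moments(4) m]) (use f2 in auto)
  have "(\<integral>x. (f x)\<^sup>2 \<partial>gaussian) \<le> (\<integral>x. x\<^sup>2 \<partial>gaussian)"
    by (rule integral_mono[OF int gaussian_moments(4) f2])
  then have le: "(\<integral>x. (f x)\<^sup>2 \<partial>gaussian) \<le> 1" by (simp only: gaussian_moments)
  have "prob {\<omega> \<in> space M. y \<le> \<bar>(\<Sum>j=1..n. f (X j \<omega>)) - real n * integral\<^sup>L gaussian f\<bar>}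
      \<le> real n * (\<integral>x. (f x)\<^sup>2 \<partial>gaussian) / y\<^sup>2"
    by (rule sample_sum_deviation[OF f int y])
  also have "\<dots> \<le> real n * 1 / y\<^sup>2" using le by (intro divide_right_mono mult_left_mono) auto
  finally show ?thesis by simp
qed

lemma upper_sum_measurable: "(\<lambda>\<omega>. upper_sum (\<lambda>i. X i \<omega>) n t) \<in> borel_measurable M"
  unfolding upper_sum_def by measurable

text \<open>
  A union bound over the ways to be atypical. The terms come, in this order, from the sample
  mean and the grid, from the sample variance, from the extreme points, and from the two
  tails. Ties have probability zero.
\<close>
lemma prob_atypical_le:
  assumes par: "sum_error n > 0" "tol n > 0" "n > 0" "max_level n \<ge> 0" "tail_start n \<ge> 0" "tail_gap x n \<ge> 0"
  shows "\<exists>A\<in>events. {\<omega> \<in> space M. \<not> typical x (\<lambda>i. X i \<omega>) n} \<subseteq> A \<and>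
    prob A \<le> (2 * real (grid_size n) + 2) * real n / (sum_error n)\<^sup>2 + 12 / (real n * (tol n)\<^sup>2) +
      2 * (real n * exp (- (max_level n)\<^sup>2 / 2)) +
      2 * (real n * (exp (- (tail_start n)\<^sup>2 / 2) * exp (- (tail_gap x n * tail_start n))))"
proof -
  interpret refl: gaussian_sample M "\<lambda>i \<omega>. - X i \<omega>" by (rule gaussian_sample_minus)
  define m where "m = int (grid_size n)"
  define A1 where "A1 = {\<omega> \<in> space M. \<not> inj_on (\<lambda>i. X i \<omega>) {1..n}}"
  define A2 where "A2 = {\<omega> \<in> space M. sum_error n \<le> \<bar>\<Sum>j=1..n. X j \<omega>\<bar>}"
  define A3 where "A3 = {\<omega> \<in> space M. real n * tol n / 2 \<le> \<bar>(\<Sum>j=1..n. (X j \<omega>)\<^sup>2) - real n\<bar>}"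
  define G where "G i = {\<omega> \<in> space M. sum_error n \<le>
      \<bar>upper_sum (\<lambda>j. X j \<omega>) n (of_int i * mesh n) - real n * \<phi> (of_int i * mesh n)\<bar>}" for i :: int
  define A4 where "A4 = (\<Union>i\<in>{- m..m}. G i)"
  define A5 where "A5 = {\<omega> \<in> space M. \<exists>j\<in>{1..n}. max_level n \<le> X j \<omega>}"
  define A6 where "A6 = {\<omega> \<in> space M. \<exists>j\<in>{1..n}. max_level n \<le> - X j \<omega>}"
  define A7 where "A7 = {\<omega> \<in> space M. wide_gap (\<lambda>i. X i \<omega>) n (tail_start n) (tail_gap x n)}"
  define A8 where "A8 = {\<omega> \<in> space M. wide_gap (\<lambda>i. - X i \<omega>) n (tail_start n) (tail_gap x n)}"
  have E1: "A1 \<in> events" unfolding A1_def inj_on_def by measurable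
  have E2: "A2 \<in> events" unfolding A2_def by measurable
  have E3: "A3 \<in> events" unfolding A3_def by measurable
  have EG: "G i \<in> events" for i
  proof -
    note [measurable] = upper_sum_measurable
    show ?thesis unfolding G_def by measurable
  qed
  have E4: "A4 \<in> events" unfolding A4_def using EG by (intro sets.finite_UN) auto
  have E5: "A5 \<in> events" unfolding A5_def by measurable
  have E6: "A6 \<in> events" unfolding A6_def by measurable
  have E7: "A7 \<in> events" unfolding A7_def by (rule wide_gap_event)
  have E8: "A8 \<in> events" unfolding A8_def by (rule refl.wide_gap_event)
  have P1: "prob A1 = 0" unfolding A1_def by (rule prob_ties)
  have P2: "prob A2 \<le> real n / (sum_error n)\<^sup>2"
    unfolding A2_def using prob_sum_deviation[of "\<lambda>v. v" "sum_error n" n] par by (simp add: gaussian_moments)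
  have P3: "prob A3 \<le> 12 / (real n * (tol n)\<^sup>2)"
  proof -
    have "prob A3 \<le> real n * (\<integral>v. (v\<^sup>2)\<^sup>2 \<partial>gaussian) / (real n * tol n / 2)\<^sup>2"
      unfolding A3_def using sample_sum_deviation[of "\<lambda>v. v\<^sup>2" "real n * tol n / 2" n] par gaussian_moments by simp
    also have "\<dots> = 12 / (real n * (tol n)\<^sup>2)"
      unfolding gaussian_moments using par by (simp add: power2_eq_square field_simps)
    finally show ?thesis .
  qed
  have PG: "prob (G i) \<le> real n / (sum_error n)\<^sup>2" for i
  proof -
    let ?t = "of_int i * mesh n"
    have "prob {\<omega> \<in> space M. sum_error n \<le> \<bar>(\<Sum>j=1..n. if ?t < X j \<omega> then X j \<omega> else 0) -
        real n * integral\<^sup>L gaussian (\<lambda>v. if ?t < v then v else 0)\<bar>} \<le> real n / (sum_error n)\<^sup>2"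
      using par by (intro prob_sum_deviation) auto
    then show ?thesis unfolding G_def upper_sum_def gaussian_partial_mean .
  qed
  have P4: "prob A4 \<le> (2 * real (grid_size n) + 1) * (real n / (sum_error n)\<^sup>2)"
  proof -
    have "prob A4 \<le> (\<Sum>i\<in>{- m..m}. prob (G i))"
      unfolding A4_def using EG by (intro measure_UNION_le) auto
    also have "\<dots> \<le> (\<Sum>i\<in>{- m..m}. real n / (sum_error n)\<^sup>2)" by (intro sum_mono PG)
    also have "\<dots> = (2 * real (grid_size n) + 1) * (real n / (sum_error n)\<^sup>2)"
      by (simp add: m_def)
    finally show ?thesis .
  qed
  have P5: "prob A5 \<le> real n * exp (- (max_level n)\<^sup>2 / 2)"
    unfolding A5_def by (rule prob_max_le[OF par(4)])
  have P6: "prob A6 \<le> real n * exp (- (max_level n)\<^sup>2 / 2)"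
    unfolding A6_def by (rule refl.prob_max_le[OF par(4)])
  have tail: "real n * (measure gaussian {tail_start n..} * exp (- (tail_gap x n * tail_start n)))
     \<le> real n * (exp (- (tail_start n)\<^sup>2 / 2) * exp (- (tail_gap x n * tail_start n)))"
    using measure_gaussian_tail_le[OF par(5)] by (intro mult_left_mono mult_right_mono) auto
  have P7: "prob A7 \<le> real n * (exp (- (tail_start n)\<^sup>2 / 2) * exp (- (tail_gap x n * tail_start n)))"
    unfolding A7_def by (rule order_trans[OF prob_wide_gap_le[OF par(6)] tail])
  have P8: "prob A8 \<le> real n * (exp (- (tail_start n)\<^sup>2 / 2) * exp (- (tail_gap x n * tail_start n)))"
    unfolding A8_def by (rule order_trans[OF refl.prob_wide_gap_le[OF par(6)] tail])
  define A where "A = A1 \<union> (A2 \<union> (A3 \<union> (A4 \<union> (A5 \<union> (A6 \<union> (A7 \<union> A8))))))"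
  have EA: "A \<in> events" unfolding A_def by (intro sets.Un E1 E2 E3 E4 E5 E6 E7 E8)
  have "prob A \<le> prob A1 + (prob A2 + (prob A3 + (prob A4 + (prob A5 + (prob A6 + (prob A7 + prob A8))))))"
    unfolding A_def
    by (intro order_trans[OF measure_Un_le] add_mono order_refl sets.Un E1 E2 E3 E4 E5 E6 E7 E8)
  also have "\<dots> \<le> 0 + (real n / (sum_error n)\<^sup>2 + (12 / (real n * (tol n)\<^sup>2) +
      ((2 * real (grid_size n) + 1) * (real n / (sum_error n)\<^sup>2) +
      (real n * exp (- (max_level n)\<^sup>2 / 2) + (real n * exp (- (max_level n)\<^sup>2 / 2) +
      (real n * (exp (- (tail_start n)\<^sup>2 / 2) * exp (- (tail_gap x n * tail_start n))) +
       real n * (exp (- (tail_start n)\<^sup>2 / 2) * exp (- (tail_gap x n * tail_start n)))))))))"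
    by (intro add_mono P2 P3 P4 P5 P6 P7 P8) (simp add: P1)
  also have "\<dots> = (2 * real (grid_size n) + 2) * real n / (sum_error n)\<^sup>2 + 12 / (real n * (tol n)\<^sup>2) +
      2 * (real n * exp (- (max_level n)\<^sup>2 / 2)) +
      2 * (real n * (exp (- (tail_start n)\<^sup>2 / 2) * exp (- (tail_gap x n * tail_start n))))"
    by (simp add: algebra_simps add_divide_distrib)
  finally have PA: "prob A \<le> (2 * real (grid_size n) + 2) * real n / (sum_error n)\<^sup>2 + 12 / (real n * (tol n)\<^sup>2) +
      2 * (real n * exp (- (max_level n)\<^sup>2 / 2)) +
      2 * (real n * (exp (- (tail_start n)\<^sup>2 / 2) * exp (- (tail_gap x n * tail_start n))))" .
  have "{\<omega> \<in> space M. \<not> typical x (\<lambda>i. X i \<omega>) n} \<subseteq> A"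
  proof
    fix \<omega> assume "\<omega> \<in> {\<omega> \<in> space M. \<not> typical x (\<lambda>i. X i \<omega>) n}"
    then have w: "\<omega> \<in> space M" and nt: "\<not> typical x (\<lambda>i. X i \<omega>) n" by auto
    show "\<omega> \<in> A"
    proof (rule ccontr)
      assume "\<omega> \<notin> A"
      then have N: "\<omega> \<notin> A1" "\<omega> \<notin> A2" "\<omega> \<notin> A3" "\<omega> \<notin> A4" "\<omega> \<notin> A5" "\<omega> \<notin> A6" "\<omega> \<notin> A7" "\<omega> \<notin> A8"
        unfolding A_def by auto
      have "inj_on (\<lambda>i. X i \<omega>) {1..n}" using N(1) w unfolding A1_def by simp
      moreover have "\<bar>\<Sum>j=1..n. X j \<omega>\<bar> < sum_error n" using N(2) w unfolding A2_def by simp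
      moreover have "\<bar>(\<Sum>j=1..n. (X j \<omega>)\<^sup>2) - real n\<bar> < real n * tol n / 2" using N(3) w unfolding A3_def by simp
      moreover have "\<bar>upper_sum (\<lambda>j. X j \<omega>) n (of_int i * mesh n) - real n * \<phi> (of_int i * mesh n)\<bar> < sum_error n"
        if "i \<in> {- int (grid_size n)..int (grid_size n)}" for i
      proof -
        have "\<omega> \<notin> G i" using N(4) that unfolding A4_def m_def by blast
        then show ?thesis using w unfolding G_def by simp
      qed
      moreover have "X j \<omega> < max_level n" if "j \<in> {1..n}" for j
        using N(5) w that unfolding A5_def by (simp add: not_le)
      moreover have "- X j \<omega> < max_level n" if "j \<in> {1..n}" for j
        using N(6) w that unfolding A6_def by (simp add: not_le)
      moreover have "\<not> wide_gap (\<lambda>i. X i \<omega>) n (tail_start n) (tail_gap x n)" using N(7) w unfolding A7_def by simp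
      moreover have "\<not> wide_gap (\<lambda>i. - X i \<omega>) n (tail_start n) (tail_gap x n)" using N(8) w unfolding A8_def by simp
      ultimately have "typical x (\<lambda>i. X i \<omega>) n" unfolding typical_def by (intro conjI ballI)
      with nt show False ..
    qed
  qed
  with EA PA show ?thesis by blast
qed

end

section \<open>The Gumbel limit\<close>

lemma exp_tail_limit:
  "(\<lambda>n. real n * (exp (- (tail_start n)\<^sup>2 / 2) * exp (- (tail_gap x n * tail_start n)))) \<longlonglongrightarrow> 0"
proof -
  \<comment> \<open>In the variable \<open>w = sqrt (2 * ln n)\<close> the expression is a single exponential whose exponent is a rational function.\<close>
  define F :: "real \<Rightarrow> real" where "F w = exp (w\<^sup>2 / 2) * (exp (- (169 / 800) * w\<^sup>2) *
      exp (- ((x + w\<^sup>2 / 2) * (1 - 4 / w ^ 4) / (21 / 20 * w + 1) * (13 / 20 * w))))" for w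
  have "(F \<longlongrightarrow> 0) at_top" unfolding F_def by real_asymp
  moreover have "filterlim (\<lambda>n. sqrt (2 * ln (real n))) at_top sequentially" by real_asymp
  ultimately have "(\<lambda>n. F (sqrt (2 * ln (real n)))) \<longlonglongrightarrow> 0" by (rule filterlim_compose)
  then show ?thesis
  proof (rule Lim_transform_eventually)
    show "eventually (\<lambda>n. F (sqrt (2 * ln (real n))) =
      real n * (exp (- (tail_start n)\<^sup>2 / 2) * exp (- (tail_gap x n * tail_start n)))) sequentially"
      using eventually_ge_at_top[of 2]
    proof eventually_elim
      case (elim n)
      define w where "w = sqrt (2 * ln (real n))"
      have w2: "w\<^sup>2 = 2 * ln (real n)" using elim by (simp add: w_def)
      have w4: "w ^ 4 = 4 * (ln (real n))\<^sup>2"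
        using arg_cong[OF w2, of "\<lambda>v. v\<^sup>2"] by (simp add: power_mult_distrib power_mult[symmetric])
      have 1: "exp (w\<^sup>2 / 2) = real n" using elim by (simp add: w2)
      have 2: "- (169 / 800) * w\<^sup>2 = - (tail_start n)\<^sup>2 / 2"
        unfolding tail_start_def w_def[symmetric] by (simp add: power_mult_distrib power_divide)
      have 3: "(x + w\<^sup>2 / 2) * (1 - 4 / w ^ 4) / (21 / 20 * w + 1) * (13 / 20 * w) = tail_gap x n * tail_start n"
        unfolding tail_gap_def level_def tol_def max_level_def tail_start_def w_def[symmetric] w4 unfolding w2
        by simp
      show ?case unfolding w_def[symmetric] F_def 1 2 3 ..
    qed
  qed
qed

lemma exp_max_limit: "(\<lambda>n. real n * exp (- (max_level n)\<^sup>2 / 2)) \<longlonglongrightarrow> 0"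
proof -
  have "(\<lambda>n. real n * exp (- (441 / 400) * ln (real n))) \<longlonglongrightarrow> 0" by real_asymp
  then show ?thesis
    by (rule Lim_transform_eventually)
      (use eventually_ge_at_top[of 1] in eventually_elim, simp add: max_level_def power_mult_distrib power_divide)
qed

lemma sum_error_limit: "(\<lambda>n. (2 * real (grid_size n) + 2) * real n / (sum_error n)\<^sup>2) \<longlonglongrightarrow> 0"
proof -
  define K :: real where "K = 1 / sqrt (2 * pi)"
  have K: "K > 0" by (simp add: K_def)
  have "(\<lambda>n. (2 * ln (real n) ^ 4 + 4) * real n / ((1 / (ln (real n))\<^sup>2 / 4 *
          (real n * (K * exp (- (4 / 9) * ln (real n))))))\<^sup>2) \<longlonglongrightarrow> 0"
    using K by real_asymp
  then have lim: "(\<lambda>n. (2 * ln (real n) ^ 4 + 4) * real n / (sum_error n)\<^sup>2) \<longlonglongrightarrow> 0"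
    by (rule Lim_transform_eventually)
      (use phi_bulk in eventually_elim, simp only: sum_error_def tol_def K_def)
  show ?thesis
  proof (rule tendsto_sandwich[OF _ _ tendsto_const lim])
    show "eventually (\<lambda>n. 0 \<le> (2 * real (grid_size n) + 2) * real n / (sum_error n)\<^sup>2) sequentially"
      by (intro always_eventually allI divide_nonneg_nonneg mult_nonneg_nonneg) auto
    have l: "eventually (\<lambda>n. ln (real n) ^ 4 \<ge> 0) sequentially" by real_asymp
    show "eventually (\<lambda>n. (2 * real (grid_size n) + 2) * real n / (sum_error n)\<^sup>2 \<le>
        (2 * ln (real n) ^ 4 + 4) * real n / (sum_error n)\<^sup>2) sequentially"
      using l
    proof eventually_elim
      case (elim n)
      have "real (grid_size n) \<le> ln (real n) ^ 4 + 1" unfolding grid_size_def using elim by linarith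
      then show ?case by (intro divide_right_mono mult_right_mono) auto
    qed
  qed
qed

lemma measure_gaussian_bulk_limit: "(\<lambda>n. measure gaussian {- bulk n..bulk n}) \<longlonglongrightarrow> 1"
proof -
  have "(\<lambda>n. 1 - 2 * exp (- (4 / 9) * ln (real n))) \<longlonglongrightarrow> 1" by real_asymp
  then have lim: "(\<lambda>n. 1 - 2 * exp (- (bulk n)\<^sup>2 / 2)) \<longlonglongrightarrow> 1"
    by (rule Lim_transform_eventually)
      (use eventually_ge_at_top[of 1] in eventually_elim, simp add: bulk_def power_mult_distrib power_divide)
  have le: "1 - 2 * exp (- L\<^sup>2 / 2) \<le> measure gaussian {- L..L}" if "L \<ge> 0" for L
  proof -
    have "1 = measure gaussian ({- L..L} \<union> (uminus -` {L..} \<union> {L..}))"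
    proof -
      have "{- L..L} \<union> (uminus -` {L..} \<union> {L..}) = space gaussian" by auto
      then show ?thesis by (simp only: gaussian.prob_space)
    qed
    also have "\<dots> \<le> measure gaussian {- L..L} + (measure gaussian (uminus -` {L..}) + measure gaussian {L..})"
    proof -
      have u: "uminus -` {L..} = {..- L}" by auto
      show ?thesis unfolding u
        by (intro order_trans[OF measure_Un_le] add_mono order_refl) auto
    qed
    also have "\<dots> = measure gaussian {- L..L} + 2 * measure gaussian {L..}"
      by (simp add: measure_gaussian_minus)
    finally show ?thesis using measure_gaussian_tail_le[OF that] by linarith
  qed
  show ?thesis
  proof (rule tendsto_sandwich[OF _ _ lim tendsto_const])
    show "eventually (\<lambda>n. 1 - 2 * exp (- (bulk n)\<^sup>2 / 2) \<le> measure gaussian {- bulk n..bulk n}) sequentially"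
      using eventually_ge_at_top[of 1] by eventually_elim (intro le, simp add: bulk_def)
  qed simp
qed

lemma level_nonneg_eventually:
  fixes c :: "nat \<Rightarrow> real"
  assumes c: "(\<lambda>n. c n - ln (real n)) \<longlonglongrightarrow> x"
  shows "eventually (\<lambda>n. c n \<ge> 0) sequentially"
proof -
  have "filterlim (\<lambda>n. (c n - ln (real n)) + ln (real n)) at_top sequentially"
    by (rule filterlim_tendsto_add_at_top[OF c]) real_asymp
  then show ?thesis unfolding filterlim_at_top by simp
qed

text \<open>
  Here \<open>h n\<close> is the longest interval that occurs in the bulk. Its length is of order
  \<open>ln n * n powr (- 5/9)\<close>, so the factors that compare the mass of an interval with
  \<open>c n / n\<close> are \<open>1 + o(1 / ln n)\<close>.
\<close>
lemma interval_mass_limits: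
  fixes c :: "nat \<Rightarrow> real"
  assumes c: "(\<lambda>n. c n - ln (real n)) \<longlonglongrightarrow> x"
  defines "h \<equiv> \<lambda>n. c n / (real n * \<phi> (bulk n))"
  shows "(\<lambda>n. c n * exp (- ((bulk n + h n) * h n)) - ln (real n)) \<longlonglongrightarrow> x"
    and "(\<lambda>n. c n * exp ((bulk n + h n) * h n) - ln (real n)) \<longlonglongrightarrow> x"
proof -
  define K :: real where "K = 1 / sqrt (2 * pi)"
  have K: "K > 0" by (simp add: K_def)
  define a where "a n = ln (real n) / (real n * (K * exp (- (4 / 9) * ln (real n))))" for n
  define \<rho> where "\<rho> n = (c n - ln (real n)) * (1 / ln (real n)) + 1" for n
  define u where "u n = (bulk n + h n) * h n" for n
  have "(\<lambda>n. 1 / ln (real n)) \<longlonglongrightarrow> 0" by real_asymp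
  then have "\<rho> \<longlonglongrightarrow> x * 0 + 1"
    unfolding \<rho>_def by (intro tendsto_add tendsto_mult tendsto_const c)
  then have \<rho>: "\<rho> \<longlonglongrightarrow> 1" by simp
  have lnpos: "eventually (\<lambda>n. ln (real n) > 0) sequentially" by real_asymp
  have c\<rho>: "eventually (\<lambda>n. c n = \<rho> n * ln (real n) \<and> h n = \<rho> n * a n) sequentially"
    using lnpos phi_bulk
  proof eventually_elim
    case (elim n)
    have "c n = \<rho> n * ln (real n)" using elim(1) by (simp add: \<rho>_def field_simps)
    then show ?case unfolding h_def a_def elim(2) K_def by simp
  qed
  have L: "(\<lambda>n. bulk n * a n) \<longlonglongrightarrow> 0" "(\<lambda>n. (a n)\<^sup>2) \<longlonglongrightarrow> 0"
    "(\<lambda>n. bulk n * a n * ln (real n)) \<longlonglongrightarrow> 0" "(\<lambda>n. (a n)\<^sup>2 * ln (real n)) \<longlonglongrightarrow> 0"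
    unfolding a_def bulk_def using K by real_asymp+
  have "(\<lambda>n. \<rho> n * (bulk n * a n) + (\<rho> n)\<^sup>2 * (a n)\<^sup>2) \<longlonglongrightarrow> 1 * 0 + 1\<^sup>2 * 0"
    by (intro tendsto_add tendsto_mult tendsto_power \<rho> L)
  then have "(\<lambda>n. \<rho> n * (bulk n * a n) + (\<rho> n)\<^sup>2 * (a n)\<^sup>2) \<longlonglongrightarrow> 0" by simp
  then have u0: "u \<longlonglongrightarrow> 0"
    by (rule Lim_transform_eventually)
      (use c\<rho> in eventually_elim, simp add: u_def power2_eq_square algebra_simps)
  have "(\<lambda>n. (\<rho> n)\<^sup>2 * (bulk n * a n * ln (real n)) + \<rho> n ^ 3 * ((a n)\<^sup>2 * ln (real n))) \<longlonglongrightarrow> 1\<^sup>2 * 0 + 1 ^ 3 * 0"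
    by (intro tendsto_add tendsto_mult tendsto_power \<rho> L)
  then have "(\<lambda>n. (\<rho> n)\<^sup>2 * (bulk n * a n * ln (real n)) + \<rho> n ^ 3 * ((a n)\<^sup>2 * ln (real n))) \<longlonglongrightarrow> 0" by simp
  then have cu: "(\<lambda>n. c n * u n) \<longlonglongrightarrow> 0"
    by (rule Lim_transform_eventually)
      (use c\<rho> in eventually_elim, simp add: u_def power2_eq_square power3_eq_cube algebra_simps)
  have u1: "eventually (\<lambda>n. u n \<le> 1) sequentially"
    using order_tendstoD(2)[OF u0, of 1] by (auto elim: eventually_mono)
  have unn: "eventually (\<lambda>n. u n \<ge> 0 \<and> c n \<ge> 0) sequentially"
    using level_nonneg_eventually[OF c] lnpos
    by eventually_elim (auto simp: u_def h_def bulk_def intro!: mult_nonneg_nonneg add_nonneg_nonneg divide_nonneg_nonneg)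
  have "(\<lambda>n. (c n - ln (real n)) - c n * u n) \<longlonglongrightarrow> x - 0" by (intro tendsto_diff c cu)
  then have lower: "(\<lambda>n. (c n - ln (real n)) - c n * u n) \<longlonglongrightarrow> x" by simp
  have "(\<lambda>n. (c n - ln (real n)) + 2 * (c n * u n)) \<longlonglongrightarrow> x + 2 * 0" by (intro tendsto_add tendsto_mult tendsto_const c cu)
  then have upper: "(\<lambda>n. (c n - ln (real n)) + 2 * (c n * u n)) \<longlonglongrightarrow> x" by simp
  show "(\<lambda>n. c n * exp (- ((bulk n + h n) * h n)) - ln (real n)) \<longlonglongrightarrow> x"
  proof (rule tendsto_sandwich[OF _ _ lower c])
    show "eventually (\<lambda>n. c n - ln (real n) - c n * u n \<le> c n * exp (- ((bulk n + h n) * h n)) - ln (real n)) sequentially"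
      using unn
    proof eventually_elim
      case (elim n)
      have "c n * (1 - u n) \<le> c n * exp (- u n)"
        using elim exp_ge_add_one_self[of "- u n"] by (intro mult_left_mono) auto
      then show ?case unfolding u_def[symmetric] by (simp add: algebra_simps)
    qed
    show "eventually (\<lambda>n. c n * exp (- ((bulk n + h n) * h n)) - ln (real n) \<le> c n - ln (real n)) sequentially"
      using unn
    proof eventually_elim
      case (elim n)
      have "c n * exp (- u n) \<le> c n * 1" using elim by (intro mult_left_mono) auto
      then show ?case unfolding u_def[symmetric] by simp
    qed
  qed
  show "(\<lambda>n. c n * exp ((bulk n + h n) * h n) - ln (real n)) \<longlonglongrightarrow> x"
  proof (rule tendsto_sandwich[OF _ _ c upper])
    show "eventually (\<lambda>n. c n - ln (real n) \<le> c n * exp ((bulk n + h n) * h n) - ln (real n)) sequentially"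
      using unn
    proof eventually_elim
      case (elim n)
      have "c n * 1 \<le> c n * exp (u n)" using elim by (intro mult_left_mono) auto
      then show ?case unfolding u_def[symmetric] by simp
    qed
    show "eventually (\<lambda>n. c n * exp ((bulk n + h n) * h n) - ln (real n) \<le> c n - ln (real n) + 2 * (c n * u n)) sequentially"
      using unn u1
    proof eventually_elim
      case (elim n)
      have "exp (u n) \<le> 1 + u n + (u n)\<^sup>2" using elim by (intro exp_bound) auto
      moreover have "(u n)\<^sup>2 \<le> u n" using elim mult_left_mono[of "u n" 1 "u n"] by (simp add: power2_eq_square)
      ultimately have "c n * exp (u n) \<le> c n * (1 + 2 * u n)" using elim by (intro mult_left_mono) auto
      then show ?case unfolding u_def[symmetric] by (simp add: algebra_simps)
    qed
  qed
qed

context gaussian_sample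
begin

lemma prob_no_isolated_limit:
  fixes c :: "nat \<Rightarrow> real"
  assumes c: "(\<lambda>n. c n - ln (real n)) \<longlonglongrightarrow> x"
  shows "(\<lambda>n. prob {\<omega> \<in> space M. no_isolated (\<lambda>i. X i \<omega>) n (bulk n) (\<lambda>t. c n / (real n * \<phi> t))})
     \<longlonglongrightarrow> exp (- exp (- x))"
proof -
  define h where "h n = c n / (real n * \<phi> (bulk n))" for n
  define g where "g n t = c n / (real n * \<phi> t)" for n t
  note c0 = level_nonneg_eventually[OF c] and mass = interval_mass_limits[OF c, folded h_def]
  have lim: "(\<lambda>n. prob {\<omega> \<in> space M. \<forall>j\<in>{1..n}. \<omega> \<notin> isolated n {- bulk n..bulk n} (g n) j}) \<longlonglongrightarrow> exp (- exp (- x))"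
  proof (rule no_isolated_point_limit[where lo="\<lambda>n. c n * exp (- ((bulk n + h n) * h n)) / real n"
        and hi="\<lambda>n. c n * exp ((bulk n + h n) * h n) / real n"])
    show "{- bulk n..bulk n} \<in> sets borel" for n by simp
    show "g n \<in> borel_measurable borel" for n unfolding g_def by measurable
    show "(\<lambda>n. measure gaussian {- bulk n..bulk n}) \<longlonglongrightarrow> 1" by (rule measure_gaussian_bulk_limit)
    have pos: "eventually (\<lambda>n. n > (0::nat)) sequentially" by (rule eventually_gt_at_top)
    show "(\<lambda>n. real n * (c n * exp ((bulk n + h n) * h n) / real n) - ln (real n)) \<longlonglongrightarrow> x"
      by (rule Lim_transform_eventually[OF mass(2)]) (use pos in eventually_elim, simp)
    show "(\<lambda>n. real n * (c n * exp (- ((bulk n + h n) * h n)) / real n) - ln (real n)) \<longlonglongrightarrow> x"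
      by (rule Lim_transform_eventually[OF mass(1)]) (use pos in eventually_elim, simp)
    show "eventually (\<lambda>n. \<forall>z\<in>{- bulk n..bulk n}. 0 \<le> g n z \<and>
        c n * exp (- ((bulk n + h n) * h n)) / real n \<le> measure gaussian {z..z + g n z} \<and>
        measure gaussian {z..z + g n z} \<le> c n * exp ((bulk n + h n) * h n) / real n) sequentially"
      using c0 pos
    proof (eventually_elim, intro ballI)
      fix n z assume c0: "c n \<ge> 0" and n: "n > 0" and z: "z \<in> {- bulk n..bulk n}"
      have z': "\<bar>z\<bar> \<le> bulk n" using z by auto
      have g0: "0 \<le> g n z" using c0 by (simp add: g_def)
      have "g n z \<le> h n"
        unfolding g_def h_def using c0 n phi_pos[of "bulk n"] phi_pos[of z] phi_antimono[OF z']
        by (intro divide_left_mono mult_left_mono mult_pos_pos) auto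
      note gi = measure_gaussian_interval[OF z' g0 this]
      have gz: "g n z * \<phi> z = c n / real n" using phi_pos[of z] n by (simp add: g_def)
      show "0 \<le> g n z \<and> c n * exp (- ((bulk n + h n) * h n)) / real n \<le> measure gaussian {z..z + g n z} \<and>
        measure gaussian {z..z + g n z} \<le> c n * exp ((bulk n + h n) * h n) / real n"
        using gi g0 unfolding gz by simp
    qed
  qed
  have "{\<omega> \<in> space M. no_isolated (\<lambda>i. X i \<omega>) n (bulk n) (\<lambda>t. c n / (real n * \<phi> t))} =
      {\<omega> \<in> space M. \<forall>j\<in>{1..n}. \<omega> \<notin> isolated n {- bulk n..bulk n} (g n) j}" for n
    unfolding no_isolated_def isolated_def g_def by (intro Collect_cong conj_cong refl) simp
  with lim show ?thesis by simp
qed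

lemma no_isolated_event: "{\<omega> \<in> space M. no_isolated (\<lambda>i. X i \<omega>) n L (\<lambda>t. c / (real n * \<phi> t))} \<in> events"
proof -
  have "{\<omega> \<in> space M. no_isolated (\<lambda>i. X i \<omega>) n L (\<lambda>t. c / (real n * \<phi> t))} =
      {\<omega> \<in> space M. \<forall>j\<in>{1..n}. \<omega> \<notin> isolated n {- L..L} (\<lambda>t. c / (real n * \<phi> t)) j}"
    unfolding no_isolated_def isolated_def by (intro Collect_cong conj_cong refl) simp
  also have "\<dots> \<in> events"
  proof (intro sets.sets_Collect_finite_All sets.sets_Collect_neg)
    fix j
    have "isolated n {- L..L} (\<lambda>t. c / (real n * \<phi> t)) j \<in> events"
      by (rule isolated_event) measurable
    then show "{\<omega> \<in> space M. \<omega> \<in> isolated n {- L..L} (\<lambda>t. c / (real n * \<phi> t)) j} \<in> events"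
      using sets.sets_into_space by (auto simp: Int_def[symmetric] inf.absorb2 Collect_conj_eq)
  qed simp
  finally show ?thesis .
qed

lemma cluster_index_limit:
  "(\<lambda>n. prob {\<omega> \<in> space M. real n * cluster_index (\<lambda>j. X j \<omega>) n < x + ln (real n)}) \<longlonglongrightarrow> exp (- exp (- x))"
proof -
  \<comment> \<open>The levels of the two comparison events from \<open>typical_sandwich\<close>.\<close>
  define cu where "cu n = level x n * (1 + tol n) / (1 - tol n)" for n
  define cl where "cl n = level x n * (1 - 2 * tol n) / (1 + tol n)" for n
  let ?Q = "\<lambda>c n. prob {\<omega> \<in> space M. no_isolated (\<lambda>i. X i \<omega>) n (bulk n) (\<lambda>t. c n / (real n * \<phi> t))}"
  have cu: "(\<lambda>n. cu n - ln (real n)) \<longlonglongrightarrow> x" and cl: "(\<lambda>n. cl n - ln (real n)) \<longlonglongrightarrow> x"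
    unfolding cu_def cl_def level_def tol_def by real_asymp+
  have limu: "?Q cu \<longlonglongrightarrow> exp (- exp (- x))" by (rule prob_no_isolated_limit[OF cu])
  have liml: "?Q cl \<longlonglongrightarrow> exp (- exp (- x))" by (rule prob_no_isolated_limit[OF cl])
  define err where "err n = (2 * real (grid_size n) + 2) * real n / (sum_error n)\<^sup>2 + 12 / (real n * (tol n)\<^sup>2) +
      2 * (real n * exp (- (max_level n)\<^sup>2 / 2)) +
      2 * (real n * (exp (- (tail_start n)\<^sup>2 / 2) * exp (- (tail_gap x n * tail_start n))))" for n
  have "(\<lambda>n. 12 / (real n * (tol n)\<^sup>2)) \<longlonglongrightarrow> 0" unfolding tol_def by real_asymp
  then have "err \<longlonglongrightarrow> 0 + 0 + 2 * 0 + 2 * 0"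
    unfolding err_def by (intro tendsto_add tendsto_mult tendsto_const sum_error_limit exp_max_limit exp_tail_limit)
  then have err: "err \<longlonglongrightarrow> 0" by simp
  let ?P = "\<lambda>n. prob {\<omega> \<in> space M. real n * cluster_index (\<lambda>j. X j \<omega>) n < x + ln (real n)}"
  have main: "eventually (\<lambda>n. ?Q cl n - err n \<le> ?P n \<and> ?P n \<le> ?Q cu n + err n) sequentially"
    using typical_sandwich[of x] parameters_eventually[of x]
  proof eventually_elim
    case (elim n)
    have n: "n > 0" using elim by auto
    have "0 \<le> tail_gap x n" using elim unfolding tail_gap_def by (intro divide_nonneg_nonneg mult_nonneg_nonneg) auto
    moreover have "0 < sum_error n" unfolding sum_error_def using elim phi_pos[of "bulk n"] n by simp
    ultimately obtain A where A: "A \<in> events" "{\<omega> \<in> space M. \<not> typical x (\<lambda>i. X i \<omega>) n} \<subseteq> A" "prob A \<le> err n"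
      using prob_atypical_le[of n x] elim n unfolding err_def by auto
    define S where "S = {\<omega> \<in> space M. real n * cluster_index (\<lambda>j. X j \<omega>) n < x + ln (real n)}"
    define U where "U = {\<omega> \<in> space M. no_isolated (\<lambda>i. X i \<omega>) n (bulk n) (\<lambda>t. cu n / (real n * \<phi> t))}"
    define V where "V = {\<omega> \<in> space M. no_isolated (\<lambda>i. X i \<omega>) n (bulk n) (\<lambda>t. cl n / (real n * \<phi> t))}"
    have S: "S \<in> events"
    proof -
      note [measurable] = borel_measurable_cluster_index[OF rv]
      show ?thesis unfolding S_def by measurable
    qed
    have U: "U \<in> events" unfolding U_def by (rule no_isolated_event)
    have V: "V \<in> events" unfolding V_def by (rule no_isolated_event)
    have "S \<subseteq> U \<union> A"
      using elim(1) A(2) unfolding S_def U_def cu_def level_def by blast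
    then have "prob S \<le> prob (U \<union> A)" using U A by (intro finite_measure_mono) auto
    also have "\<dots> \<le> prob U + prob A" using U A by (intro measure_Un_le) auto
    finally have 1: "prob S \<le> prob U + err n" using A by linarith
    have "V \<subseteq> S \<union> A"
      using elim(1) A(2) unfolding S_def V_def cl_def level_def by blast
    then have "prob V \<le> prob (S \<union> A)" using S A by (intro finite_measure_mono) auto
    also have "\<dots> \<le> prob S + prob A" using S A by (intro measure_Un_le) auto
    finally have 2: "prob V \<le> prob S + err n" using A by linarith
    show ?case using 1 2 unfolding S_def U_def V_def by linarith
  qed
  show ?thesis
  proof (rule tendsto_sandwich)
    show "eventually (\<lambda>n. ?Q cl n - err n \<le> ?P n) sequentially" using main by eventually_elim simp
    show "eventually (\<lambda>n. ?P n \<le> ?Q cu n + err n) sequentially" using main by eventually_elim simp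
    show "(\<lambda>n. ?Q cl n - err n) \<longlonglongrightarrow> exp (- exp (- x))" using tendsto_diff[OF liml err] by simp
    show "(\<lambda>n. ?Q cu n + err n) \<longlonglongrightarrow> exp (- exp (- x))" using tendsto_add[OF limu err] by simp
  qed
qed

end

lemma cluster_index_cong:
  assumes "\<And>j. j \<in> {1..n} \<Longrightarrow> z j = z' j"
  shows "cluster_index z n = cluster_index z' n"
proof -
  have "map z [1..<Suc n] = map z' [1..<Suc n]" using assms by (intro map_cong) auto
  then have os: "order_stat z n = order_stat z' n" by (intro ext) (simp only: order_stat_def)
  have "(\<Sum>j=1..n. z j) = (\<Sum>j=1..n. z' j)" by (rule sum.cong[OF refl assms])
  then have sm: "sample_mean z n = sample_mean z' n" unfolding sample_mean_def by (simp only:)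
  have "(\<Sum>j=1..n. (z j - sample_mean z' n)\<^sup>2) = (\<Sum>j=1..n. (z' j - sample_mean z' n)\<^sup>2)"
    using assms by (intro sum.cong) auto
  then show ?thesis unfolding cluster_index_def segment_mean_def os sm by simp
qed

theorem theorem3p1:
  fixes M :: "'a measure" and Z :: "nat \<Rightarrow> 'a \<Rightarrow> real" and x :: real
  assumes "prob_space M"
    and "prob_space.indep_vars M (\<lambda>_. borel) Z {1..}"
    and "\<And>i. i \<ge> 1 \<Longrightarrow> distributed M lborel (Z i) std_normal_density"
  shows "(\<lambda>n. measure M {\<omega> \<in> space M.
            real n * cluster_index (\<lambda>j. Z j \<omega>) n < x + ln (real n)})
         \<longlonglongrightarrow> exp (- exp (- x))"
proof -
  interpret prob_space M by (rule assms(1))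
  \<comment> \<open>The variable \<open>Z 0\<close> is unconstrained and may fail to be measurable.\<close>
  define X where "X i = (if i \<ge> 1 then Z i else (\<lambda>_. 0))" for i :: nat
  have XZ: "X i = Z i" if "i \<ge> 1" for i using that by (simp add: X_def)
  have ind: "indep_vars (\<lambda>_. borel) X {1..}"
    using assms(2) by (rule indep_vars_cong[THEN iffD1, rotated 3]) (auto simp: XZ)
  have d: "distr M borel (X i) = gaussian" if "i \<ge> 1" for i
  proof -
    have "distr M borel (Z i) = distr M lborel (Z i)" by (rule distr_cong) auto
    also have "\<dots> = gaussian" using distributed_distr_eq_density[OF assms(3)[OF that]] by (simp add: gaussian_def)
    finally show ?thesis using XZ[OF that] by simp
  qed
  have rv: "X i \<in> borel_measurable M" for i
  proof (cases "i \<ge> 1")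
    case True
    then show ?thesis using distributed_measurable[OF assms(3)[OF True]] XZ[OF True] by simp
  next
    case False
    then show ?thesis by (simp add: X_def)
  qed
  interpret gaussian_sample M X
    by unfold_locales (use rv ind d in auto)
  have "cluster_index (\<lambda>j. X j \<omega>) n = cluster_index (\<lambda>j. Z j \<omega>) n" for \<omega> n
    by (rule cluster_index_cong) (simp add: XZ)
  with cluster_index_limit[of x] show ?thesis by simp
qed

end
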